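(* (1) Each of the following classes of frames is sound and complete for $\mathsf{GBL}$: (a) the class of $[0,1]_{MV}$-valued frames; (b) the class of frames valued in finite simple MV-algebra chains. (2) Each of the following classes of frames is sound and complete for $\mathsf{BL}$: (a) the class of $[0,1]_{MV}$-valued frames based in root systems; (b) the class of $\{\mathbf{Ł}_k:k\geq2\}$-valued frames based in root systems; (c) the class of $\{\mathbf{Ł}_k:k\geq2\}$-valued frames based in finite chains. (3) For each $k\geq2$, the class of frames valued in finite simple $k$-potent MV-algebra chains is sound and complete for $\mathsf{GBL}^k$. (4) For each $k\geq2$, the class of frames valued in finite simple $k$-potent MV-algebra chains and based in root systems is sound and complete for $\mathsf{BL}^k$. (5) The class of $\mathbf{2}$-valued frames is sound and complete for $\mathsf{HA}$. (6) The class of $\mathbf{2}$-valued frames based in root systems is sound and complete for $\mathsf{GA}$.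
   Context: Residuated lattices are algebras $(A,\wedge,\vee,\cdot,\to,0,1)$ with $(A,\wedge,\vee,0,1)$ a bounded lattice, $(A,\cdot,1)$ a commutative monoid, and $xy\leq z\iff x\leq y\to z$. A GBL-algebra is a residuated lattice satisfying $x(x\to y)\approx x\wedge y$; a BL-algebra is a GBL-algebra satisfying $(x\to y)\vee(y\to x)\approx1$; a Heyting algebra is a GBL-algebra satisfying $x^2\approx x$; a Gödel algebra is a Heyting algebra satisfying $(x\to y)\vee(y\to x)\approx 1$; an MV-algebra is a BL-algebra satisfying $x\approx(x\to0)\to0$. $\mathsf{GBL},\mathsf{BL},\mathsf{HA},\mathsf{GA}$ denote the corresponding varieties. A residuated lattice is $k$-potent if it satisfies $x^{k+1}\approx x^k$; for a variety $\mathsf{V}$, $\mathsf{V}^k$ is its subvariety of $k$-potent members. $[0,1]_{MV}=([0,1],\min,\max,\cdot,\to,0,1)$ with $x\cdot y=\max\{0,x+y-1\}$, $x\to y=\min\{1,1-x+y\}$; for $k\ge2$, $\mathbf{Ł}_k$ is its subalgebra on $\{0,\frac1{k-1},\dots,\frac{k-2}{k-1},1\}$, and $\mathbf{2}=\mathbf{Ł}_2$. A root system is a poset in which $\{y:x\leq y\}$ is totally ordered for each $x$. A frame is $F=(X,\leq,\{\mathbf{A}_x:x\in X\})$ with $(X,\leq)$ a poset and residuated lattices $\mathbf{A}_x$ with common bounds $0,1$; it is based in a class $\mathsf{P}$ of posets if $(X,\leq)\in\mathsf{P}$ and valued in a class $\mathsf{C}$ of algebras if each $\mathbf{A}_x\in\mathsf{C}$.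 Its poset product $P(F)$ is the set of $f\in\prod_xA_x$ with $\Box f=f$, where $\Box(f)(x)=f(x)$ if $f(y)=1$ for all $y>x$ and $\Box(f)(x)=0$ otherwise, with pointwise $\vee,\cdot$, meet $\Box(f\wedge g)$, implication $\Box(f\to g)$, constants $0,1$. A valuation is $h\colon\mathrm{Var}\to P(F)$ with homomorphic extension $\hat h$ to terms; $F\Vdash\varphi$ means $\hat h(\varphi)(x)=1$ for all valuations $h$ and $x\in X$; $\mathsf{K}\Vdash\varphi$ means $F\Vdash\varphi$ for all $F\in\mathsf{K}$. A class $\mathsf{K}$ of frames is sound for a variety $\mathsf{V}$ if whenever $\varphi\approx1$ is valid in $\mathsf{V}$ then $\mathsf{K}\Vdash\varphi$, and complete for $\mathsf{V}$ if $\mathsf{K}\Vdash\varphi$ implies $\varphi\approx1$ is valid in $\mathsf{V}$. *)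

theory Defs
  imports Complex_Main "HOL-Algebra.Group" "HOL-Library.FuncSet" "HOL-Library.Infinite_Typeclass"
begin

record 'a rlat = "'a monoid" +
  rmeet :: "'a \<Rightarrow> 'a \<Rightarrow> 'a" (infixl \<open>\<curlywedge>\<index>\<close> 70)
  rjoin :: "'a \<Rightarrow> 'a \<Rightarrow> 'a" (infixl \<open>\<curlyvee>\<index>\<close> 65)
  rimp  :: "'a \<Rightarrow> 'a \<Rightarrow> 'a" (infixr \<open>\<leadsto>\<index>\<close> 60)
  rzero :: 'a (\<open>\<zero>\<index>\<close>)

definition rle :: "('a, 'm) rlat_scheme \<Rightarrow> 'a \<Rightarrow> 'a \<Rightarrow> bool" (infix \<open>\<preceq>\<index>\<close> 50)
  where "x \<preceq>\<^bsub>A\<^esub> y \<longleftrightarrow> x \<curlywedge>\<^bsub>A\<^esub> y = x"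

locale residuated_lattice = comm_monoid A for A :: "('a, 'm) rlat_scheme" (structure) +
  assumes meet_closed: "\<lbrakk>x \<in> carrier A; y \<in> carrier A\<rbrakk> \<Longrightarrow> x \<curlywedge> y \<in> carrier A"
    and join_closed: "\<lbrakk>x \<in> carrier A; y \<in> carrier A\<rbrakk> \<Longrightarrow> x \<curlyvee> y \<in> carrier A"
    and imp_closed: "\<lbrakk>x \<in> carrier A; y \<in> carrier A\<rbrakk> \<Longrightarrow> x \<leadsto> y \<in> carrier A"
    and zero_closed: "\<zero> \<in> carrier A"
    and meet_comm: "\<lbrakk>x \<in> carrier A; y \<in> carrier A\<rbrakk> \<Longrightarrow> x \<curlywedge> y = y \<curlywedge> x"
    and join_comm: "\<lbrakk>x \<in> carrier A; y \<in> carrier A\<rbrakk> \<Longrightarrow> x \<curlyvee> y = y \<curlyvee> x"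
    and meet_assoc: "\<lbrakk>x \<in> carrier A; y \<in> carrier A; z \<in> carrier A\<rbrakk>
          \<Longrightarrow> (x \<curlywedge> y) \<curlywedge> z = x \<curlywedge> (y \<curlywedge> z)"
    and join_assoc: "\<lbrakk>x \<in> carrier A; y \<in> carrier A; z \<in> carrier A\<rbrakk>
          \<Longrightarrow> (x \<curlyvee> y) \<curlyvee> z = x \<curlyvee> (y \<curlyvee> z)"
    and meet_join_absorb: "\<lbrakk>x \<in> carrier A; y \<in> carrier A\<rbrakk> \<Longrightarrow> x \<curlywedge> (x \<curlyvee> y) = x"
    and join_meet_absorb: "\<lbrakk>x \<in> carrier A; y \<in> carrier A\<rbrakk> \<Longrightarrow> x \<curlyvee> (x \<curlywedge> y) = x"
    and zero_least: "x \<in> carrier A \<Longrightarrow> \<zero> \<preceq> x"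
    and one_greatest: "x \<in> carrier A \<Longrightarrow> x \<preceq> \<one>"
    and residuation: "\<lbrakk>x \<in> carrier A; y \<in> carrier A; z \<in> carrier A\<rbrakk>
          \<Longrightarrow> x \<otimes> y \<preceq> z \<longleftrightarrow> x \<preceq> y \<leadsto> z"

locale gbl_algebra = residuated_lattice +
  assumes divisibility: "\<lbrakk>x \<in> carrier A; y \<in> carrier A\<rbrakk> \<Longrightarrow> x \<otimes> (x \<leadsto> y) = x \<curlywedge> y"

locale bl_algebra = gbl_algebra +
  assumes prelinearity: "\<lbrakk>x \<in> carrier A; y \<in> carrier A\<rbrakk> \<Longrightarrow> (x \<leadsto> y) \<curlyvee> (y \<leadsto> x) = \<one>"

locale heyting_algebra = gbl_algebra +
  assumes idempotence: "x \<in> carrier A \<Longrightarrow> x \<otimes> x = x"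

locale goedel_algebra = heyting_algebra +
  assumes prelinearity: "\<lbrakk>x \<in> carrier A; y \<in> carrier A\<rbrakk> \<Longrightarrow> (x \<leadsto> y) \<curlyvee> (y \<leadsto> x) = \<one>"

locale mv_algebra = bl_algebra +
  assumes involution: "x \<in> carrier A \<Longrightarrow> x = (x \<leadsto> \<zero>) \<leadsto> \<zero>"

definition GBL :: "'a rlat set" where "GBL = {A. gbl_algebra A}"
definition BL :: "'a rlat set" where "BL = {A. bl_algebra A}"
definition HA :: "'a rlat set" where "HA = {A. heyting_algebra A}"
definition GA :: "'a rlat set" where "GA = {A. goedel_algebra A}"

definition potent :: "nat \<Rightarrow> 'a rlat set \<Rightarrow> 'a rlat set"
  where "potent k V = {A \<in> V. \<forall>x\<in>carrier A. x [^]\<^bsub>A\<^esub> (k + 1) = x [^]\<^bsub>A\<^esub> k}"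

definition congruence :: "'a rlat \<Rightarrow> 'a rel \<Rightarrow> bool"
  where "congruence A \<theta> \<longleftrightarrow> equiv (carrier A) \<theta> \<and>
    (\<forall>(x, x') \<in> \<theta>. \<forall>(y, y') \<in> \<theta>.
      (x \<curlywedge>\<^bsub>A\<^esub> y, x' \<curlywedge>\<^bsub>A\<^esub> y') \<in> \<theta> \<and> (x \<curlyvee>\<^bsub>A\<^esub> y, x' \<curlyvee>\<^bsub>A\<^esub> y') \<in> \<theta> \<and>
      (x \<otimes>\<^bsub>A\<^esub> y, x' \<otimes>\<^bsub>A\<^esub> y') \<in> \<theta> \<and> (x \<leadsto>\<^bsub>A\<^esub> y, x' \<leadsto>\<^bsub>A\<^esub> y') \<in> \<theta>)"

text \<open>Simple algebras are nontrivial: there are exactly two congruences.\<close>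

definition simple_algebra :: "'a rlat \<Rightarrow> bool"
  where "simple_algebra A \<longleftrightarrow> Id_on (carrier A) \<noteq> carrier A \<times> carrier A \<and>
    (\<forall>\<theta>. congruence A \<theta> \<longrightarrow> \<theta> = Id_on (carrier A) \<or> \<theta> = carrier A \<times> carrier A)"

definition is_chain :: "'a rlat \<Rightarrow> bool"
  where "is_chain A \<longleftrightarrow> (\<forall>x\<in>carrier A. \<forall>y\<in>carrier A. x \<preceq>\<^bsub>A\<^esub> y \<or> y \<preceq>\<^bsub>A\<^esub> x)"

definition finite_simple_MV_chains :: "'a rlat set"
  where "finite_simple_MV_chains =
    {A. mv_algebra A \<and> is_chain A \<and> finite (carrier A) \<and> simple_algebra A}"

definition MV_unit :: "real rlat"
  where "MV_unit =
    \<lparr>carrier = {0..1}, mult = (\<lambda>x y. max 0 (x + y - 1)), one = 1,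
     rmeet = min, rjoin = max, rimp = (\<lambda>x y. min 1 (1 - x + y)), rzero = 0\<rparr>"

definition Luk :: "nat \<Rightarrow> real rlat"
  where "Luk k = MV_unit\<lparr>carrier := {real i / real (k - 1) | i. i \<le> k - 1}\<rparr>"

datatype trm =
    Var nat
  | Zero
  | One
  | Meet trm trm
  | Join trm trm
  | Mult trm trm
  | Imp trm trm

primrec eval :: "'a rlat \<Rightarrow> (nat \<Rightarrow> 'a) \<Rightarrow> trm \<Rightarrow> 'a" where
  "eval A h (Var v) = h v"
| "eval A h Zero = \<zero>\<^bsub>A\<^esub>"
| "eval A h One = \<one>\<^bsub>A\<^esub>"
| "eval A h (Meet s t) = eval A h s \<curlywedge>\<^bsub>A\<^esub> eval A h t"
| "eval A h (Join s t) = eval A h s \<curlyvee>\<^bsub>A\<^esub> eval A h t"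
| "eval A h (Mult s t) = eval A h s \<otimes>\<^bsub>A\<^esub> eval A h t"
| "eval A h (Imp s t) = eval A h s \<leadsto>\<^bsub>A\<^esub> eval A h t"

text \<open>\<open>valid_one V t\<close> says that the equation \<open>t \<approx> 1\<close> is valid in \<open>V\<close>.\<close>

definition valid_one :: "'a rlat set \<Rightarrow> trm \<Rightarrow> bool"
  where "valid_one V t \<longleftrightarrow>
    (\<forall>A\<in>V. \<forall>h. (\<forall>v. h v \<in> carrier A) \<longrightarrow> eval A h t = \<one>\<^bsub>A\<^esub>)"

definition posets :: "('x set \<times> 'x rel) set"
  where "posets = {(X, R). partial_order_on X R}"

definition root_systems :: "('x set \<times> 'x rel) set"
  where "root_systems = {(X, R). partial_order_on X R \<and> (\<forall>x\<in>X. total_on {y \<in> X. (x, y) \<in> R} R)}"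

definition finite_chains :: "('x set \<times> 'x rel) set"
  where "finite_chains = {(X, R). finite X \<and> linear_order_on X R}"

record ('x, 'b) frame =
  worlds :: "'x set"
  ord :: "'x rel"
  alg :: "'x \<Rightarrow> 'b rlat"

definition is_frame :: "('x, 'b) frame \<Rightarrow> bool"
  where "is_frame F \<longleftrightarrow>
    partial_order_on (worlds F) (ord F) \<and>
    (\<forall>x\<in>worlds F. residuated_lattice (alg F x)) \<and>
    (\<forall>x\<in>worlds F. \<forall>y\<in>worlds F. rzero (alg F x) = rzero (alg F y) \<and> one (alg F x) = one (alg F y))"

definition frames :: "('x set \<times> 'x rel) set \<Rightarrow> 'b rlat set \<Rightarrow> ('x, 'b) frame set"
  where "frames P C =
    {F. is_frame F \<and> (worlds F, ord F) \<in> P \<and> (\<forall>x\<in>worlds F. alg F x \<in> C)}"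

definition box :: "('x, 'b) frame \<Rightarrow> ('x \<Rightarrow> 'b) \<Rightarrow> 'x \<Rightarrow> 'b"
  where "box F f = (\<lambda>x\<in>worlds F.
    if \<forall>y\<in>worlds F. (x, y) \<in> ord F \<and> x \<noteq> y \<longrightarrow> f y = one (alg F y) then f x else rzero (alg F x))"

definition poset_product :: "('x, 'b) frame \<Rightarrow> ('x \<Rightarrow> 'b) rlat"
  where "poset_product F =
    \<lparr>carrier = {f \<in> Pi\<^sub>E (worlds F) (\<lambda>x. carrier (alg F x)). box F f = f},
     mult = (\<lambda>f g. \<lambda>x\<in>worlds F. mult (alg F x) (f x) (g x)),
     one = (\<lambda>x\<in>worlds F. one (alg F x)),
     rmeet = (\<lambda>f g. box F (\<lambda>x\<in>worlds F. rmeet (alg F x) (f x) (g x))),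
     rjoin = (\<lambda>f g. \<lambda>x\<in>worlds F. rjoin (alg F x) (f x) (g x)),
     rimp = (\<lambda>f g. box F (\<lambda>x\<in>worlds F. rimp (alg F x) (f x) (g x))),
     rzero = (\<lambda>x\<in>worlds F. rzero (alg F x))\<rparr>"

definition forces :: "('x, 'b) frame \<Rightarrow> trm \<Rightarrow> bool" (infix \<open>\<tturnstile>\<close> 50)
  where "F \<tturnstile> t \<longleftrightarrow>
    (\<forall>h. (\<forall>v. h v \<in> carrier (poset_product F)) \<longrightarrow>
      (\<forall>x\<in>worlds F. eval (poset_product F) h t x = one (alg F x)))"

definition sound :: "('x, 'b) frame set \<Rightarrow> 'a rlat set \<Rightarrow> bool"
  where "sound K V \<longleftrightarrow> (\<forall>t. valid_one V t \<longrightarrow> (\<forall>F\<in>K. F \<tturnstile> t))"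

definition complete_for :: "('x, 'b) frame set \<Rightarrow> 'a rlat set \<Rightarrow> bool"
  where "complete_for K V \<longleftrightarrow> (\<forall>t. (\<forall>F\<in>K. F \<tturnstile> t) \<longrightarrow> valid_one V t)"

definition sound_and_complete :: "('x, 'b) frame set \<Rightarrow> 'a rlat set \<Rightarrow> bool"
  where "sound_and_complete K V \<longleftrightarrow> sound K V \<and> complete_for K V"

text \<open>
  A class of algebras or frames is rendered as a set over a carrier type. The three types involved
  (\<open>'a\<close> for the members of the variety, \<open>'x\<close> for the points of the base posets, \<open>'b\<close> for the elements
  of the value algebras) are meant to be arbitrary infinite types, chosen independently. Nothing is
  lost by this: a refuting algebra may be replaced by the countable subalgebra generated by the values
  of the variables, and a refuting frame by its restriction to countably many points, while the
  value algebras that are not fixed subsets of the reals are finite.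
\<close>

end

theory Submission
  imports Defs "HOL-Library.Countable_Set"
begin

text \<open>
  Soundness: a poset product of GBL-algebras is a GBL-algebra, and prelinearity and potency are inherited
  under the respective hypotheses; all classes involved are equational, so a refutation can be moved to a
  countable subalgebra and from there into any infinite type.

  Completeness: let a term fail in a GBL-algebra. A filter \<open>F\<close> that is maximal with respect to omitting an
  element has a subdirectly irreducible quotient, whose top component (an upward closed set \<open>W\<close>) is a totally
  ordered Wajsberg hoop with everything else below it. The points of the countermodel are such filters, a point being
  strictly below another if the latter contains the preimage of the top component of the former. Elements of
  \<open>W\<close> receive values in \<open>[0, 1]\<close>, all others the value \<open>0\<close>. Since only finitely many subterms matter, it suffices to
  embed finite parts of an interval of \<open>W\<close> into a finite chain. Multiplication by elements of the interval, with carry, gives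
  commuting strictly increasing maps of a chain, so by Fourier--Motzkin elimination the relations between finitely many of them are
  realised by integers. Under \<open>k\<close>-potency the interval has at most \<open>k + 1\<close> elements and is itself a finite
  chain. Under prelinearity the filters above a given point are totally ordered, and finitely many of them suffice.
\<close>

section \<open>Residuated lattices\<close>

text \<open>The top component need not embed into \<open>[0, 1]\<close>: it may contain
  infinitesimals, as Chang's MV-algebra does. Values are therefore prescribed only on the finite set
  of values of subterms, and each point of the countermodel receives its own finite chain; the
  chains need to share nothing but 0 and 1. The points cohere through the two filters attached to
  each of them: an element of the larger filter has value 1 at every point strictly above, and an
  element outside it has value 0. This is the shape that the box demands. It also allows an
  implication outside the larger filter to be ignored locally, because it fails at a higher point
  and the box resets it to 0. Potency adds an obligation: the chain with \<open>N + 1\<close>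
  elements is \<open>k\<close>-potent only if \<open>N \<le> k\<close>, and arbitrary integer
  weights give no such bound. Hence the interval is first shown to be finite, and its weights are
  then divided by the smallest positive one. Heyting and Goedel algebras are the case
  \<open>k = 1\<close>, where every value algebra is the two-element chain.\<close>

context residuated_lattice
begin

lemmas rl_closed [simp, intro] = meet_closed join_closed imp_closed zero_closed

lemma meet_idem [simp]: "x \<in> carrier A \<Longrightarrow> x \<curlywedge> x = x"
  by (metis join_meet_absorb meet_closed meet_join_absorb)

lemma le_refl [simp]: "x \<in> carrier A \<Longrightarrow> x \<preceq> x"
  by (simp add: rle_def)

lemma le_antisym: "\<lbrakk>x \<preceq> y; y \<preceq> x; x \<in> carrier A; y \<in> carrier A\<rbrakk> \<Longrightarrow> x = y"
  by (metis rle_def meet_comm)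

lemma le_trans: "\<lbrakk>x \<preceq> y; y \<preceq> z; x \<in> carrier A; y \<in> carrier A; z \<in> carrier A\<rbrakk> \<Longrightarrow> x \<preceq> z"
  by (metis rle_def meet_assoc)

lemma le_join_iff: "\<lbrakk>x \<in> carrier A; y \<in> carrier A\<rbrakk> \<Longrightarrow> x \<preceq> y \<longleftrightarrow> x \<curlyvee> y = y"
  by (metis rle_def join_comm join_meet_absorb meet_comm meet_join_absorb)

lemma meet_le1 [simp]: "\<lbrakk>x \<in> carrier A; y \<in> carrier A\<rbrakk> \<Longrightarrow> x \<curlywedge> y \<preceq> x"
  by (metis meet_assoc meet_closed meet_comm meet_idem rle_def)

lemma meet_le2 [simp]: "\<lbrakk>x \<in> carrier A; y \<in> carrier A\<rbrakk> \<Longrightarrow> x \<curlywedge> y \<preceq> y"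
  by (metis meet_comm meet_le1)

lemma meet_greatest:
  "\<lbrakk>z \<preceq> x; z \<preceq> y; x \<in> carrier A; y \<in> carrier A; z \<in> carrier A\<rbrakk> \<Longrightarrow> z \<preceq> x \<curlywedge> y"
  by (metis meet_assoc rle_def)

lemma join_ge1 [simp]: "\<lbrakk>x \<in> carrier A; y \<in> carrier A\<rbrakk> \<Longrightarrow> x \<preceq> x \<curlyvee> y"
  by (simp add: meet_join_absorb rle_def)

lemma join_ge2 [simp]: "\<lbrakk>x \<in> carrier A; y \<in> carrier A\<rbrakk> \<Longrightarrow> y \<preceq> x \<curlyvee> y"
  by (metis join_comm join_ge1)

lemma join_least:
  "\<lbrakk>x \<preceq> z; y \<preceq> z; x \<in> carrier A; y \<in> carrier A; z \<in> carrier A\<rbrakk> \<Longrightarrow> x \<curlyvee> y \<preceq> z"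
  by (simp add: join_assoc le_join_iff)

lemma le_one [simp]: "x \<in> carrier A \<Longrightarrow> x \<preceq> \<one>"
  by (rule one_greatest)

lemma one_le_iff [simp]: "x \<in> carrier A \<Longrightarrow> \<one> \<preceq> x \<longleftrightarrow> x = \<one>"
  by (metis le_antisym le_refl one_closed one_greatest)

lemma le_zero_iff [simp]: "x \<in> carrier A \<Longrightarrow> x \<preceq> \<zero> \<longleftrightarrow> x = \<zero>"
  by (metis le_antisym le_refl zero_closed zero_least)

lemma imp_eq_one: "\<lbrakk>x \<in> carrier A; y \<in> carrier A\<rbrakk> \<Longrightarrow> x \<leadsto> y = \<one> \<longleftrightarrow> x \<preceq> y"
  by (metis imp_closed l_one one_closed one_le_iff residuation)

lemma mult_imp_le: "\<lbrakk>x \<in> carrier A; y \<in> carrier A\<rbrakk> \<Longrightarrow> x \<otimes> (x \<leadsto> y) \<preceq> y"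
  by (metis imp_closed le_refl m_comm residuation)

lemma le_imp_mult: "\<lbrakk>x \<in> carrier A; y \<in> carrier A\<rbrakk> \<Longrightarrow> x \<preceq> y \<leadsto> x \<otimes> y"
  by (metis le_refl m_closed residuation)

lemma mult_mono1: "\<lbrakk>x \<preceq> y; x \<in> carrier A; y \<in> carrier A; z \<in> carrier A\<rbrakk> \<Longrightarrow> x \<otimes> z \<preceq> y \<otimes> z"
  by (meson imp_closed le_imp_mult le_trans m_closed residuation)

lemma mult_mono2: "\<lbrakk>x \<preceq> y; x \<in> carrier A; y \<in> carrier A; z \<in> carrier A\<rbrakk> \<Longrightarrow> z \<otimes> x \<preceq> z \<otimes> y"
  by (metis m_comm mult_mono1)

lemma mult_mono:
  assumes "x \<preceq> y" "z \<preceq> w" "x \<in> carrier A" "y \<in> carrier A" "z \<in> carrier A" "w \<in> carrier A"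
  shows "x \<otimes> z \<preceq> y \<otimes> w"
  using assms by (meson le_trans m_closed mult_mono1 mult_mono2)

lemma mult_le1 [simp]: "\<lbrakk>x \<in> carrier A; y \<in> carrier A\<rbrakk> \<Longrightarrow> x \<otimes> y \<preceq> x"
  by (metis le_one mult_mono2 one_closed r_one)

lemma mult_le2 [simp]: "\<lbrakk>x \<in> carrier A; y \<in> carrier A\<rbrakk> \<Longrightarrow> x \<otimes> y \<preceq> y"
  by (metis m_comm mult_le1)

lemma le_imp_self [simp]: "\<lbrakk>x \<in> carrier A; y \<in> carrier A\<rbrakk> \<Longrightarrow> x \<preceq> y \<leadsto> x"
  by (metis mult_le1 residuation)

lemma one_imp [simp]: "x \<in> carrier A \<Longrightarrow> \<one> \<leadsto> x = x"
  by (metis imp_closed l_one le_antisym le_imp_self mult_imp_le one_closed)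

lemma imp_one [simp]: "x \<in> carrier A \<Longrightarrow> x \<leadsto> \<one> = \<one>"
  by (simp add: imp_eq_one)

lemma imp_self [simp]: "x \<in> carrier A \<Longrightarrow> x \<leadsto> x = \<one>"
  by (simp add: imp_eq_one)

lemma imp_curry:
  assumes [simp]: "x \<in> carrier A" "y \<in> carrier A" "z \<in> carrier A"
  shows "(x \<otimes> y) \<leadsto> z = x \<leadsto> (y \<leadsto> z)"
proof (rule le_antisym)
  have "((x \<otimes> y) \<leadsto> z) \<otimes> (x \<otimes> y) \<preceq> z"
    by (simp add: residuation)
  then show "(x \<otimes> y) \<leadsto> z \<preceq> x \<leadsto> (y \<leadsto> z)"
    by (simp add: m_assoc flip: residuation)
  have "((x \<leadsto> (y \<leadsto> z)) \<otimes> x) \<otimes> y \<preceq> z"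
    by (simp add: residuation)
  then show "x \<leadsto> (y \<leadsto> z) \<preceq> (x \<otimes> y) \<leadsto> z"
    by (simp add: m_assoc flip: residuation)
qed simp_all

lemma imp_left_commute:
  "\<lbrakk>x \<in> carrier A; y \<in> carrier A; z \<in> carrier A\<rbrakk> \<Longrightarrow> x \<leadsto> (y \<leadsto> z) = y \<leadsto> (x \<leadsto> z)"
  by (metis imp_curry m_comm)

lemma imp_mono:
  assumes "y \<preceq> z" "x \<in> carrier A" "y \<in> carrier A" "z \<in> carrier A"
  shows "x \<leadsto> y \<preceq> x \<leadsto> z"
  using assms by (meson imp_closed le_refl le_trans m_closed residuation)

lemma imp_antimono:
  assumes "x \<preceq> y" "x \<in> carrier A" "y \<in> carrier A" "z \<in> carrier A"
  shows "y \<leadsto> z \<preceq> x \<leadsto> z"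
  using assms by (meson imp_closed le_refl le_trans m_closed mult_mono2 residuation)

lemma imp_trans:
  assumes [simp]: "x \<in> carrier A" "y \<in> carrier A" "z \<in> carrier A"
  shows "(x \<leadsto> y) \<otimes> (y \<leadsto> z) \<preceq> x \<leadsto> z"
proof -
  have "x \<otimes> ((x \<leadsto> y) \<otimes> (y \<leadsto> z)) \<preceq> y \<otimes> (y \<leadsto> z)"
    by (simp add: mult_imp_le mult_mono1 flip: m_assoc)
  also have "y \<otimes> (y \<leadsto> z) \<preceq> z"
    by (simp add: mult_imp_le)
  finally (le_trans) have "x \<otimes> ((x \<leadsto> y) \<otimes> (y \<leadsto> z)) \<preceq> z" by simp
  then show ?thesis
    by (metis assms imp_closed m_closed m_comm residuation)
qed

lemma imp_meet:
  assumes [simp]: "x \<in> carrier A" "y \<in> carrier A" "z \<in> carrier A"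
  shows "x \<leadsto> (y \<curlywedge> z) = (x \<leadsto> y) \<curlywedge> (x \<leadsto> z)"
proof (rule le_antisym)
  show "x \<leadsto> (y \<curlywedge> z) \<preceq> (x \<leadsto> y) \<curlywedge> (x \<leadsto> z)"
    by (simp add: imp_mono meet_greatest)
  let ?t = "(x \<leadsto> y) \<curlywedge> (x \<leadsto> z)"
  have "?t \<otimes> x \<preceq> y" "?t \<otimes> x \<preceq> z"
    by (simp_all add: residuation)
  then show "?t \<preceq> x \<leadsto> (y \<curlywedge> z)"
    by (simp add: meet_greatest flip: residuation)
qed simp_all

lemma mult_join:
  assumes [simp]: "x \<in> carrier A" "y \<in> carrier A" "z \<in> carrier A"
  shows "(x \<curlyvee> y) \<otimes> z = (x \<otimes> z) \<curlyvee> (y \<otimes> z)"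
proof (rule le_antisym)
  have "x \<preceq> z \<leadsto> (x \<otimes> z) \<curlyvee> (y \<otimes> z)" "y \<preceq> z \<leadsto> (x \<otimes> z) \<curlyvee> (y \<otimes> z)"
    by (simp_all flip: residuation)
  then show "(x \<curlyvee> y) \<otimes> z \<preceq> (x \<otimes> z) \<curlyvee> (y \<otimes> z)"
    by (simp add: join_least residuation)
  show "(x \<otimes> z) \<curlyvee> (y \<otimes> z) \<preceq> (x \<curlyvee> y) \<otimes> z"
    by (simp add: join_least mult_mono1)
qed simp_all

lemma pow_imp_fixed:
  "\<lbrakk>x \<leadsto> y = y; x \<in> carrier A; y \<in> carrier A\<rbrakk> \<Longrightarrow> x [^] (n::nat) \<leadsto> y = y"
  by (induction n) (simp_all add: imp_curry)

lemma zero_mult [simp]: "x \<in> carrier A \<Longrightarrow> \<zero> \<otimes> x = \<zero>"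
  by (metis le_zero_iff m_closed mult_le1 zero_closed)

lemma mult_zero [simp]: "x \<in> carrier A \<Longrightarrow> x \<otimes> \<zero> = \<zero>"
  using m_comm[of x \<zero>] by simp

lemma zero_meet [simp]: "x \<in> carrier A \<Longrightarrow> \<zero> \<curlywedge> x = \<zero>"
  using zero_least[of x] by (simp add: rle_def)

lemma meet_zero [simp]: "x \<in> carrier A \<Longrightarrow> x \<curlywedge> \<zero> = \<zero>"
  using meet_comm[of x \<zero>] by simp

lemma join_idem [simp]: "x \<in> carrier A \<Longrightarrow> x \<curlyvee> x = x"
  using le_join_iff[of x x] by simp

lemma one_join [simp]: "x \<in> carrier A \<Longrightarrow> \<one> \<curlyvee> x = \<one>"
  by (metis join_closed join_ge1 one_closed one_le_iff)

lemma join_one [simp]: "x \<in> carrier A \<Longrightarrow> x \<curlyvee> \<one> = \<one>"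
  using join_comm[of x \<one>] by simp

end

lemma (in gbl_algebra) meet_eq_mult: "\<lbrakk>x \<preceq> y; x \<in> carrier A; y \<in> carrier A\<rbrakk> \<Longrightarrow> y \<otimes> (y \<leadsto> x) = x"
  by (metis divisibility meet_comm rle_def)

section \<open>The top component of a subdirectly irreducible GBL-algebra\<close>

text \<open>Subdirect irreducibility in the form of a witness: a filter other than
  \<open>{\<one>}\<close> contains a nonunit, hence a power of it below \<open>u\<close>, hence
  \<open>u\<close> itself.\<close>

locale si_gbl = gbl_algebra +
  fixes u
  assumes u_closed [simp]: "u \<in> carrier A"
    and u_neq_one: "u \<noteq> \<one>"
    and si: "\<lbrakk>x \<in> carrier A; x \<noteq> \<one>\<rbrakk> \<Longrightarrow> \<exists>n::nat. x [^] n \<preceq> u"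
begin

text \<open>In an ordinal sum whose last summand contains \<open>u\<close>, the elements below that
  summand are the nonunits fixed by \<open>u \<leadsto>\<close>. Taking this as the definition
  singles out the last summand before any decomposition is known.\<close>

definition top_part :: "'a set" where
  "top_part = {x \<in> carrier A. x = \<one> \<or> u \<leadsto> x \<noteq> x}"

lemma one_top [simp]: "\<one> \<in> top_part"
  by (simp add: top_part_def)

lemma u_top [simp]: "u \<in> top_part"
  using u_neq_one by (auto simp: top_part_def)

lemma notin_top: "\<lbrakk>x \<notin> top_part; x \<in> carrier A\<rbrakk> \<Longrightarrow> u \<leadsto> x = x \<and> x \<noteq> \<one>"
  by (auto simp: top_part_def)

lemma top_fixed_eq_one: "\<lbrakk>x \<in> top_part; u \<leadsto> x = x\<rbrakk> \<Longrightarrow> x = \<one>"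
  by (auto simp: top_part_def)

lemma top_carrier [simp]: "x \<in> top_part \<Longrightarrow> x \<in> carrier A"
  by (simp add: top_part_def)

lemma imp_notin_top:
  assumes "y \<notin> top_part" "x \<in> carrier A" "y \<in> carrier A"
  shows "x \<leadsto> y = \<one> \<or> x \<leadsto> y \<notin> top_part"
proof -
  have "u \<leadsto> (x \<leadsto> y) = x \<leadsto> y"
    using notin_top[OF assms(1,3)] assms by (metis imp_left_commute u_closed)
  then show ?thesis
    using top_fixed_eq_one by blast
qed

text \<open>Being fixed passes from \<open>r\<close> to all its powers, one of which lies below
  \<open>u\<close>; implication is antitone in its first argument.\<close>

lemma fixed_by_nonunit:
  assumes "r \<leadsto> x = x" "r \<noteq> \<one>" "r \<in> carrier A" "x \<in> carrier A"
  shows "u \<leadsto> x = x"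
proof -
  obtain n :: nat where n: "r [^] n \<preceq> u"
    using si assms by blast
  have "u \<leadsto> x \<preceq> r [^] n \<leadsto> x"
    using n assms by (simp add: imp_antimono)
  then have "u \<leadsto> x \<preceq> x"
    using pow_imp_fixed assms by simp
  then show ?thesis
    using assms by (simp add: le_antisym)
qed

text \<open>Let \<open>q = b \<leadsto> z\<close>. Since \<open>q\<close> lies above
  \<open>u\<close>, also \<open>q \<leadsto> b = b\<close>, and divisibility evaluates both
  \<open>b \<curlywedge> z\<close> and \<open>b \<curlywedge> q\<close> to
  \<open>b \<otimes> q\<close>. Hence \<open>b \<leadsto> q = b \<leadsto> z = q\<close>, so every
  power of \<open>b\<close> fixes \<open>q\<close>; but some power lies below \<open>u\<close> and
  so below \<open>q\<close>, which forces \<open>q = \<one>\<close>.\<close>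

lemma fixed_imp_le:
  assumes b: "u \<leadsto> b = b" "b \<noteq> \<one>" "b \<in> carrier A"
    and z: "u \<preceq> z" "z \<in> carrier A"
  shows "b \<preceq> z"
proof -
  note [simp] = b(3) z(2)
  define q where "q = b \<leadsto> z"
  have [simp]: "q \<in> carrier A" by (simp add: q_def)
  have fixed: "w \<leadsto> b = b" if "u \<preceq> w" "w \<in> carrier A" for w
  proof (rule le_antisym)
    show "w \<leadsto> b \<preceq> b"
      using imp_antimono[OF that(1) u_closed that(2) b(3)] b(1) by simp
  qed (use that in simp_all)
  have qz: "u \<preceq> q"
    using z le_imp_self[of z b] unfolding q_def by (meson b(3) imp_closed le_trans u_closed)
  have "b \<curlywedge> z = b \<otimes> q" by (simp add: q_def divisibility)
  moreover have "b \<curlywedge> z = z \<otimes> b"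
    using divisibility[of z b] fixed[OF z] by (simp add: meet_comm)
  moreover have "b \<curlywedge> q = q \<otimes> b"
    using divisibility[of q b] fixed[OF qz] by (simp add: meet_comm)
  ultimately have "b \<curlywedge> q = b \<curlywedge> z"
    by (simp add: m_comm)
  moreover have "b \<leadsto> w = b \<leadsto> (b \<curlywedge> w)" if "w \<in> carrier A" for w
    using that imp_meet[of b b w] le_one[of "b \<leadsto> w"] by (simp add: rle_def meet_comm)
  ultimately have bq: "b \<leadsto> q = q"
    by (metis q_def z(2) \<open>q \<in> carrier A\<close>)
  obtain n :: nat where "b [^] n \<preceq> u"
    using si b by blast
  then have "b [^] n \<preceq> q"
    using qz by (meson \<open>q \<in> carrier A\<close> b(3) le_trans nat_pow_closed u_closed)
  then have "b [^] n \<leadsto> q = \<one>"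
    by (simp add: imp_eq_one)
  then have "q = \<one>"
    using pow_imp_fixed[OF bq] by simp
  then show ?thesis
    by (simp add: q_def imp_eq_one)
qed

text \<open>Factor \<open>c = g \<otimes> e\<close> with \<open>e = u \<leadsto> c\<close>. Below a
  fixed nonunit the factor \<open>g\<close> is neutral, so \<open>c\<close> and \<open>e\<close>
  have the same meet with it. Therefore \<open>d = b \<leadsto> c\<close> equals
  \<open>b \<leadsto> e\<close> and is itself fixed. Were it not \<open>\<one>\<close>, the same
  comparison with \<open>d\<close> in place of \<open>b\<close> would give
  \<open>e \<preceq> d\<close> and then \<open>e = c\<close>, although \<open>c\<close> is not
  fixed.\<close>

lemma notin_top_le:
  assumes b: "b \<notin> top_part" "b \<in> carrier A" and c: "c \<in> top_part"
  shows "b \<preceq> c"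
proof (cases "c = \<one>")
  case False
  have [simp]: "c \<in> carrier A" using c by simp
  have c': "u \<leadsto> c \<noteq> c" using c False top_fixed_eq_one by blast
  define e where "e = u \<leadsto> c"
  define g where "g = e \<leadsto> c"
  have [simp]: "e \<in> carrier A" "g \<in> carrier A" by (simp_all add: e_def g_def)
  have ce: "c \<preceq> e" by (simp add: e_def)
  have ug: "u \<preceq> g"
    unfolding g_def e_def by (simp add: mult_imp_le flip: residuation)
  have c_eq: "c = g \<otimes> e"
    using meet_eq_mult[OF ce] by (simp add: g_def m_comm)
  have step: "b \<curlywedge> c = b \<curlywedge> e" if "u \<leadsto> b = b" "b \<noteq> \<one>" "b \<in> carrier A" for b
  proof -
    note [simp] = that(3)
    have gb: "g \<leadsto> b = b"
      using imp_antimono[OF ug, of b] that(1) by (simp add: le_antisym)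
    have "b \<preceq> g" using fixed_imp_le[OF that ug] by simp
    then have "g \<otimes> b = b"
      using meet_eq_mult[of b g] gb by simp
    \<comment> \<open>By divisibility everything below \<open>b\<close> is a multiple of
      \<open>b\<close>, so it is enough that \<open>g\<close> leaves \<open>b\<close>
      unchanged.\<close>
    then have gy: "g \<otimes> y = y" if "y \<preceq> b" "y \<in> carrier A" for y
      using meet_eq_mult[OF that] that by (metis \<open>b \<in> carrier A\<close> \<open>g \<in> carrier A\<close> imp_closed m_assoc)
    have "(e \<otimes> g) \<leadsto> b = e \<leadsto> b"
      by (simp add: imp_curry gb)
    then have cb: "c \<leadsto> b = e \<leadsto> b"
      using c_eq by (simp add: m_comm)
    have "c \<curlywedge> b = c \<otimes> (e \<leadsto> b)"
      using divisibility[of c b] cb by simp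
    also have "\<dots> = g \<otimes> (e \<otimes> (e \<leadsto> b))"
      by (subst c_eq) (simp add: m_assoc)
    also have "\<dots> = g \<otimes> (e \<curlywedge> b)"
      by (simp add: divisibility)
    also have "\<dots> = e \<curlywedge> b" by (rule gy) simp_all
    finally show ?thesis by (simp add: meet_comm)
  qed
  define d where "d = b \<leadsto> c"
  have [simp]: "d \<in> carrier A" using b by (simp add: d_def)
  have "b \<leadsto> w = b \<leadsto> (b \<curlywedge> w)" if "w \<in> carrier A" for w
    using that b imp_meet[of b b w] le_one[of "b \<leadsto> w"] by (simp add: rle_def meet_comm)
  then have "d = b \<leadsto> e"
    using step notin_top b by (metis d_def \<open>c \<in> carrier A\<close> \<open>e \<in> carrier A\<close>)
  then have d_fixed: "u \<leadsto> d = d"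
    using imp_left_commute[of u b c] b by (simp add: d_def e_def)
  have "d = \<one>"
  proof (rule ccontr)
    assume "d \<noteq> \<one>"
    then have "d \<curlywedge> c = d \<curlywedge> e" using step d_fixed by simp
    moreover have "c \<preceq> d" using b by (simp add: d_def)
    ultimately have c2: "c = d \<curlywedge> e" by (metis \<open>c \<in> carrier A\<close> \<open>d \<in> carrier A\<close> meet_comm rle_def)
    have "e = u \<leadsto> (d \<curlywedge> e)"
      unfolding c2[symmetric] by (rule e_def)
    then have "e = (u \<leadsto> d) \<curlywedge> (u \<leadsto> e)"
      using imp_meet[of u d e] by simp
    then have "e \<preceq> d" using d_fixed by (metis \<open>d \<in> carrier A\<close> \<open>e \<in> carrier A\<close> imp_closed meet_le1 u_closed)
    then have "e = c" using c2 by (metis \<open>d \<in> carrier A\<close> \<open>e \<in> carrier A\<close> meet_comm rle_def)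
    then show False using c' by (simp add: e_def)
  qed
  then show ?thesis using b by (simp add: d_def imp_eq_one)
qed (use b in simp)

lemma top_upward: "\<lbrakk>x \<in> top_part; x \<preceq> y; y \<in> carrier A\<rbrakk> \<Longrightarrow> y \<in> top_part"
  by (metis le_antisym notin_top_le top_carrier)

text \<open>The residual \<open>x \<leadsto> x \<otimes> y\<close> lies above \<open>y\<close>,
  hence in the top part. If the product were outside, \<open>imp_notin_top\<close> would make this
  residual \<open>\<one>\<close>, and the product would lie above \<open>x\<close>.\<close>

lemma top_mult:
  assumes "x \<in> top_part" "y \<in> top_part"
  shows "x \<otimes> y \<in> top_part"
proof (rule ccontr)
  assume *: "x \<otimes> y \<notin> top_part"
  have [simp]: "x \<in> carrier A" "y \<in> carrier A" using assms by simp_all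
  have "y \<preceq> x \<leadsto> x \<otimes> y" by (metis \<open>x \<in> carrier A\<close> \<open>y \<in> carrier A\<close> le_imp_mult m_comm)
  then have "x \<leadsto> x \<otimes> y \<in> top_part" by (rule top_upward[OF assms(2)]) simp
  then have "x \<preceq> x \<otimes> y" using imp_notin_top[OF *, of x] by (simp add: imp_eq_one)
  then have "x \<otimes> y \<in> top_part" by (rule top_upward[OF assms(1)]) simp
  with * show False ..
qed

lemma top_imp: "\<lbrakk>x \<in> carrier A; y \<in> top_part\<rbrakk> \<Longrightarrow> x \<leadsto> y \<in> top_part"
  by (meson imp_closed le_imp_self top_carrier top_upward)

lemma top_meet: "\<lbrakk>x \<in> top_part; y \<in> top_part\<rbrakk> \<Longrightarrow> x \<curlywedge> y \<in> top_part"
  by (metis divisibility top_carrier top_imp top_mult)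

lemma top_fixed_by:
  "\<lbrakk>r \<leadsto> x = x; r \<noteq> \<one>; r \<in> carrier A; x \<in> top_part\<rbrakk> \<Longrightarrow> x = \<one>"
  using fixed_by_nonunit top_fixed_eq_one by simp

text \<open>Let \<open>y'\<close> be the double residual and \<open>r = y' \<leadsto> y\<close>.
  Since \<open>y = r \<otimes> y'\<close>, currying shows that \<open>r\<close> fixes
  \<open>y \<leadsto> x\<close>. In the top part only \<open>\<one>\<close> is fixed by a nonunit,
  so \<open>r = \<one>\<close> or \<open>y \<leadsto> x = \<one>\<close>, and either gives
  \<open>y' = y\<close>.\<close>

lemma top_wajsberg:
  assumes "x \<in> top_part" "x \<preceq> y" "y \<in> carrier A"
  shows "(y \<leadsto> x) \<leadsto> x = y"
proof -
  have [simp]: "x \<in> carrier A" "y \<in> carrier A" using assms by simp_all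
  define g where "g = y \<leadsto> x"
  define y' where "y' = g \<leadsto> x"
  define r where "r = y' \<leadsto> y"
  have [simp]: "g \<in> carrier A" "y' \<in> carrier A" "r \<in> carrier A"
    by (simp_all add: g_def y'_def r_def)
  have g_top: "g \<in> top_part" using assms by (simp add: g_def top_imp)
  have yy': "y \<preceq> y'"
    unfolding y'_def g_def by (simp add: mult_imp_le flip: residuation)
  have "g \<otimes> y' \<preceq> x" by (simp add: y'_def mult_imp_le)
  then have "g \<preceq> y' \<leadsto> x" by (simp add: residuation)
  moreover have "y' \<leadsto> x \<preceq> g" unfolding g_def by (simp add: imp_antimono yy')
  ultimately have g2: "y' \<leadsto> x = g" by (simp add: le_antisym)
  have "y = r \<otimes> y'" using meet_eq_mult[OF yy'] by (simp add: r_def m_comm)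
  then have rg: "r \<leadsto> g = g" using g2 imp_curry[of r y' x] by (simp add: g_def)
  have "r = \<one> \<or> g = \<one>" using top_fixed_by[OF rg] g_top by auto
  then have "y' = y"
  proof
    assume "r = \<one>"
    then show ?thesis using yy' by (simp add: r_def imp_eq_one le_antisym)
  next
    assume "g = \<one>"
    moreover from this have "x = y" using assms by (simp add: g_def imp_eq_one le_antisym)
    ultimately show ?thesis by (simp add: y'_def)
  qed
  then show ?thesis by (simp add: y'_def g_def)
qed

text \<open>With \<open>n = x \<and> y\<close> the Wajsberg law turns \<open>(x \<leadsto> n) \<leadsto> (y \<leadsto> n)\<close> into \<open>y \<leadsto> x\<close>, so \<open>y \<leadsto> x\<close> is
  fixed by \<open>x \<leadsto> y\<close>.\<close>

lemma top_chain:
  assumes "x \<in> top_part" "y \<in> top_part"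
  shows "x \<preceq> y \<or> y \<preceq> x"
proof (rule ccontr)
  assume "\<not> ?thesis"
  then have nle: "\<not> x \<preceq> y" "\<not> y \<preceq> x" by simp_all
  have [simp]: "x \<in> carrier A" "y \<in> carrier A" using assms by simp_all
  have xn: "x \<leadsto> (x \<curlywedge> y) = x \<leadsto> y" and yn: "y \<leadsto> (x \<curlywedge> y) = y \<leadsto> x"
    using imp_meet[of x x y] imp_meet[of y x y] le_one[of "x \<leadsto> y"] le_one[of "y \<leadsto> x"]
    by (simp_all add: rle_def meet_comm)
  have "(x \<leadsto> y) \<leadsto> (y \<leadsto> x) = y \<leadsto> ((x \<leadsto> y) \<leadsto> (x \<curlywedge> y))"
    by (metis yn imp_left_commute imp_closed meet_closed \<open>x \<in> carrier A\<close> \<open>y \<in> carrier A\<close>)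
  also have "(x \<leadsto> y) \<leadsto> (x \<curlywedge> y) = x"
    using top_wajsberg[of "x \<curlywedge> y" x] assms top_meet xn by simp
  finally have "y \<leadsto> x = \<one>"
    by (rule top_fixed_by) (use assms nle in \<open>simp_all add: top_imp imp_eq_one\<close>)
  then show False using nle by (simp add: imp_eq_one)
qed

text \<open>Two elements are comparable unless both are outside the top part, and then both, with
  their join, lie below \<open>u\<close>. In a quotient this turns prelinearity into primeness of
  the filter.\<close>

lemma join_eq_one:
  assumes "x \<curlyvee> y = \<one>" "x \<in> carrier A" "y \<in> carrier A"
  shows "x = \<one> \<or> y = \<one>"
proof -
  consider "x \<preceq> y" | "y \<preceq> x" | "x \<preceq> u" "y \<preceq> u"
    using top_chain notin_top_le u_top assms(2,3) by blast
  then show ?thesis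
  proof cases
    case 1
    then show ?thesis using assms by (simp add: le_join_iff)
  next
    case 2
    then show ?thesis using assms by (simp add: le_join_iff join_comm)
  next
    case 3
    then have "\<one> \<preceq> u" using join_least[of x u y] assms by simp
    then show ?thesis using u_neq_one by simp
  qed
qed

text \<open>The residual \<open>x \<leadsto> w\<close> is fixed by the nonunit \<open>r\<close>,
  hence equal to \<open>\<one>\<close>. So a nonunit can be absorbed only at the bottom of the top
  part.\<close>

lemma top_absorb_least:
  assumes "x \<otimes> r = x" "r \<noteq> \<one>" "r \<in> carrier A" "x \<in> top_part" "w \<in> top_part"
  shows "x \<preceq> w"
proof (rule ccontr)
  assume nle: "\<not> x \<preceq> w"
  have "r \<leadsto> (x \<leadsto> w) = x \<leadsto> w"
    using assms by (metis imp_curry m_comm top_carrier)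
  then have "x \<leadsto> w = \<one>"
    using assms by (intro top_fixed_by) (simp_all add: top_imp)
  then show False using nle assms by (simp add: imp_eq_one)
qed

text \<open>The witness \<open>m\<close> says that the product is not the least element. If
  \<open>b \<preceq> c\<close>, then \<open>b = c \<otimes> (c \<leadsto> b)\<close>, so
  \<open>a \<otimes> b\<close> absorbs \<open>c \<leadsto> b\<close>, which must then be
  \<open>\<one>\<close>.\<close>

lemma top_cancel:
  assumes "a \<otimes> b = a \<otimes> c" "a \<in> top_part" "b \<in> top_part" "c \<in> top_part"
    and "m \<in> top_part" "\<not> a \<otimes> b \<preceq> m"
  shows "b = c"
proof -
  have *: "b = c" if "b \<preceq> c" "a \<otimes> b = a \<otimes> c" "\<not> a \<otimes> b \<preceq> m" "b \<in> top_part" "c \<in> top_part" for b c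
  proof -
    note [simp] = that(4,5)[THEN top_carrier] assms(2)[THEN top_carrier]
    have b: "b = c \<otimes> (c \<leadsto> b)" using meet_eq_mult[OF that(1)] by simp
    then have "(a \<otimes> b) \<otimes> (c \<leadsto> b) = a \<otimes> b"
      using that(2) by (metis m_assoc imp_closed \<open>b \<in> carrier A\<close> \<open>c \<in> carrier A\<close> assms(2)[THEN top_carrier])
    then have "c \<leadsto> b = \<one>"
      using top_absorb_least[of "a \<otimes> b" "c \<leadsto> b" m] that assms by (auto simp: top_mult)
    then show ?thesis using that by (simp add: imp_eq_one le_antisym)
  qed
  show ?thesis
    using top_chain[OF assms(3,4)] *[of b c] *[of c b] assms by auto
qed

end

section \<open>Integer weights for commuting increasing maps\<close>

text \<open>If both kinds of bounds occur, the midpoint of the largest lower and the smallest upper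
  bound serves: where the two coincide, they are attained by weak bounds only.\<close>

lemma finite_interpolation:
  fixes Ls Lw Us Uw :: "rat set"
  assumes fin: "finite Ls" "finite Lw" "finite Us" "finite Uw"
    and ss: "\<And>l u. l \<in> Ls \<Longrightarrow> u \<in> Us \<Longrightarrow> l < u" and sw: "\<And>l u. l \<in> Ls \<Longrightarrow> u \<in> Uw \<Longrightarrow> l < u"
    and ws: "\<And>l u. l \<in> Lw \<Longrightarrow> u \<in> Us \<Longrightarrow> l < u" and ww: "\<And>l u. l \<in> Lw \<Longrightarrow> u \<in> Uw \<Longrightarrow> l \<le> u"
  shows "\<exists>x. (\<forall>l\<in>Ls. l < x) \<and> (\<forall>l\<in>Lw. l \<le> x) \<and> (\<forall>u\<in>Us. x < u) \<and> (\<forall>u\<in>Uw. x \<le> u)"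
proof -
  let ?L = "Ls \<union> Lw" and ?U = "Us \<union> Uw"
  have L: "l \<le> Max ?L" if "l \<in> ?L" for l using that fin by simp
  have U: "Min ?U \<le> u" if "u \<in> ?U" for u using that fin by simp
  consider "?L = {}" "?U = {}" | "?L = {}" "?U \<noteq> {}" | "?L \<noteq> {}" "?U = {}" | "?L \<noteq> {}" "?U \<noteq> {}"
    by blast
  then show ?thesis
  proof cases
    case 1
    then show ?thesis by auto
  next
    case 2
    then show ?thesis
      by (intro exI[of _ "Min ?U - 1"]) (use U in force)
  next
    case 3
    then show ?thesis
      by (intro exI[of _ "Max ?L + 1"]) (use L in force)
  next
    case 4
    have maxL: "Max ?L \<in> ?L" and minU: "Min ?U \<in> ?U"
      using 4 fin by (intro Max_in Min_in; simp)+
    have "Max ?L \<le> Min ?U"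
      using maxL minU ss sw ws ww by (meson UnE less_imp_le)
    moreover have "l < Min ?U" if "l \<in> Ls" for l using that minU ss sw by blast
    moreover have "Max ?L < u" if "u \<in> Us" for u using that maxL ss ws by blast
    ultimately show ?thesis
      using L U
      by (intro exI[of _ "(Max ?L + Min ?U) / 2"]) (force simp: field_simps intro: add_le_less_mono add_less_le_mono)
  qed
qed

text \<open>A form of Motzkin's transposition theorem, proved by Fourier--Motzkin elimination: \<open>P\<close> and \<open>K\<close>
  collect the strict and weak inequalities that are consequences of the given ones.\<close>

lemma fourier_motzkin:
  fixes P K C D :: "('v \<Rightarrow> int) set"
  assumes "finite V"
    and "\<And>a b. a \<in> P \<Longrightarrow> b \<in> P \<Longrightarrow> (\<lambda>v. a v + b v) \<in> P"
    and "\<And>a b. a \<in> P \<Longrightarrow> b \<in> K \<Longrightarrow> (\<lambda>v. a v + b v) \<in> P"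
    and "\<And>a b. a \<in> K \<Longrightarrow> b \<in> K \<Longrightarrow> (\<lambda>v. a v + b v) \<in> K"
    and "\<And>a. a \<in> P \<Longrightarrow> \<exists>v\<in>V. a v \<noteq> 0"
    and "finite C" "C \<subseteq> P" "finite D" "D \<subseteq> K"
  shows "\<exists>L :: 'v \<Rightarrow> rat. (\<forall>c\<in>C. 0 < (\<Sum>v\<in>V. of_int (c v) * L v)) \<and>
    (\<forall>d\<in>D. 0 \<le> (\<Sum>v\<in>V. of_int (d v) * L v))"
  using assms
proof (induction V arbitrary: P K C D rule: finite_induct)
  case empty
  then have "C = {}" by blast
  then show ?case by simp
next
  case (insert w V)
  note PP = insert.prems(1) and PK = insert.prems(2) and KK = insert.prems(3)
  have scale: "(\<lambda>v. n * a v) \<in> X"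
    if X: "\<And>a b. a \<in> X \<Longrightarrow> b \<in> X \<Longrightarrow> (\<lambda>v. a v + b v) \<in> X" and a: "a \<in> X" and "0 < n"
    for n :: int and a :: "'v \<Rightarrow> int" and X
  proof -
    have "1 \<le> n" using that(3) by simp
    then show ?thesis
    proof (induction n rule: int_ge_induct)
      case base
      then show ?case using a by simp
    next
      case (step i)
      then show ?case using X[OF a step(2)] by (simp add: algebra_simps)
    qed
  qed
  \<comment> \<open>For a lower bound \<open>c1\<close> and an upper bound \<open>c2\<close> on the
    eliminated variable both multipliers are positive. They are integers, so the combination stays
    in \<open>P\<close> or \<open>K\<close>, for which only closure under sums is assumed.\<close>
  define comb where "comb = (\<lambda>(c1, c2). \<lambda>v. (- c2 w) * c1 v + c1 w * (c2 v :: int))"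
  define P' where "P' = {a \<in> P. a w = 0}"
  define K' where "K' = {a \<in> K. a w = 0}"
  define Z where "Z = (\<lambda>S :: ('v \<Rightarrow> int) set. {c \<in> S. c w = 0})"
  define Pos where "Pos = (\<lambda>S :: ('v \<Rightarrow> int) set. {c \<in> S. c w > 0})"
  define Neg where "Neg = (\<lambda>S :: ('v \<Rightarrow> int) set. {c \<in> S. c w < 0})"
  note defs = P'_def K'_def Z_def Pos_def Neg_def
  \<comment> \<open>A combination is strict as soon as one of its two parents is.\<close>
  let ?C = "Z C \<union> comb ` (Pos C \<times> Neg C) \<union> comb ` (Pos C \<times> Neg D) \<union> comb ` (Pos D \<times> Neg C)"
  let ?D = "Z D \<union> comb ` (Pos D \<times> Neg D)"
  have fin: "finite (Z S)" "finite (Pos S)" "finite (Neg S)" if "finite S" for S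
    using that by (simp_all add: defs)
  have comb: "comb (c1, c2) w = 0" for c1 c2 by (simp add: comb_def)
  have combE: "comb (c1, c2) = (\<lambda>v. (- c2 w) * c1 v + c1 w * c2 v)" for c1 c2
    by (simp add: comb_def)
  have combE': "comb (c1, c2) = (\<lambda>v. c1 w * c2 v + (- c2 w) * c1 v)" for c1 c2
    by (simp add: comb_def add.commute)
  have CC: "comb (c1, c2) \<in> P" if "c1 \<in> P" "c2 \<in> P" "c1 w > 0" "c2 w < 0" for c1 c2
    unfolding combE by (rule PP; rule scale) (use that PP in auto)
  have CD: "comb (c1, c2) \<in> P" if "c1 \<in> P" "c2 \<in> K" "c1 w > 0" "c2 w < 0" for c1 c2
    unfolding combE by (rule PK; rule scale) (use that PP KK in auto)
  have DC: "comb (c1, c2) \<in> P" if "c1 \<in> K" "c2 \<in> P" "c1 w > 0" "c2 w < 0" for c1 c2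
    unfolding combE' by (rule PK; rule scale) (use that PP KK in auto)
  have DD: "comb (c1, c2) \<in> K" if "c1 \<in> K" "c2 \<in> K" "c1 w > 0" "c2 w < 0" for c1 c2
    unfolding combE by (rule KK; rule scale) (use that KK in auto)
  have "\<exists>L :: 'v \<Rightarrow> rat. (\<forall>c\<in>?C. 0 < (\<Sum>v\<in>V. of_int (c v) * L v)) \<and>
    (\<forall>d\<in>?D. 0 \<le> (\<Sum>v\<in>V. of_int (d v) * L v))"
  proof (rule insert.IH[of P' K'])
    show "\<exists>v\<in>V. a v \<noteq> 0" if "a \<in> P'" for a
      using that insert.prems(4)[of a] by (auto simp: defs)
    show "?C \<subseteq> P'"
      using comb insert.prems(6,8)[THEN subsetD] by (auto simp: defs intro: CC CD DC)
    show "?D \<subseteq> K'"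
      using comb insert.prems(8)[THEN subsetD] by (auto simp: defs intro: DD)
    show "finite ?C" "finite ?D"
      using fin insert.prems by auto
    show "(\<lambda>v. a v + b v) \<in> P'" if "a \<in> P'" "b \<in> P'" for a b
      using that by (simp add: P'_def PP)
    show "(\<lambda>v. a v + b v) \<in> P'" if "a \<in> P'" "b \<in> K'" for a b
      using that by (simp add: P'_def K'_def PK)
    show "(\<lambda>v. a v + b v) \<in> K'" if "a \<in> K'" "b \<in> K'" for a b
      using that by (simp add: K'_def KK)
  qed
  then obtain L :: "'v \<Rightarrow> rat" where
    L: "(\<forall>c\<in>?C. 0 < (\<Sum>v\<in>V. of_int (c v) * L v)) \<and> (\<forall>d\<in>?D. 0 \<le> (\<Sum>v\<in>V. of_int (d v) * L v))"
    by (elim exE)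
  note LC = bspec[OF conjunct1[OF L]] and LD = bspec[OF conjunct2[OF L]]
  define s where "s = (\<lambda>c :: 'v \<Rightarrow> int. \<Sum>v\<in>V. of_int (c v) * L v)"
  \<comment> \<open>The value at \<open>w\<close> for which the constraint \<open>c\<close> becomes
    an equality: a lower bound if \<open>c w > 0\<close>, an upper bound if
    \<open>c w < 0\<close>.\<close>
  define \<beta> where "\<beta> = (\<lambda>c. - s c / of_int (c w))"
  have sC: "0 < s c" if "c \<in> ?C" for c using LC[OF that] by (simp only: s_def)
  have sD: "0 \<le> s c" if "c \<in> ?D" for c using LD[OF that] by (simp only: s_def)
  have s_comb: "s (comb (c1, c2)) = of_int (- c2 w) * s c1 + of_int (c1 w) * s c2" for c1 c2
    by (simp add: s_def comb_def sum_distrib_left sum.distrib algebra_simps sum_subtractf sum_negf)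
  have lt: "\<beta> c1 < \<beta> c2" if "0 < s (comb (c1, c2))" "c1 w > 0" "c2 w < 0" for c1 c2
  proof -
    have "0 < of_int (- c2 w) * s c1 + of_int (c1 w) * s c2" using that(1) s_comb by simp
    moreover have "(0::rat) < of_int (c1 w)" "of_int (c2 w) < (0::rat)" using that by simp_all
    ultimately show ?thesis unfolding \<beta>_def by (simp add: field_simps)
  qed
  have le: "\<beta> c1 \<le> \<beta> c2" if "0 \<le> s (comb (c1, c2))" "c1 w > 0" "c2 w < 0" for c1 c2
  proof -
    have "0 \<le> of_int (- c2 w) * s c1 + of_int (c1 w) * s c2" using that(1) s_comb by simp
    moreover have "(0::rat) < of_int (c1 w)" "of_int (c2 w) < (0::rat)" using that by simp_all
    ultimately show ?thesis unfolding \<beta>_def by (simp add: field_simps)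
  qed
  have "\<exists>x. (\<forall>l\<in>\<beta> ` Pos C. l < x) \<and> (\<forall>l\<in>\<beta> ` Pos D. l \<le> x) \<and>
      (\<forall>u\<in>\<beta> ` Neg C. x < u) \<and> (\<forall>u\<in>\<beta> ` Neg D. x \<le> u)"
  proof (rule finite_interpolation)
    show "l < u" if lu: "l \<in> \<beta> ` Pos C" "u \<in> \<beta> ` Neg C" for l u
    proof -
      obtain c1 c2 where c: "c1 \<in> Pos C" "c2 \<in> Neg C" "l = \<beta> c1" "u = \<beta> c2" using lu by blast
      then have "0 < s (comb (c1, c2))" by (intro sC) blast
      then show ?thesis using c lt by (simp add: Pos_def Neg_def)
    qed
    show "l < u" if lu: "l \<in> \<beta> ` Pos C" "u \<in> \<beta> ` Neg D" for l u
    proof -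
      obtain c1 c2 where c: "c1 \<in> Pos C" "c2 \<in> Neg D" "l = \<beta> c1" "u = \<beta> c2" using lu by blast
      then have "0 < s (comb (c1, c2))" by (intro sC) blast
      then show ?thesis using c lt by (simp add: Pos_def Neg_def)
    qed
    show "l < u" if lu: "l \<in> \<beta> ` Pos D" "u \<in> \<beta> ` Neg C" for l u
    proof -
      obtain c1 c2 where c: "c1 \<in> Pos D" "c2 \<in> Neg C" "l = \<beta> c1" "u = \<beta> c2" using lu by blast
      then have "0 < s (comb (c1, c2))" by (intro sC) blast
      then show ?thesis using c lt by (simp add: Pos_def Neg_def)
    qed
    show "l \<le> u" if lu: "l \<in> \<beta> ` Pos D" "u \<in> \<beta> ` Neg D" for l u
    proof -
      obtain c1 c2 where c: "c1 \<in> Pos D" "c2 \<in> Neg D" "l = \<beta> c1" "u = \<beta> c2" using lu by blast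
      then have "0 \<le> s (comb (c1, c2))" by (intro sD) blast
      then show ?thesis using c le by (simp add: Pos_def Neg_def)
    qed
  qed (use fin insert.prems(5,7) in simp_all)
  then obtain x where x': "(\<forall>l\<in>\<beta> ` Pos C. l < x) \<and> (\<forall>l\<in>\<beta> ` Pos D. l \<le> x) \<and>
      (\<forall>u\<in>\<beta> ` Neg C. x < u) \<and> (\<forall>u\<in>\<beta> ` Neg D. x \<le> u)" by (elim exE)
  have x: "c \<in> C \<Longrightarrow> c w > 0 \<Longrightarrow> \<beta> c < x" "c \<in> D \<Longrightarrow> c w > 0 \<Longrightarrow> \<beta> c \<le> x"
    "c \<in> C \<Longrightarrow> c w < 0 \<Longrightarrow> x < \<beta> c" "c \<in> D \<Longrightarrow> c w < 0 \<Longrightarrow> x \<le> \<beta> c" for c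
    using x' by (simp_all add: Pos_def Neg_def)
  have sum: "(\<Sum>v\<in>insert w V. of_int (c v) * (L(w := x)) v) = of_int (c w) * x + s c" for c
    using insert.hyps by (auto simp: s_def intro!: sum.cong)
  show ?case
  proof (intro exI[of _ "L(w := x)"] conjI ballI)
    fix c assume c: "c \<in> C"
    consider "c w = 0" | "c w > 0" | "c w < 0" by linarith
    then have "0 < of_int (c w) * x + s c"
    proof cases
      case 1
      then show ?thesis using c sC[of c] by (simp add: Z_def)
    next
      case 2
      then have "(0::rat) < of_int (c w)" by simp
      then show ?thesis using x(1)[OF c 2] by (simp add: \<beta>_def field_simps)
    next
      case 3
      then have "of_int (c w) < (0::rat)" by simp
      then show ?thesis using x(3)[OF c 3] by (simp add: \<beta>_def field_simps)
    qed
    then show "0 < (\<Sum>v\<in>insert w V. of_int (c v) * (L(w := x)) v)" using sum by simp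
  next
    fix c assume c: "c \<in> D"
    consider "c w = 0" | "c w > 0" | "c w < 0" by linarith
    then have "0 \<le> of_int (c w) * x + s c"
    proof cases
      case 1
      then show ?thesis using c sD[of c] by (simp add: Z_def)
    next
      case 2
      then have "(0::rat) < of_int (c w)" by simp
      then show ?thesis using x(2)[OF c 2] by (simp add: \<beta>_def field_simps)
    next
      case 3
      then have "of_int (c w) < (0::rat)" by simp
      then show ?thesis using x(4)[OF c 3] by (simp add: \<beta>_def field_simps)
    qed
    then show "0 \<le> (\<Sum>v\<in>insert w V. of_int (c v) * (L(w := x)) v)" using sum by simp
  qed
qed

lemma common_denominator:
  fixes L :: "'v \<Rightarrow> rat"
  assumes "finite V"
  shows "\<exists>N :: int. N > 0 \<and> (\<forall>v\<in>V. \<exists>k :: int. of_int N * L v = of_int k)"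
  using assms
proof (induction V rule: finite_induct)
  case empty
  then show ?case by (intro exI[of _ 1]) simp
next
  case (insert w V)
  then obtain N :: int where N: "N > 0" "\<And>v. v \<in> V \<Longrightarrow> \<exists>k :: int. of_int N * L v = of_int k" by blast
  obtain a b :: int where ab: "L w = of_int a / of_int b" "b > 0"
    by (metis Fract_of_int_quotient Rat_cases)
  have "\<exists>k :: int. of_int (N * b) * L v = of_int k" if "v \<in> insert w V" for v
  proof (cases "v = w")
    case True
    then show ?thesis using ab by (intro exI[of _ "N * a"]) simp
  next
    case False
    then have "v \<in> V" using that by simp
    then obtain k :: int where "of_int N * L v = of_int k" using N(2) by blast
    then show ?thesis by (intro exI[of _ "k * b"]) (simp add: mult_ac)
  qed
  then show ?case using N(1) ab(2) by (intro exI[of _ "N * b"]) simp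
qed

text \<open>The value of a word in the maps at \<open>b\<close> depends only on how often each
  letter occurs. The difference of two count vectors counts as a strict or a weak consequence
  according to how the two values compare. Concatenation of words adds such vectors, and
  irreflexivity keeps the zero vector out of the strict ones, so the wanted relations have no
  contradictory consequence. A rational solution exists and is cleared of denominators.\<close>

lemma commuting_maps_weights:
  fixes \<tau> :: "'v \<Rightarrow> 'o \<Rightarrow> 'o" and lt :: "'o \<Rightarrow> 'o \<Rightarrow> bool"
  assumes "finite V"
    and \<tau>: "\<And>v p. v \<in> V \<Longrightarrow> p \<in> \<Omega> \<Longrightarrow> \<tau> v p \<in> \<Omega>"
    and comm: "\<And>v w p. v \<in> V \<Longrightarrow> w \<in> V \<Longrightarrow> p \<in> \<Omega> \<Longrightarrow> \<tau> v (\<tau> w p) = \<tau> w (\<tau> v p)"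
    and mono: "\<And>v p q. v \<in> V \<Longrightarrow> p \<in> \<Omega> \<Longrightarrow> q \<in> \<Omega> \<Longrightarrow> lt p q \<Longrightarrow> lt (\<tau> v p) (\<tau> v q)"
    and irrefl: "\<And>p. p \<in> \<Omega> \<Longrightarrow> \<not> lt p p"
    and trans: "\<And>p q r. p \<in> \<Omega> \<Longrightarrow> q \<in> \<Omega> \<Longrightarrow> r \<in> \<Omega> \<Longrightarrow> lt p q \<Longrightarrow> lt q r \<Longrightarrow> lt p r"
    and b: "b \<in> \<Omega>"
    and Z: "Z \<subseteq> V" "\<And>z. z \<in> Z \<Longrightarrow> lt b (\<tau> z b)"
    and E: "E \<subseteq> V \<times> V \<times> V" "\<And>x y z. (x, y, z) \<in> E \<Longrightarrow> \<tau> x (\<tau> y b) = \<tau> z b"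
  shows "\<exists>L :: 'v \<Rightarrow> int. (\<forall>z\<in>Z. L z > 0) \<and> (\<forall>(x, y, z)\<in>E. L x + L y = L z)"
proof -
  define ev where "ev = (\<lambda>ws. foldr \<tau> ws b)"
  have ev_simps: "ev [] = b" "ev (v # ws) = \<tau> v (ev ws)" for v ws by (simp_all add: ev_def)
  have ev_closed: "ev ws \<in> \<Omega>" if "set ws \<subseteq> V" for ws
    using that by (induction ws) (simp_all add: ev_simps b \<tau>)
  have ev_remove: "ev ws = \<tau> x (ev (remove1 x ws))" if "x \<in> set ws" "set ws \<subseteq> V" for x ws
    using that
  proof (induction ws)
    case (Cons y ws)
    show ?case
    proof (cases "x = y")
      case False
      then have "x \<in> set ws" using Cons by simp
      moreover have "ev (remove1 x ws) \<in> \<Omega>"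
        using Cons.prems set_remove1_subset[of x ws] by (intro ev_closed) auto
      ultimately show ?thesis
        using Cons False comm[of y x "ev (remove1 x ws)"] by (auto simp: ev_simps)
    qed (simp add: ev_simps)
  qed simp
  have ev_count: "ev ws = ev us" if "\<And>v. count_list ws v = count_list us v" "set us \<subseteq> V" for ws us
    using that
  proof (induction ws arbitrary: us)
    case Nil
    then have "set us = {}" by (metis count_list.simps(1) count_list_0_iff equals0I)
    then show ?case by simp
  next
    case (Cons x ws)
    have "count_list us x \<noteq> 0" using Cons.prems(1)[of x] by simp
    then have "x \<in> set us" by (simp add: count_list_0_iff)
    moreover have "count_list ws v = count_list (remove1 x us) v" for v
      using Cons.prems(1)[of v] by (auto split: if_splits)
    moreover have "set (remove1 x us) \<subseteq> V"
      using Cons.prems(2) set_remove1_subset by fast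
    ultimately show ?case
      using Cons.IH[of "remove1 x us"] Cons.prems(2) ev_remove[of x us] by (simp add: ev_simps)
  qed
  have ev_append: "ev (ws @ us) = foldr \<tau> ws (ev us)" for ws us by (simp add: ev_def)
  have fold_mono: "lt (foldr \<tau> ws p) (foldr \<tau> ws q)"
    if "set ws \<subseteq> V" "p \<in> \<Omega>" "q \<in> \<Omega>" "lt p q" for ws p q
  proof -
    have "foldr \<tau> ws p \<in> \<Omega> \<and> foldr \<tau> ws q \<in> \<Omega> \<and> lt (foldr \<tau> ws p) (foldr \<tau> ws q)"
      using that by (induction ws) (auto simp: \<tau> mono)
    then show ?thesis by blast
  qed
  define diff where "diff = (\<lambda>ws us (v :: 'v). int (count_list us v) - int (count_list ws v))"
  have diff_append: "diff (ws @ ws') (us @ us') = (\<lambda>v. diff ws us v + diff ws' us' v)" for ws ws' us us'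
    by (auto simp: diff_def)
  define P where "P = {diff ws us | ws us. set ws \<subseteq> V \<and> set us \<subseteq> V \<and> lt (ev ws) (ev us)}"
  define K where "K = {diff ws us | ws us. set ws \<subseteq> V \<and> set us \<subseteq> V \<and> ev ws = ev us}"
  have swap: "ev (ws @ us) = ev (us @ ws)" if "set ws \<subseteq> V" "set us \<subseteq> V" for ws us
    by (rule ev_count) (use that in auto)
  have lt1: "lt (ev (ws @ ws')) (ev (us @ ws'))"
    if "set ws \<subseteq> V" "set us \<subseteq> V" "set ws' \<subseteq> V" "lt (ev ws) (ev us)" for ws us ws'
    using fold_mono[of ws' "ev ws" "ev us"] that swap[of ws ws'] swap[of us ws'] ev_closed
    by (simp add: ev_append)
  have lt2: "lt (ev (us @ ws')) (ev (us @ us'))"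
    if "set us \<subseteq> V" "set us' \<subseteq> V" "set ws' \<subseteq> V" "lt (ev ws') (ev us')" for us us' ws'
    using fold_mono[of us "ev ws'" "ev us'"] that ev_closed by (simp add: ev_append)
  have eq1: "ev (ws @ ws') = ev (us @ ws')"
    if "set ws \<subseteq> V" "set us \<subseteq> V" "set ws' \<subseteq> V" "ev ws = ev us" for ws us ws'
    using swap[of ws ws'] swap[of us ws'] that by (simp add: ev_append)
  have eq2: "ev (us @ ws') = ev (us @ us')" if "ev ws' = ev us'" for us us' ws'
    using that by (simp add: ev_append)
  define C where "C = (\<lambda>z. diff [] [z]) ` Z"
  \<comment> \<open>An equation is entered as two opposite weak inequalities.\<close>
  define D where "D = (\<lambda>(x, y, z). diff [x, y] [z]) ` E \<union> (\<lambda>(x, y, z). diff [z] [x, y]) ` E"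
  have "finite E" using E(1) \<open>finite V\<close> by (meson finite_SigmaI finite_subset)
  have "finite Z" using Z(1) \<open>finite V\<close> by (rule finite_subset)
  have "\<exists>L :: 'v \<Rightarrow> rat. (\<forall>c\<in>C. 0 < (\<Sum>v\<in>V. of_int (c v) * L v)) \<and>
    (\<forall>d\<in>D. 0 \<le> (\<Sum>v\<in>V. of_int (d v) * L v))"
  proof (rule fourier_motzkin[OF \<open>finite V\<close>, of P K])
    fix a a' assume a: "a \<in> P" "a' \<in> P"
    then obtain ws us ws' us' where *: "a = diff ws us" "a' = diff ws' us'"
      "set ws \<subseteq> V" "set us \<subseteq> V" "lt (ev ws) (ev us)" "set ws' \<subseteq> V" "set us' \<subseteq> V" "lt (ev ws') (ev us')"
      by (auto simp: P_def)
    have "lt (ev (ws @ ws')) (ev (us @ us'))"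
      using lt1[of ws us ws'] lt2[of us us' ws'] * ev_closed
      by (metis Un_subset_iff set_append trans)
    then show "(\<lambda>v. a v + a' v) \<in> P"
      unfolding P_def mem_Collect_eq using *
      by - (rule exI[of _ "ws @ ws'"], rule exI[of _ "us @ us'"], simp add: diff_append)
  next
    fix a a' assume a: "a \<in> P" "a' \<in> K"
    then obtain ws us ws' us' where *: "a = diff ws us" "a' = diff ws' us'"
      "set ws \<subseteq> V" "set us \<subseteq> V" "lt (ev ws) (ev us)" "set ws' \<subseteq> V" "set us' \<subseteq> V" "ev ws' = ev us'"
      by (auto simp: P_def K_def)
    have "lt (ev (ws @ ws')) (ev (us @ us'))"
      using lt1[of ws us ws'] eq2[of ws' us' us] * by simp
    then show "(\<lambda>v. a v + a' v) \<in> P"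
      unfolding P_def mem_Collect_eq using *
      by - (rule exI[of _ "ws @ ws'"], rule exI[of _ "us @ us'"], simp add: diff_append)
  next
    fix a a' assume a: "a \<in> K" "a' \<in> K"
    then obtain ws us ws' us' where *: "a = diff ws us" "a' = diff ws' us'"
      "set ws \<subseteq> V" "set us \<subseteq> V" "ev ws = ev us" "set ws' \<subseteq> V" "set us' \<subseteq> V" "ev ws' = ev us'"
      by (auto simp: K_def)
    have "ev (ws @ ws') = ev (us @ us')"
      using eq1[of ws us ws'] eq2[of ws' us' us] * by simp
    then show "(\<lambda>v. a v + a' v) \<in> K"
      unfolding K_def mem_Collect_eq using *
      by - (rule exI[of _ "ws @ ws'"], rule exI[of _ "us @ us'"], simp add: diff_append)
  next
    fix a assume "a \<in> P"
    then obtain ws us where *: "a = diff ws us" "set ws \<subseteq> V" "set us \<subseteq> V" "lt (ev ws) (ev us)"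
      by (auto simp: P_def)
    show "\<exists>v\<in>V. a v \<noteq> 0"
    proof (rule ccontr)
      assume "\<not> ?thesis"
      then have "count_list us v = count_list ws v" if "v \<in> V" for v
        using that * by (auto simp: diff_def)
      moreover have "count_list us v = count_list ws v" if "v \<notin> V" for v
        using that * by (metis count_notin subsetD)
      ultimately have "ev ws = ev us"
        using *(3) by (intro ev_count) metis+
      then show False using * irrefl ev_closed by metis
    qed
  next
    show "C \<subseteq> P"
    proof
      fix c assume "c \<in> C"
      then obtain z where "z \<in> Z" "c = diff [] [z]" by (auto simp: C_def)
      then show "c \<in> P"
        unfolding P_def mem_Collect_eq using Z
        by - (rule exI[of _ "[]"], rule exI[of _ "[z]"], auto simp: ev_simps)
    qed
    show "D \<subseteq> K"
    proof
      fix d assume "d \<in> D"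
      then obtain x y z where xyz: "(x, y, z) \<in> E" "d = diff [x, y] [z] \<or> d = diff [z] [x, y]"
        by (auto simp: D_def)
      have eq: "ev [x, y] = ev [z]" using E(2)[OF xyz(1)] by (simp add: ev_simps)
      have V: "set [x, y] \<subseteq> V" "set [z] \<subseteq> V" using E(1) xyz(1) by auto
      from xyz(2) show "d \<in> K"
      proof
        assume "d = diff [x, y] [z]"
        with eq V show ?thesis unfolding K_def by blast
      next
        assume "d = diff [z] [x, y]"
        with eq[symmetric] V show ?thesis unfolding K_def by blast
      qed
    qed
  qed (use \<open>finite E\<close> \<open>finite Z\<close> in \<open>simp_all add: C_def D_def\<close>)
  then obtain L :: "'v \<Rightarrow> rat" where LC: "\<And>c. c \<in> C \<Longrightarrow> 0 < (\<Sum>v\<in>V. of_int (c v) * L v)"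
    and LD: "\<And>d. d \<in> D \<Longrightarrow> 0 \<le> (\<Sum>v\<in>V. of_int (d v) * L v)" by blast
  obtain N :: int where N: "N > 0" "\<And>v. v \<in> V \<Longrightarrow> \<exists>k :: int. of_int N * L v = of_int k"
    using common_denominator[OF \<open>finite V\<close>, of L] by blast
  then obtain M :: "'v \<Rightarrow> int" where M: "\<And>v. v \<in> V \<Longrightarrow> of_int N * L v = of_int (M v)"
    by metis
  have single: "(\<Sum>v\<in>V. of_int (int (count_list [z] v)) * L v) = L z" if "z \<in> V" for z
  proof -
    have "(\<Sum>v\<in>V. of_int (int (count_list [z] v)) * L v) = (\<Sum>v\<in>V. if z = v then L v else 0)"
      by (intro sum.cong) auto
    then show ?thesis using that \<open>finite V\<close> by simp
  qed
  have double: "(\<Sum>v\<in>V. of_int (int (count_list [x, y] v)) * L v) = L x + L y" if "x \<in> V" "y \<in> V" for x y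
  proof -
    have "(\<Sum>v\<in>V. of_int (int (count_list [x, y] v)) * L v)
        = (\<Sum>v\<in>V. (if x = v then L v else 0) + (if y = v then L v else 0))"
      by (intro sum.cong) (auto simp: algebra_simps)
    then show ?thesis using that \<open>finite V\<close> by (simp add: sum.distrib)
  qed
  have pos: "0 < L z" if "z \<in> Z" for z
  proof -
    have "0 < (\<Sum>v\<in>V. of_int (diff [] [z] v) * L v)" using LC that by (auto simp: C_def)
    then show ?thesis using single[of z] that Z(1) by (auto simp: diff_def)
  qed
  have add: "L x + L y = L z" if "(x, y, z) \<in> E" for x y z
  proof -
    have "0 \<le> (\<Sum>v\<in>V. of_int (diff [x, y] [z] v) * L v)" "0 \<le> (\<Sum>v\<in>V. of_int (diff [z] [x, y] v) * L v)"
      using LD that by (force simp: D_def)+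
    moreover have "x \<in> V" "y \<in> V" "z \<in> V" using that E(1) by auto
    ultimately show ?thesis
      using single[of z] double[of x y]
      by (simp add: diff_def of_int_diff left_diff_distrib sum_subtractf del: count_list.simps of_int_of_nat_eq)
  qed
  have "0 < M z" if "z \<in> Z" for z
  proof -
    have "(0::rat) < of_int (M z)" using pos[OF that] M[of z] N(1) that Z(1) by (metis of_int_0_less_iff subsetD zero_less_mult_iff)
    then show ?thesis by simp
  qed
  moreover have "M x + M y = M z" if "(x, y, z) \<in> E" for x y z
  proof -
    have "x \<in> V" "y \<in> V" "z \<in> V" using that E(1) by auto
    then have "(of_int (M x + M y) :: rat) = of_int (M z)"
      using add[OF that] by (simp add: M[symmetric] flip: distrib_left)
    then show ?thesis by (simp only: of_int_eq_iff)
  qed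
  ultimately show ?thesis by (intro exI[of _ M]) auto
qed

section \<open>Weights on intervals of the top component\<close>

text \<open>Think of \<open>x \<in> [m, 1]\<close> as having a loss, with products adding losses. A pair \<open>(n, y)\<close> stands for \<open>n\<close> times the loss
  of \<open>m\<close> plus the loss of \<open>y\<close>, and \<open>shift x\<close> adds the loss of \<open>x\<close> with carry. This is Chang's group of an MV-chain, represented by
  its translations so that associativity comes for free.\<close>

locale si_gbl_floor = si_gbl +
  fixes m
  assumes m_top [simp]: "m \<in> top_part" and m_neq_one: "m \<noteq> \<one>"
begin

definition segment :: "'a set" where "segment = {x \<in> top_part. m \<preceq> x}"

abbreviation neg :: "'a \<Rightarrow> 'a" where "neg x \<equiv> x \<leadsto> m"

definition shift :: "'a \<Rightarrow> nat \<times> 'a \<Rightarrow> nat \<times> 'a" where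
  "shift x p = (if x \<otimes> snd p \<preceq> m then (Suc (fst p), neg x \<leadsto> snd p) else (fst p, x \<otimes> snd p))"

text \<open>The second component is a remainder that loses strictly less than \<open>m\<close>. A
  full loss of \<open>m\<close> is recorded as a carry: the loss of \<open>m\<close> itself is
  \<open>(1, \<one>)\<close>.\<close>

definition points :: "(nat \<times> 'a) set" where
  "points = {p. snd p \<in> top_part \<and> \<not> snd p \<preceq> m}"

text \<open>Larger elements lose less, so second components are compared in reverse. On the chain
  \<open>top_part\<close> the negated inequality is the strict one.\<close>

definition less_loss :: "nat \<times> 'a \<Rightarrow> nat \<times> 'a \<Rightarrow> bool" where
  "less_loss p q \<longleftrightarrow> fst p < fst q \<or> fst p = fst q \<and> \<not> snd p \<preceq> snd q"

lemma segmentD: "x \<in> segment \<Longrightarrow> x \<in> top_part" "x \<in> segment \<Longrightarrow> m \<preceq> x"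
  by (simp_all add: segment_def)

lemma segment_carrier [simp]: "x \<in> segment \<Longrightarrow> x \<in> carrier A"
  by (simp add: segmentD)

lemma not_le_top: "\<lbrakk>\<not> x \<preceq> y; x \<in> top_part; y \<in> top_part\<rbrakk> \<Longrightarrow> y \<preceq> x"
  using top_chain by blast

lemma segment_upward: "\<lbrakk>x \<in> segment; x \<preceq> y; y \<in> carrier A\<rbrakk> \<Longrightarrow> y \<in> segment"
  unfolding segment_def by (metis (no_types, lifting) le_trans m_top mem_Collect_eq top_carrier top_upward)

lemma m_segment [simp]: "m \<in> segment"
  by (simp add: segment_def)

lemma one_segment [simp]: "\<one> \<in> segment"
  by (simp add: segment_def)

lemma imp_segment [simp]: "\<lbrakk>x \<in> carrier A; y \<in> segment\<rbrakk> \<Longrightarrow> x \<leadsto> y \<in> segment"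
  by (rule segment_upward[of y]) simp_all

lemma not_le_segment: "\<lbrakk>\<not> y \<preceq> m; y \<in> top_part\<rbrakk> \<Longrightarrow> y \<in> segment"
  using not_le_top[of y m] by (simp add: segment_def)

lemma neg_neg [simp]: "x \<in> segment \<Longrightarrow> neg (neg x) = x"
  by (rule top_wajsberg) (simp_all add: segmentD)

lemma mult_le_m_iff: "\<lbrakk>x \<in> carrier A; y \<in> carrier A\<rbrakk> \<Longrightarrow> x \<otimes> y \<preceq> m \<longleftrightarrow> y \<preceq> neg x"
  by (metis m_comm m_top residuation top_carrier)

lemma cancel_above_m:
  "\<lbrakk>a \<otimes> b = a \<otimes> c; \<not> a \<otimes> b \<preceq> m; a \<in> segment; b \<in> segment; c \<in> segment\<rbrakk> \<Longrightarrow> b = c"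
  using top_cancel[of a b c m] by (simp add: segmentD)

text \<open>Here \<open>x\<close> carries over \<open>y\<close> and \<open>z\<close> does not.
  Multiplied by \<open>neg x\<close>, both sides become \<open>z \<otimes> y\<close>, which is above
  \<open>m\<close>, where cancellation holds.\<close>

lemma shift_comm1:
  assumes xyz: "x \<in> segment" "y \<in> segment" "z \<in> segment" and xy: "x \<otimes> y \<preceq> m" and zy: "\<not> z \<otimes> y \<preceq> m"
  shows "z \<otimes> (neg x \<leadsto> y) = neg x \<leadsto> (z \<otimes> y)"
proof -
  note [simp] = xyz
  have yx: "y \<preceq> neg x" using xy mult_le_m_iff by simp
  have zyx: "z \<otimes> y \<preceq> neg x" using yx by (meson le_trans m_closed imp_closed mult_le2 segment_carrier m_segment xyz)
  have zys: "z \<otimes> y \<in> segment" using zy xyz by (intro not_le_segment top_mult) (simp_all add: segmentD)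
  have l: "neg x \<otimes> (z \<otimes> (neg x \<leadsto> y)) = z \<otimes> y"
    using meet_eq_mult[OF yx] by (simp add: m_lcomm)
  have r: "neg x \<otimes> (neg x \<leadsto> (z \<otimes> y)) = z \<otimes> y"
    using meet_eq_mult[OF zyx] by simp
  have "z \<otimes> y \<preceq> z \<otimes> (neg x \<leadsto> y)"
    by (simp add: mult_mono2)
  then have "z \<otimes> (neg x \<leadsto> y) \<in> segment"
    by (rule segment_upward[OF zys]) simp
  then show ?thesis
    using cancel_above_m[of "neg x"] l r zy zys by simp
qed

text \<open>Neither factor carries over \<open>y\<close> alone, but both together do. The residual
  \<open>p = y \<leadsto> neg x\<close> is also \<open>neg (x \<otimes> y)\<close>, and it factors
  both \<open>neg x = y \<otimes> p\<close> and \<open>z = p \<otimes> B\<close>. Hence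
  \<open>neg x \<otimes> B = z \<otimes> y\<close>, and \<open>neg x\<close> cancels.\<close>

lemma shift_comm2:
  assumes xyz: "x \<in> segment" "y \<in> segment" "z \<in> segment"
    and zy: "\<not> z \<otimes> y \<preceq> m" and xy: "\<not> x \<otimes> y \<preceq> m" and xzy: "x \<otimes> (z \<otimes> y) \<preceq> m"
  shows "neg x \<leadsto> (z \<otimes> y) = neg z \<leadsto> (x \<otimes> y)"
proof -
  note [simp] = xyz
  define p where "p = y \<leadsto> neg x"
  define B where "B = neg z \<leadsto> (x \<otimes> y)"
  have zys: "z \<otimes> y \<in> segment" using zy xyz by (intro not_le_segment top_mult) (simp_all add: segmentD)
  have xys: "x \<otimes> y \<in> segment" using xy xyz by (intro not_le_segment top_mult) (simp_all add: segmentD)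
  have [simp]: "p \<in> segment" by (simp add: p_def)
  have [simp]: "B \<in> segment" using xys by (simp add: B_def)
  have "neg x \<preceq> y"
    using xy by (intro not_le_top) (simp_all add: mult_le_m_iff segmentD)
  then have yp: "y \<otimes> p = neg x" by (simp add: p_def meet_eq_mult)
  have neg_xy: "neg (x \<otimes> y) = p"
    using imp_curry[of y x m] by (simp add: p_def m_comm)
  have "B = neg z \<leadsto> neg p" using neg_neg[OF xys] neg_xy by (simp add: B_def)
  also have "\<dots> = p \<leadsto> neg (neg z)" by (rule imp_left_commute) simp_all
  finally have B: "B = p \<leadsto> z" by simp
  have "z \<otimes> (x \<otimes> y) \<preceq> m" using xzy by (simp add: m_lcomm)
  then have "z \<preceq> p" using neg_xy by (simp add: residuation)
  then have pB: "p \<otimes> B = z" using B by (simp add: meet_eq_mult)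
  have "neg x \<otimes> B = (y \<otimes> p) \<otimes> B" by (simp only: yp)
  also have "\<dots> = y \<otimes> (p \<otimes> B)" by (simp add: m_assoc)
  also have "\<dots> = z \<otimes> y" unfolding pB by (simp add: m_comm)
  finally have l: "neg x \<otimes> B = z \<otimes> y" .
  have "z \<otimes> y \<preceq> neg x" using xzy by (simp add: mult_le_m_iff)
  then have r: "neg x \<otimes> (neg x \<leadsto> (z \<otimes> y)) = z \<otimes> y" by (simp add: meet_eq_mult)
  have "neg x \<leadsto> (z \<otimes> y) = B"
    using cancel_above_m[of "neg x" "neg x \<leadsto> (z \<otimes> y)" B] l r zy zys by simp
  then show ?thesis by (simp add: B_def)
qed

text \<open>Each factor carries over \<open>y\<close>, but \<open>x\<close> does not carry a second
  time after \<open>z\<close>. With \<open>a\<close> the remainder left by \<open>z\<close> and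
  \<open>q = a \<leadsto> neg x\<close>, both sides turn out to be \<open>neg q\<close>.\<close>

lemma shift_comm3:
  assumes xyz: "x \<in> segment" "y \<in> segment" "z \<in> segment" and y: "\<not> y \<preceq> m"
    and xy: "x \<otimes> y \<preceq> m" and zy: "z \<otimes> y \<preceq> m" and xA: "\<not> x \<otimes> (neg z \<leadsto> y) \<preceq> m"
  shows "z \<otimes> (neg x \<leadsto> y) = x \<otimes> (neg z \<leadsto> y)"
proof -
  note [simp] = xyz
  define a where "a = neg z \<leadsto> y"
  define b where "b = neg x \<leadsto> y"
  define q where "q = a \<leadsto> neg x"
  have [simp]: "a \<in> segment" "b \<in> segment" "q \<in> segment" by (simp_all add: a_def b_def q_def)
  have yx: "y \<preceq> neg x" and yz: "y \<preceq> neg z" using xy zy by (simp_all add: mult_le_m_iff)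
  have "neg x \<preceq> a"
    using xA by (intro not_le_top) (simp_all add: mult_le_m_iff segmentD flip: a_def)
  then have aq: "a \<otimes> q = neg x" by (simp add: q_def meet_eq_mult)
  have ya: "a \<otimes> neg z = y" using meet_eq_mult[OF yz] by (simp add: a_def m_comm)
  have "a \<otimes> (a \<leadsto> y) = y" using ya by (metis meet_eq_mult mult_le1 segment_carrier \<open>a \<in> segment\<close> imp_closed m_segment xyz(2,3))
  then have az: "a \<leadsto> y = neg z"
    using cancel_above_m[of a "a \<leadsto> y" "neg z"] ya y by simp
  have "b = q \<leadsto> (a \<leadsto> y)" using imp_curry[of q a y] aq by (simp add: b_def m_comm)
  also have "\<dots> = z \<leadsto> neg q" using az imp_left_commute[of q z m] by simp
  finally have b: "b = z \<leadsto> neg q" .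
  have "x = neg (a \<otimes> q)" using aq by simp
  then have x: "x = a \<leadsto> neg q" by (simp add: imp_curry)
  have "neg q \<preceq> a"
  proof (rule not_le_top)
    show "\<not> a \<preceq> neg q"
    proof
      assume "a \<preceq> neg q"
      then have "x = \<one>" using x by (simp add: imp_eq_one)
      then show False using xy y by simp
    qed
  qed (simp_all add: segmentD)
  then have xa: "x \<otimes> a = neg q" using x meet_eq_mult[of "neg q" a] by (simp add: m_comm)
  have "neg q \<preceq> z"
  proof (rule ccontr)
    assume n: "\<not> neg q \<preceq> z"
    then have "z \<preceq> neg q" by (intro not_le_top) (simp_all add: segmentD)
    then have "b = \<one>" using b by (simp add: imp_eq_one)
    then have "neg x \<preceq> y" by (simp add: b_def imp_eq_one)
    then have "y = neg x" using yx by (simp add: le_antisym)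
    then have "q = neg z" using cancel_above_m[of a q "neg z"] aq ya y by simp
    then show False using n by simp
  qed
  then have "z \<otimes> b = neg q" using b by (simp add: meet_eq_mult)
  with xa show ?thesis by (simp add: a_def b_def)
qed

lemma shift_points:
  assumes "x \<in> segment" "p \<in> points" shows "shift x p \<in> points"
proof (cases "x \<otimes> snd p \<preceq> m")
  case True
  have p: "snd p \<in> top_part" "\<not> snd p \<preceq> m" using assms(2) by (simp_all add: points_def)
  have "snd p \<preceq> neg x \<leadsto> snd p" using assms p by simp
  then have "\<not> neg x \<leadsto> snd p \<preceq> m"
    using p assms(1) by (meson imp_closed le_trans m_top segment_carrier top_carrier)
  then show ?thesis using True p assms(1) by (simp add: shift_def points_def top_imp)
next
  case False
  then show ?thesis using assms by (simp add: shift_def points_def top_mult segmentD)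
qed

lemma shift_commute:
  assumes x: "x \<in> segment" and z: "z \<in> segment" and p: "p \<in> points"
  shows "shift x (shift z p) = shift z (shift x p)"
proof -
  obtain n y where p_eq: "p = (n, y)" by (cases p)
  have y: "y \<in> segment" "\<not> y \<preceq> m"
    using p not_le_segment by (simp_all add: p_eq points_def)
  note [simp] = x z y
  have shift: "shift x (n, y) = (if x \<otimes> y \<preceq> m then (Suc n, neg x \<leadsto> y) else (n, x \<otimes> y))" for x n y
    by (simp add: shift_def)
  have mixed: "shift x (shift z (n, y)) = shift z (shift x (n, y))"
    if xz: "x \<in> segment" "z \<in> segment" and xy: "x \<otimes> y \<preceq> m" and zy: "\<not> z \<otimes> y \<preceq> m" for x z
  proof -
    note [simp] = xz
    have "x \<otimes> (z \<otimes> y) \<preceq> x \<otimes> y" by (simp add: mult_mono2)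
    then have 1: "x \<otimes> (z \<otimes> y) \<preceq> m" using xy by (rule le_trans) simp_all
    have 2: "z \<otimes> (neg x \<leadsto> y) = neg x \<leadsto> (z \<otimes> y)"
      by (rule shift_comm1) (simp_all add: xy zy)
    have "z \<otimes> y \<preceq> neg x \<leadsto> (z \<otimes> y)" by simp
    then have "\<not> neg x \<leadsto> (z \<otimes> y) \<preceq> m" using zy
      by (meson imp_closed le_trans m_closed segment_carrier m_segment xz y(1))
    then show ?thesis using xy zy 1 2 by (simp add: shift)
  qed
  have "shift x (shift z (n, y)) = shift z (shift x (n, y))"
  proof (cases "x \<otimes> y \<preceq> m"; cases "z \<otimes> y \<preceq> m")
    assume xy: "x \<otimes> y \<preceq> m" and zy: "z \<otimes> y \<preceq> m"
    let ?a = "neg z \<leadsto> y" and ?b = "neg x \<leadsto> y"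
    \<comment> \<open>If the second application carries in neither order or in both, the two orders
      are easily compared; this equation excludes that it carries in just one.\<close>
    have eq: "z \<otimes> ?b = x \<otimes> ?a" if "\<not> x \<otimes> ?a \<preceq> m \<or> \<not> z \<otimes> ?b \<preceq> m"
      using that shift_comm3[OF x y(1) z y(2) xy zy] shift_comm3[OF z y(1) x y(2) zy xy] by metis
    have "neg x \<leadsto> ?a = neg z \<leadsto> ?b" by (rule imp_left_commute) simp_all
    then show ?thesis
      using eq xy zy by (cases "x \<otimes> ?a \<preceq> m"; cases "z \<otimes> ?b \<preceq> m") (simp_all add: shift)
  next
    assume "x \<otimes> y \<preceq> m" "\<not> z \<otimes> y \<preceq> m"
    then show ?thesis by (intro mixed) simp_all
  next
    assume "\<not> x \<otimes> y \<preceq> m" "z \<otimes> y \<preceq> m"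
    then show ?thesis by (intro mixed[symmetric]) simp_all
  next
    assume xy: "\<not> x \<otimes> y \<preceq> m" and zy: "\<not> z \<otimes> y \<preceq> m"
    have eq: "x \<otimes> (z \<otimes> y) = z \<otimes> (x \<otimes> y)" by (simp add: m_lcomm)
    show ?thesis
    proof (cases "x \<otimes> (z \<otimes> y) \<preceq> m")
      case True
      have "neg x \<leadsto> (z \<otimes> y) = neg z \<leadsto> (x \<otimes> y)"
        by (rule shift_comm2) (simp_all add: xy zy True)
      then show ?thesis using True xy zy eq by (simp add: shift)
    next
      case False
      then show ?thesis using xy zy eq by (simp add: shift)
    qed
  qed
  then show ?thesis by (simp add: p_eq)
qed

lemma shift_less_loss:
  assumes x: "x \<in> segment" and p: "p \<in> points" and q: "q \<in> points" and pq: "less_loss p q"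
  shows "less_loss (shift x p) (shift x q)"
proof -
  obtain n y k w where eqs: "p = (n, y)" "q = (k, w)" by (cases p, cases q)
  have y: "y \<in> segment" "\<not> y \<preceq> m" and w: "w \<in> segment" "\<not> w \<preceq> m"
    using p q not_le_segment by (simp_all add: eqs points_def)
  note [simp] = x y w
  have carry: "neg x \<otimes> (neg x \<leadsto> y) = y" if "x \<otimes> y \<preceq> m"
    using that by (simp add: mult_le_m_iff meet_eq_mult)
  have pq': "n < k \<or> n = k \<and> \<not> y \<preceq> w" using pq by (simp add: less_loss_def eqs)
  show ?thesis
  proof (cases "x \<otimes> y \<preceq> m"; cases "x \<otimes> w \<preceq> m")
    assume xy: "x \<otimes> y \<preceq> m" and xw: "x \<otimes> w \<preceq> m"
    have "\<not> neg x \<leadsto> y \<preceq> neg x \<leadsto> w" if "\<not> y \<preceq> w"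
    proof
      assume "neg x \<leadsto> y \<preceq> neg x \<leadsto> w"
      then have "(neg x \<leadsto> y) \<otimes> neg x \<preceq> w" by (simp add: residuation)
      then show False using that carry[OF xy] by (simp add: m_comm)
    qed
    then show ?thesis using pq' xy xw by (auto simp: less_loss_def eqs shift_def)
  next
    assume xy: "x \<otimes> y \<preceq> m" and xw: "\<not> x \<otimes> w \<preceq> m"
    have "n < k"
    proof (rule ccontr)
      assume "\<not> n < k"
      then have "\<not> y \<preceq> w" using pq' by simp
      then have "w \<preceq> y" by (intro not_le_top) (simp_all add: segmentD)
      then have "x \<otimes> w \<preceq> x \<otimes> y" by (simp add: mult_mono2)
      then have "x \<otimes> w \<preceq> m" using xy by (rule le_trans) simp_all
      with xw show False ..
    qed
    \<comment> \<open>This settles the tie \<open>Suc n = k\<close>: the remainder left by a carry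
      over \<open>x\<close> loses less than \<open>x\<close> alone does.\<close>
    moreover have "\<not> neg x \<leadsto> y \<preceq> x \<otimes> w"
    proof
      assume "neg x \<leadsto> y \<preceq> x \<otimes> w"
      then have "neg x \<otimes> (neg x \<leadsto> y) \<preceq> neg x \<otimes> (x \<otimes> w)" by (simp add: mult_mono2)
      then have "y \<preceq> neg x \<otimes> (x \<otimes> w)" using carry[OF xy] by simp
      also have "neg x \<otimes> (x \<otimes> w) = (x \<otimes> neg x) \<otimes> w" by (simp add: m_ac)
      also have "(x \<otimes> neg x) \<otimes> w \<preceq> x \<otimes> neg x" by simp
      also (le_trans) have "x \<otimes> neg x \<preceq> m" by (rule mult_imp_le) simp_all
      finally (le_trans) show False using y(2) by simp
    qed
    ultimately show ?thesis using xy xw by (auto simp: less_loss_def eqs shift_def)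
  next
    assume "\<not> x \<otimes> y \<preceq> m" "x \<otimes> w \<preceq> m"
    then show ?thesis using pq' by (auto simp: less_loss_def eqs shift_def)
  next
    assume xy: "\<not> x \<otimes> y \<preceq> m" and xw: "\<not> x \<otimes> w \<preceq> m"
    have "\<not> x \<otimes> y \<preceq> x \<otimes> w" if "\<not> y \<preceq> w"
    proof
      assume le: "x \<otimes> y \<preceq> x \<otimes> w"
      have "w \<preceq> y" using that by (intro not_le_top) (simp_all add: segmentD)
      then have "x \<otimes> w \<preceq> x \<otimes> y" by (simp add: mult_mono2)
      with le have "x \<otimes> y = x \<otimes> w" by (simp add: le_antisym)
      then have "y = w" using cancel_above_m[of x y w] xy by simp
      then show False using that by simp
    qed
    then show ?thesis using pq' xy xw by (auto simp: less_loss_def eqs shift_def)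
  qed
qed

lemma less_loss_trans:
  assumes "p \<in> points" "q \<in> points" "r \<in> points" "less_loss p q" "less_loss q r"
  shows "less_loss p r"
proof -
  have "\<not> snd p \<preceq> snd r" if "\<not> snd p \<preceq> snd q" "\<not> snd q \<preceq> snd r"
  proof
    assume "snd p \<preceq> snd r"
    moreover have "snd r \<preceq> snd q"
      using that(2) assms by (intro not_le_top) (simp_all add: points_def)
    ultimately have "snd p \<preceq> snd q"
      using assms by (intro le_trans[of "snd p" "snd r" "snd q"]) (simp_all add: points_def)
    with that(1) show False ..
  qed
  then show ?thesis using assms(4,5) by (auto simp: less_loss_def)
qed

text \<open>The pair \<open>(0, \<one>)\<close> is loss zero, and \<open>shift x\<close> sends it to
  the loss of \<open>x\<close>. The additive law for weights has to be verified at this one point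
  only.\<close>

lemma shift_base:
  assumes "x \<in> segment" "y \<in> segment" "y \<preceq> x"
  shows "shift (x \<leadsto> y) (shift x (0, \<one>)) = shift y (0, \<one>)"
proof -
  note [simp] = assms(1,2)
  have m1: "\<not> \<one> \<preceq> m" using m_neq_one by simp
  have eq_m: "z = m" if "z \<preceq> m" "z \<in> segment" for z
    using that by (simp add: le_antisym segmentD)
  show ?thesis
  proof (cases "x \<preceq> m")
    case True
    then have "y \<preceq> m" using assms(3) by (intro le_trans[of y x m]) simp_all
    then show ?thesis using True eq_m[of x] eq_m[of y] m1 by (simp add: shift_def)
  next
    case False
    have "(x \<leadsto> y) \<otimes> x = y" using meet_eq_mult[OF assms(3)] by (simp add: m_comm)
    then show ?thesis using False eq_m[of y] by (auto simp: shift_def)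
  qed
qed

text \<open>Losses are related through residuals rather than products because residuals of elements
  of the interval stay in it, while a product may drop below \<open>m\<close>. The residual
  \<open>x \<leadsto> y\<close> need not lie in \<open>T\<close>, so its positivity is a separate
  clause.\<close>

definition weight :: "('a \<Rightarrow> int) \<Rightarrow> 'a set \<Rightarrow> bool" where
  "weight L T \<longleftrightarrow> (\<forall>x\<in>T. x \<noteq> \<one> \<longrightarrow> 0 < L x) \<and>
    (\<forall>x\<in>T. \<forall>y\<in>T. y \<preceq> x \<longrightarrow> L (x \<leadsto> y) + L x = L y \<and> (x \<noteq> y \<longrightarrow> 0 < L (x \<leadsto> y)))"

lemma weight_exists:
  assumes "finite T" "T \<subseteq> segment"
  shows "\<exists>L. weight L T"
proof -
  define V where "V = T \<union> (\<lambda>(x, y). x \<leadsto> y) ` (T \<times> T)"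
  define E where "E = {(x \<leadsto> y, x, y) | x y. x \<in> T \<and> y \<in> T \<and> y \<preceq> x}"
  have V: "V \<subseteq> segment" using subsetD[OF assms(2)] by (auto simp: V_def)
  have "\<exists>L :: 'a \<Rightarrow> int. (\<forall>z\<in>V - {\<one>}. L z > 0) \<and> (\<forall>(x, y, z)\<in>E. L x + L y = L z)"
  proof (rule commuting_maps_weights[where \<tau> = shift and lt = less_loss and \<Omega> = points and V = V and b = "(0, \<one>)"])
    show "finite V" using assms(1) by (simp add: V_def)
    show "less_loss (0, \<one>) (shift z (0, \<one>))" if "z \<in> V - {\<one>}" for z
      using that subsetD[OF V, of z] by (auto simp: less_loss_def shift_def)
    show "(0, \<one>) \<in> points" using m_neq_one by (simp add: points_def)
    show "E \<subseteq> V \<times> V \<times> V" by (auto simp: E_def V_def)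
    show "shift x (shift y (0, \<one>)) = shift z (0, \<one>)" if "(x, y, z) \<in> E" for x y z
      using that subsetD[OF assms(2)] by (auto simp: E_def intro!: shift_base)
    show "\<not> less_loss p p" if "p \<in> points" for p
      using that by (simp add: less_loss_def points_def)
  qed (use subsetD[OF V] in \<open>auto intro: shift_points shift_commute shift_less_loss less_loss_trans\<close>)
  then obtain L :: "'a \<Rightarrow> int" where
    L: "\<forall>z\<in>V - {\<one>}. L z > 0" "\<forall>(x, y, z)\<in>E. L x + L y = L z" by (elim exE conjE)
  have "x \<leadsto> y \<noteq> \<one>" if "x \<in> T" "y \<in> T" "y \<preceq> x" "x \<noteq> y" for x y
  proof -
    have "x \<in> carrier A" "y \<in> carrier A" using that(1,2) assms(2) by auto
    then show ?thesis using that(3,4) by (auto simp: imp_eq_one le_antisym)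
  qed
  moreover have "x \<leadsto> y \<in> V" if "x \<in> T" "y \<in> T" for x y
    using that by (auto simp: V_def)
  moreover have "L (x \<leadsto> y) + L x = L y" if "x \<in> T" "y \<in> T" "y \<preceq> x" for x y
    using L(2) that by (auto simp: E_def)
  moreover have "T \<subseteq> V" by (auto simp: V_def)
  ultimately have "weight L T"
    unfolding weight_def using L(1) by (simp add: subset_iff)
  then show ?thesis by (rule exI[of _ L])
qed

end

section \<open>Local embeddings of the top component into finite chains\<close>

text \<open>On \<open>S\<close>, \<open>\<psi>\<close> behaves like a homomorphism into the chain with \<open>N + 1\<close> elements that sends exactly \<open>G\<close> to \<open>1\<close>
  and everything outside \<open>U\<close> to \<open>0\<close>. Implications outside \<open>U\<close> are not constrained: in the countermodel they
  are refuted at a higher point.\<close>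

definition local_emb :: "('a, 'm) rlat_scheme \<Rightarrow> 'a set \<Rightarrow> 'a set \<Rightarrow> 'a set \<Rightarrow> nat \<Rightarrow> ('a \<Rightarrow> real) \<Rightarrow> bool" where
  "local_emb A S G U N \<psi> \<longleftrightarrow>
    (\<forall>x\<in>S. \<exists>i\<le>N. \<psi> x = real i / real N) \<and>
    (\<forall>x\<in>S. \<psi> x = 1 \<longleftrightarrow> x \<in> G) \<and>
    (\<forall>x\<in>S. x \<notin> U \<longrightarrow> \<psi> x = 0) \<and>
    (\<zero>\<^bsub>A\<^esub> \<in> S \<longrightarrow> \<psi> \<zero>\<^bsub>A\<^esub> = 0) \<and>
    (\<forall>x\<in>S. \<forall>y\<in>S. x \<otimes>\<^bsub>A\<^esub> y \<in> S \<longrightarrow> \<psi> (x \<otimes>\<^bsub>A\<^esub> y) = max 0 (\<psi> x + \<psi> y - 1)) \<and>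
    (\<forall>x\<in>S. \<forall>y\<in>S. x \<curlywedge>\<^bsub>A\<^esub> y \<in> S \<longrightarrow> \<psi> (x \<curlywedge>\<^bsub>A\<^esub> y) = min (\<psi> x) (\<psi> y)) \<and>
    (\<forall>x\<in>S. \<forall>y\<in>S. x \<curlyvee>\<^bsub>A\<^esub> y \<in> S \<longrightarrow> \<psi> (x \<curlyvee>\<^bsub>A\<^esub> y) = max (\<psi> x) (\<psi> y)) \<and>
    (\<forall>x\<in>S. \<forall>y\<in>S. x \<leadsto>\<^bsub>A\<^esub> y \<in> S \<longrightarrow> x \<leadsto>\<^bsub>A\<^esub> y \<in> U \<longrightarrow> \<psi> (x \<leadsto>\<^bsub>A\<^esub> y) = min 1 (1 - \<psi> x + \<psi> y))"

context si_gbl_floor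
begin

lemma top_pow: "x \<in> top_part \<Longrightarrow> x [^] (i::nat) \<in> top_part"
  by (induction i) (simp_all add: top_mult)

lemma weight_one: "\<lbrakk>weight L T; \<one> \<in> T\<rbrakk> \<Longrightarrow> L \<one> = 0"
  unfolding weight_def by force

lemma weight_imp: "\<lbrakk>weight L T; x \<in> T; y \<in> T; y \<preceq> x\<rbrakk> \<Longrightarrow> L (x \<leadsto> y) + L x = L y"
  by (simp add: weight_def)

lemma weight_antimono:
  assumes "weight L T" "x \<in> T" "y \<in> T" "y \<preceq> x" shows "L x \<le> L y"
proof (cases "x = y")
  case False
  then have "0 < L (x \<leadsto> y)" using assms by (simp add: weight_def)
  then show ?thesis using weight_imp[OF assms] by simp
qed simp

text \<open>Losses are rescaled so that \<open>m\<close> loses exactly 1. A product is reached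
  through \<open>t = x \<leadsto> x \<otimes> y\<close>, for which the losses do add. If
  \<open>t\<close> differs from the factor \<open>y\<close>, cancellation has failed, so the product
  is \<open>m\<close>; since \<open>t\<close> loses at most as much as \<open>y\<close>, the losses
  of the factors then sum to at least that of \<open>m\<close>, and the Lukasiewicz product is
  truncated to 0 as well.\<close>

lemma weight_local_emb:
  assumes S: "S \<subseteq> carrier A" "\<And>x. x \<in> S \<Longrightarrow> x \<in> top_part \<Longrightarrow> m \<preceq> x"
    and L: "weight L T" and T: "\<one> \<in> T" "m \<in> T" "T \<subseteq> segment" "S \<inter> top_part \<subseteq> T"
    and TT: "\<And>x y. \<lbrakk>x \<in> S \<inter> top_part; y \<in> S \<inter> top_part; x \<otimes> y \<in> S\<rbrakk> \<Longrightarrow> x \<leadsto> x \<otimes> y \<in> T"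
  defines "\<psi> \<equiv> \<lambda>x. if x \<in> top_part then 1 - real_of_int (L x) / real_of_int (L m) else 0"
  shows "local_emb A S {\<one>} top_part (nat (L m)) \<psi>"
proof -
  have Lm: "0 < L m" using L T m_neq_one by (auto simp: weight_def)
  have L1: "L \<one> = 0" using weight_one[OF L T(1)] .
  have inT: "x \<in> T" if "x \<in> S" "x \<in> top_part" for x using that T(4) by blast
  have le_m: "L x \<le> L m" if "x \<in> T" for x
    using that weight_antimono[OF L that T(2)] T(3) by (auto simp: segmentD)
  have nonneg: "0 \<le> L x" if "x \<in> T" for x
    using that L L1 by (cases "x = \<one>") (auto simp: weight_def)
  have \<psi>_top: "\<psi> x = 1 - real_of_int (L x) / real_of_int (L m)" if "x \<in> top_part" for x
    using that by (simp add: \<psi>_def)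
  have \<psi>_out: "\<psi> x = 0" if "x \<notin> top_part" for x
    using that by (simp add: \<psi>_def)
  have \<psi>_m: "\<psi> m = 0" using Lm by (simp add: \<psi>_def)
  have \<psi>_1: "\<psi> \<one> = 1" using L1 by (simp add: \<psi>_def)
  have \<psi>_ge: "0 \<le> \<psi> x" if "x \<in> S" for x
    using that le_m[of x] inT[of x] Lm by (auto simp: \<psi>_def)
  have \<psi>_mono: "\<psi> x \<le> \<psi> y" if "x \<in> T" "y \<in> T" "x \<preceq> y" for x y
  proof -
    have "x \<in> top_part" "y \<in> top_part" using that T(3) by (auto simp: segmentD)
    then show ?thesis
      using weight_antimono[OF L that(2,1,3)] Lm by (simp add: \<psi>_top divide_right_mono)
  qed
  have C: "x \<in> carrier A" if "x \<in> S" for x using that S(1) by blast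
  have eq_m: "x = m" if "x \<preceq> m" "x \<in> S" "x \<in> top_part" for x
    using that S(2) by (simp add: le_antisym)
  have range: "\<exists>i\<le>nat (L m). \<psi> x = real i / real (nat (L m))" if x: "x \<in> S" for x
  proof (cases "x \<in> top_part")
    case True
    have *: "real (nat (L m - L x)) = real_of_int (L m) - real_of_int (L x)"
      using le_m[OF inT[OF x True]] by simp
    have "\<psi> x = real (nat (L m - L x)) / real (nat (L m))"
      unfolding * using True Lm by (simp add: \<psi>_top field_simps)
    moreover have "nat (L m - L x) \<le> nat (L m)"
      using nonneg[OF inT[OF x True]] by simp
    ultimately show ?thesis by blast
  next
    case False
    then show ?thesis using \<psi>_out by (intro exI[of _ 0]) simp
  qed
  have one_iff: "\<psi> x = 1 \<longleftrightarrow> x = \<one>" if x: "x \<in> S" for x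
  proof (cases "x \<in> top_part \<and> x \<noteq> \<one>")
    case True
    then have "0 < L x" using L inT[OF x] by (auto simp: weight_def)
    then show ?thesis using True Lm by (simp add: \<psi>_top)
  next
    case False
    then show ?thesis using \<psi>_out[of x] \<psi>_1 by auto
  qed
  have zero: "\<psi> \<zero> = 0" if "\<zero> \<in> S"
  proof (cases "\<zero> \<in> top_part")
    case True
    then have "\<zero> = m" using that by (intro eq_m) (simp_all add: zero_least)
    then show ?thesis using \<psi>_m by simp
  qed (rule \<psi>_out)
  have mult: "\<psi> (x \<otimes> y) = max 0 (\<psi> x + \<psi> y - 1)" if xy: "x \<in> S" "y \<in> S" "x \<otimes> y \<in> S" for x y
  proof (cases "x \<in> top_part \<and> y \<in> top_part")
    case True
    note [simp] = C[OF xy(1)] C[OF xy(2)]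
    have xyt: "x \<otimes> y \<in> top_part" using True by (simp add: top_mult)
    define t where "t = x \<leadsto> x \<otimes> y"
    have t: "t \<in> T" using TT[of x y] True xy by (simp add: t_def)
    have ts: "t \<in> segment" using t T(3) by blast
    have Lxy: "L t + L x = L (x \<otimes> y)"
      unfolding t_def using weight_imp[OF L inT[OF xy(1)] inT[OF xy(3)]] True xyt by simp
    show ?thesis
    proof (cases "t = y")
      case t_eq: True
      have "0 \<le> \<psi> (x \<otimes> y)" using \<psi>_ge xy by simp
      moreover have "\<psi> (x \<otimes> y) = \<psi> x + \<psi> y - 1"
        using Lxy True xyt Lm by (simp add: \<psi>_top t_eq field_simps flip: Lxy)
      ultimately show ?thesis by simp
    next
      case False
      have "y \<preceq> t" unfolding t_def using le_imp_mult[of y x] by (simp add: m_comm)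
      have "x \<otimes> t = x \<otimes> y" by (simp add: t_def meet_eq_mult)
      then have "x \<otimes> y \<preceq> m"
        using False top_cancel[of x t y m] True ts by (auto simp: segmentD)
      then have "x \<otimes> y = m" using eq_m xy xyt by simp
      moreover have "L t \<le> L y"
        using weight_antimono[OF L t inT[OF xy(2)]] True \<open>y \<preceq> t\<close> by simp
      ultimately have le: "L m \<le> L x + L y" using Lxy by simp
      have "\<psi> x + \<psi> y - 1 = 1 - real_of_int (L x + L y) / real_of_int (L m)"
        using True by (simp add: \<psi>_top add_divide_distrib)
      also have "\<dots> \<le> 0" using le Lm by (simp only: of_int_le_iff le_divide_eq_1_pos of_int_0_less_iff diff_le_0_iff_le)
      finally show ?thesis using \<open>x \<otimes> y = m\<close> \<psi>_m by simp
    qed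
  next
    case False
    have "x \<otimes> y \<preceq> x" "x \<otimes> y \<preceq> y" using C xy by simp_all
    then have "x \<otimes> y \<notin> top_part" using False C xy top_upward by blast
    moreover have "\<psi> x + \<psi> y - 1 \<le> 0"
    proof -
      have "\<psi> z \<le> 1" if "z \<in> S" for z
        using that nonneg[OF inT[OF that]] Lm by (cases "z \<in> top_part") (simp_all add: \<psi>_def)
      then have "\<psi> x \<le> 1" "\<psi> y \<le> 1" using xy by simp_all
      then show ?thesis using False \<psi>_out[of x] \<psi>_out[of y] by linarith
    qed
    ultimately show ?thesis using \<psi>_out by simp
  qed
  have meet: "\<psi> (x \<curlywedge> y) = min (\<psi> x) (\<psi> y)" if xy: "x \<in> S" "y \<in> S" "x \<curlywedge> y \<in> S" for x y
  proof (cases "x \<in> top_part \<and> y \<in> top_part")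
    case True
    have *: "\<psi> (x \<curlywedge> y) = min (\<psi> x) (\<psi> y)" if "x \<preceq> y" "x \<in> S" "y \<in> S" "x \<in> top_part" "y \<in> top_part" for x y
      using that \<psi>_mono[OF inT inT, of x y] by (simp add: rle_def)
    from True top_chain have "x \<preceq> y \<or> y \<preceq> x" by blast
    then show ?thesis using *[of x y] *[of y x] True xy C by (auto simp: meet_comm min.commute)
  next
    case False
    have "x \<curlywedge> y \<preceq> x" "x \<curlywedge> y \<preceq> y" using C xy by simp_all
    then have "x \<curlywedge> y \<notin> top_part" using False C xy top_upward by blast
    then show ?thesis using False \<psi>_out \<psi>_ge xy by (metis min.absorb1 min.absorb2)
  qed
  have join: "\<psi> (x \<curlyvee> y) = max (\<psi> x) (\<psi> y)" if xy: "x \<in> S" "y \<in> S" "x \<curlyvee> y \<in> S" for x y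
  proof -
    have *: "\<psi> (x \<curlyvee> y) = max (\<psi> x) (\<psi> y)" if "x \<preceq> y" "x \<in> S" "y \<in> S" "y \<in> top_part" for x y
    proof -
      have "\<psi> x \<le> \<psi> y"
        using that \<psi>_mono[OF inT inT, of x y] \<psi>_out[of x] \<psi>_ge[of y] by (cases "x \<in> top_part") simp_all
      then show ?thesis using that C by (simp add: le_join_iff)
    qed
    consider "y \<in> top_part" "x \<preceq> y" | "x \<in> top_part" "y \<preceq> x" | "x \<notin> top_part" "y \<notin> top_part"
      using top_chain notin_top_le C xy by blast
    then show ?thesis
    proof cases
      case 1
      then show ?thesis using *[of x y] xy by simp
    next
      case 2
      then show ?thesis using *[of y x] xy C by (simp add: join_comm max.commute)
    next
      case 3
      have "\<psi> (x \<curlyvee> y) = 0"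
      \<comment> \<open>Two elements below the top part may have their join inside it. The join is
        then below \<open>m\<close>, hence equal to \<open>m\<close>, and still has value 0.\<close>
      proof (cases "x \<curlyvee> y \<in> top_part")
        case True
        have "x \<curlyvee> y \<preceq> m" using 3 C xy by (intro join_least notin_top_le) simp_all
        then have "x \<curlyvee> y = m" using eq_m True xy by simp
        then show ?thesis using \<psi>_m by simp
      qed (rule \<psi>_out)
      then show ?thesis using 3 \<psi>_out by simp
    qed
  qed
  have imp: "\<psi> (x \<leadsto> y) = min 1 (1 - \<psi> x + \<psi> y)"
    if xy: "x \<in> S" "y \<in> S" "x \<leadsto> y \<in> S" "x \<leadsto> y \<in> top_part" for x y
  proof (cases "y \<in> top_part")
    case y: True
    show ?thesis
    proof (cases "x \<preceq> y")
      case True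
      then have "\<psi> x \<le> \<psi> y"
        using \<psi>_mono[OF inT inT, of x y] xy y \<psi>_out[of x] \<psi>_ge[of y] by (cases "x \<in> top_part") simp_all
      then show ?thesis using True C xy \<psi>_1 imp_eq_one[of x y] by simp
    next
      case False
      then have x: "x \<in> top_part" using notin_top_le[of x y] C xy y by blast
      then have yx: "y \<preceq> x" using False y top_chain by blast
      have w: "L (x \<leadsto> y) + L x = L y" by (rule weight_imp[OF L inT inT yx]) (use xy x y in simp_all)
      have "\<psi> (x \<leadsto> y) = 1 - \<psi> x + \<psi> y"
        using xy x y Lm by (simp add: \<psi>_top field_simps flip: w)
      moreover have "\<psi> y \<le> \<psi> x" using \<psi>_mono[OF inT inT yx] xy x y by simp
      ultimately show ?thesis by simp
    qed
  next
    case False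
    have "x \<leadsto> y = \<one>" using imp_notin_top[OF False, of x] C xy by auto
    then have "x \<preceq> y" using C xy by (simp add: imp_eq_one)
    then have "x \<notin> top_part" using False top_upward C xy by blast
    then show ?thesis using False \<psi>_out \<open>x \<leadsto> y = \<one>\<close> \<psi>_1 by simp
  qed
  show ?thesis
    unfolding local_emb_def using range one_iff \<psi>_out zero mult meet join imp by auto
qed

text \<open>While the powers of \<open>d\<close> stay strictly above \<open>m\<close>, each further
  factor adds \<open>L d\<close>. The step that reaches or passes \<open>m\<close> is bounded
  through \<open>neg (d [^] i)\<close>: its weight is the loss still missing, and it is at most that
  of \<open>d\<close>.\<close>

lemma weight_le_power:
  assumes L: "weight L T" and T: "\<one> \<in> T" "m \<in> T" and d: "d \<in> T" "d \<in> segment" "d \<noteq> \<one>"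
    and pow: "\<And>i. \<lbrakk>i \<le> k; m \<preceq> d [^] i\<rbrakk> \<Longrightarrow> d [^] i \<in> T \<and> neg (d [^] i) \<in> T"
    and k: "d [^] (k::nat) \<preceq> m"
  shows "L m \<le> int k * L d"
proof -
  have dt: "d [^] i \<in> top_part" for i :: nat
    using d by (simp add: top_pow segmentD)
  have Ld: "0 < L d" using L d by (simp add: weight_def)
  have "if m \<preceq> d [^] i then L (d [^] i) \<le> int i * L d else L m \<le> int i * L d" if "i \<le> k" for i
    using that
  proof (induction i)
    case 0
    then show ?case using weight_one[OF L T(1)] by simp
  next
    case (Suc i)
    note [simp] = segment_carrier[OF d(2)]
    have suc: "d [^] Suc i \<preceq> d [^] i" by simp
    show ?case
    proof (cases "m \<preceq> d [^] i")
      case False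
      then have "\<not> m \<preceq> d [^] Suc i"
        using suc by (meson le_trans m_top nat_pow_closed top_carrier \<open>d \<in> carrier A\<close>)
      then show ?thesis using Suc False Ld by (auto simp: algebra_simps)
    next
      case True
      have i: "L (d [^] i) \<le> int i * L d" using Suc True by simp
      have di: "d [^] i \<in> T" "neg (d [^] i) \<in> T" using pow[of i] True Suc.prems by simp_all
      have dis: "d [^] i \<in> segment" using True dt by (simp add: segment_def)
      show ?thesis
      proof (cases "d [^] Suc i \<preceq> m")
        case le: True
        have "d \<preceq> neg (d [^] i)" using le by (simp add: mult_le_m_iff)
        then have "L (neg (d [^] i)) \<le> L d" using weight_antimono[OF L di(2) d(1)] by simp
        then have "L m \<le> int (Suc i) * L d"
          using weight_imp[OF L di(1) T(2) True] i by (simp add: algebra_simps)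
        moreover have "d [^] Suc i = m" if "m \<preceq> d [^] Suc i"
          using that le by (intro le_antisym) simp_all
        ultimately show ?thesis by auto
      next
        case False
        have m: "m \<preceq> d [^] Suc i" using False dt[of "Suc i"] by (intro not_le_top) simp_all
        have "d [^] i \<otimes> (d [^] i \<leadsto> d [^] Suc i) = d [^] i \<otimes> d"
          using meet_eq_mult[OF suc] by simp
        moreover have "d [^] i \<leadsto> d [^] Suc i \<in> segment"
          using m dt[of "Suc i"] by (intro imp_segment) (simp_all add: segment_def)
        ultimately have "d [^] i \<leadsto> d [^] Suc i = d"
          using False d(2) dis by - (rule cancel_above_m[of "d [^] i"], simp_all)
        moreover have "d [^] Suc i \<in> T" using pow[OF Suc.prems m] by simp
        ultimately have "L (d [^] Suc i) = L d + L (d [^] i)"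
          using weight_imp[OF L di(1) _ suc] by simp
        then show ?thesis using i m by (simp add: algebra_simps)
      qed
    qed
  qed
  from this[of k] show ?thesis
    using le_antisym[OF k] d(2) by (auto split: if_splits)
qed

text \<open>By potency \<open>d [^] k\<close> absorbs the nonunit \<open>d\<close>, so it lies below
  every element of the top part.\<close>

lemma potent_power_le:
  assumes "\<And>x. x \<in> carrier A \<Longrightarrow> x [^] (k + 1) = x [^] (k::nat)" and d: "d \<in> segment" "d \<noteq> \<one>"
  shows "d [^] k \<preceq> m"
proof -
  have "d [^] i \<in> top_part" for i :: nat
    using d by (simp add: top_pow segmentD)
  moreover have "d [^] k \<otimes> d = d [^] k" using assms(1)[of d] d by simp
  ultimately show ?thesis using top_absorb_least[of "d [^] k" d m] d by simp
qed

text \<open>Weights are available for finite sets only, so finiteness must precede a weight on the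
  whole interval. Given \<open>k + 2\<close> elements, let \<open>g\<close> be the least weight of a
  residual between two of them. Then \<open>L m \<le> k * g\<close>, and division by
  \<open>g\<close> maps the elements injectively into the \<open>k + 1\<close> numbers of
  \<open>{..k}\<close>.\<close>

lemma potent_segment_finite:
  assumes pot: "\<And>x. x \<in> carrier A \<Longrightarrow> x [^] (k + 1) = x [^] (k::nat)"
  shows "finite segment"
proof (rule ccontr)
  assume "infinite segment"
  then obtain X where X: "X \<subseteq> segment" "finite X" "card X = k + 2"
    using infinite_arbitrarily_large by blast
  define \<Delta> where "\<Delta> = {x \<leadsto> y | x y. x \<in> X \<and> y \<in> X \<and> y \<preceq> x \<and> x \<noteq> y}"
  \<comment> \<open>Which residual has least weight is known only once \<open>L\<close> is chosen,
    so the powers of all of them are put into \<open>T\<close> beforehand.\<close>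
  define Q where "Q = (\<lambda>(d, i). d [^] (i::nat)) ` (\<Delta> \<times> {..k}) \<inter> segment"
  define T where "T = X \<union> {\<one>, m} \<union> \<Delta> \<union> Q \<union> neg ` Q"
  have Xc: "x \<in> segment" if "x \<in> X" for x using that X(1) by blast
  have "\<Delta> \<subseteq> (\<lambda>(x, y). x \<leadsto> y) ` (X \<times> X)" by (auto simp: \<Delta>_def)
  then have fin\<Delta>: "finite \<Delta>" using X(2) finite_subset by fast
  then have "finite T" using X(2) by (simp add: T_def Q_def)
  have \<Delta>s: "d \<in> segment" "d \<noteq> \<one>" if "d \<in> \<Delta>" for d
    using that Xc by (auto simp: \<Delta>_def imp_eq_one le_antisym)
  have "T \<subseteq> segment" using Xc \<Delta>s by (auto simp: T_def Q_def)
  then obtain L where L: "weight L T" using weight_exists[OF \<open>finite T\<close>] by blast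
  have "\<not> X \<subseteq> {x}" for x using X(3) card_mono[of "{x}" X] by auto
  then obtain x y where "x \<in> X" "y \<in> X" "x \<noteq> y" by blast
  then have "\<Delta> \<noteq> {}" using top_chain[of x y] Xc segmentD unfolding \<Delta>_def by blast
  define g where "g = Min (L ` \<Delta>)"
  have "g \<in> L ` \<Delta>" unfolding g_def using \<open>\<Delta> \<noteq> {}\<close> fin\<Delta> by (intro Min_in) simp_all
  then obtain d where d: "d \<in> \<Delta>" "L d = g" by blast
  have g_le: "g \<le> L e" if "e \<in> \<Delta>" for e using that fin\<Delta> by (simp add: g_def)
  have XT: "x \<in> T" if "x \<in> X" for x using that by (simp add: T_def)
  have \<Delta>T: "x \<in> T" if "x \<in> \<Delta>" for x using that by (simp add: T_def)
  have oneT: "\<one> \<in> T" and mT: "m \<in> T" by (simp_all add: T_def)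
  have g_pos: "0 < g" using L \<Delta>T[OF d(1)] \<Delta>s[OF d(1)] d(2) by (auto simp: weight_def)
  have Lm: "L m \<le> int k * g"
  proof -
    have "d [^] i \<in> Q" if "i \<le> k" "m \<preceq> d [^] i" for i
    proof -
      have "d [^] i \<in> segment"
      proof -
        have "d [^] i \<in> top_part"
          using \<Delta>s[OF d(1)] by (simp add: top_pow segmentD)
        then show ?thesis using that by (simp add: segment_def)
      qed
      then show ?thesis using that d(1) by (auto simp: Q_def)
    qed
    then show ?thesis
      using weight_le_power[OF L oneT mT \<Delta>T[OF d(1)] \<Delta>s[OF d(1)], of k] potent_power_le[OF pot \<Delta>s[OF d(1)]] d(2)
      by (auto simp: T_def)
  qed
  have gap: "L x + g \<le> L y" if "x \<in> X" "y \<in> X" "y \<preceq> x" "x \<noteq> y" for x y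
  proof -
    have "x \<leadsto> y \<in> \<Delta>" using that by (auto simp: \<Delta>_def)
    then show ?thesis using weight_imp[OF L XT XT that(3)] that(1,2) g_le[of "x \<leadsto> y"] by simp
  qed
  have "inj_on (\<lambda>x. nat (L x div g)) X"
  proof (rule inj_onI, rule ccontr)
    have *: "L x div g < L y div g" if "x \<in> X" "y \<in> X" "y \<preceq> x" "x \<noteq> y" for x y
    proof -
      have "(L x + g) div g \<le> L y div g" using gap[OF that] g_pos by (rule zdiv_mono1)
      then show ?thesis using g_pos by simp
    qed
    fix x y assume xy: "x \<in> X" "y \<in> X" "nat (L x div g) = nat (L y div g)" "x \<noteq> y"
    have nonneg: "0 \<le> L x div g" if "x \<in> X" for x
    proof -
      have "0 \<le> L x" using L XT[OF that] weight_one[OF L oneT] by (cases "x = \<one>") (auto simp: weight_def)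
      then show ?thesis using g_pos by (simp add: pos_imp_zdiv_nonneg_iff)
    qed
    then have "L x div g = L y div g" using xy by (simp add: nat_eq_iff2)
    moreover have "x \<preceq> y \<or> y \<preceq> x" using top_chain xy Xc segmentD by blast
    ultimately show False using *[of x y] *[of y x] xy by auto
  qed
  moreover have "(\<lambda>x. nat (L x div g)) ` X \<subseteq> {..k}"
  proof (rule image_subsetI)
    fix x assume x: "x \<in> X"
    have "L x \<le> L m" using weight_antimono[OF L XT[OF x] mT] segmentD[OF Xc[OF x]] by simp
    then have "L x \<le> int k * g" using Lm by simp
    then have "L x div g \<le> (int k * g) div g" using g_pos by (intro zdiv_mono1)
    then show "nat (L x div g) \<in> {..k}" using g_pos by simp
  qed
  ultimately have "card X \<le> card {..k}" by (rule card_inj_on_le) simp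
  then show False using X(3) by simp
qed

text \<open>The smallest weight \<open>g\<close> of a nonunit divides all weights: replacing
  \<open>x\<close> by \<open>d \<leadsto> x\<close>, with \<open>d\<close> of weight
  \<open>g\<close>, lowers the weight by \<open>g\<close>. After division by \<open>g\<close> the
  estimate of \<open>weight_le_power\<close> bounds the length of the target chain by
  \<open>k\<close>.\<close>

lemma potent_weight:
  assumes pot: "\<And>x. x \<in> carrier A \<Longrightarrow> x [^] (k + 1) = x [^] (k::nat)"
  shows "\<exists>L. weight L segment \<and> L m \<le> int k"
proof -
  have fin: "finite segment" by (rule potent_segment_finite[OF pot])
  then obtain L where L: "weight L segment" using weight_exists[OF fin] by blast
  define g where "g = Min (L ` (segment - {\<one>}))"
  have "g \<in> L ` (segment - {\<one>})"
  proof -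
    have "m \<in> segment - {\<one>}" using m_neq_one by simp
    then show ?thesis unfolding g_def using fin by (intro Min_in) blast+
  qed
  then obtain d where d: "d \<in> segment" "d \<noteq> \<one>" "L d = g" by blast
  have g_le: "g \<le> L x" if "x \<in> segment" "x \<noteq> \<one>" for x using that fin by (simp add: g_def)
  have g_pos: "0 < g" using L d by (auto simp: weight_def)
  have nonneg: "0 \<le> L x" if "x \<in> segment" for x
    using L that weight_one[OF L one_segment] by (cases "x = \<one>") (auto simp: weight_def)
  have dvd: "g dvd L x" if "x \<in> segment" for x
    using that
  proof (induction "nat (L x)" arbitrary: x rule: less_induct)
    case less
    show ?case
    proof (cases "x = \<one>")
      case True
      then show ?thesis using weight_one[OF L one_segment] by simp
    next
      case False
      have xd: "x \<preceq> d"
      proof (rule ccontr)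
        assume nle: "\<not> x \<preceq> d"
        then have "d \<preceq> x" using not_le_top less.prems d(1) segmentD by blast
        moreover have "x \<noteq> d" using nle d(1) by auto
        ultimately have "L x < L d" using L less.prems d(1) unfolding weight_def by (smt (verit))
        then show False using g_le[OF less.prems False] d(3) by simp
      qed
      have "L (d \<leadsto> x) = L x - g" using weight_imp[OF L d(1) less.prems xd] d(3) by simp
      moreover have "g dvd L (d \<leadsto> x)"
        using less.hyps[of "d \<leadsto> x"] calculation g_pos g_le[OF less.prems False] less.prems d(1) by simp
      ultimately show ?thesis by (metis diff_add_cancel dvd_add_right_iff dvd_refl add.commute)
    qed
  qed
  have div_pos: "0 < L x div g" if "x \<in> segment" "x \<noteq> \<one>" for x
    using g_le[OF that] g_pos by (simp add: pos_imp_zdiv_pos_iff)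
  have "weight (\<lambda>x. L x div g) segment"
    unfolding weight_def
  proof (intro conjI ballI impI)
    fix x y assume xy: "x \<in> segment" "y \<in> segment" "y \<preceq> x"
    have "L (x \<leadsto> y) div g + L x div g = (L (x \<leadsto> y) + L x) div g"
      using dvd xy by (intro div_plus_div_distrib_dvd_left[symmetric]) simp
    then show "L (x \<leadsto> y) div g + L x div g = L y div g"
      using weight_imp[OF L xy] by simp
    assume "x \<noteq> y"
    then have "x \<leadsto> y \<noteq> \<one>" using xy by (auto simp: imp_eq_one le_antisym)
    then show "0 < L (x \<leadsto> y) div g" using xy div_pos by simp
  qed (use div_pos in simp)
  moreover have "L m \<le> int k * g"
  proof -
    have "d [^] i \<in> segment" if "m \<preceq> d [^] i" for i :: nat
      using that d(1) by (simp add: segment_def top_pow)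
    then show ?thesis
      using weight_le_power[OF L one_segment m_segment d(1,1,2), of k] potent_power_le[OF pot d(1,2)] d(1,3)
      by simp
  qed
  then have "L m div g \<le> (int k * g) div g" using g_pos by (intro zdiv_mono1)
  then have "L m div g \<le> int k" using g_pos by simp
  ultimately show ?thesis by blast
qed

end

context si_gbl
begin

lemma finite_top_least:
  assumes "finite X" "X \<noteq> {}" "X \<subseteq> top_part"
  shows "\<exists>m\<in>X. \<forall>x\<in>X. m \<preceq> x"
  using assms
proof (induction X rule: finite_ne_induct)
  case (insert x X)
  then obtain m where m: "m \<in> X" "\<And>y. y \<in> X \<Longrightarrow> m \<preceq> y" by auto
  show ?case
  proof (cases "x \<preceq> m")
    case True
    have "x \<preceq> y" if "y \<in> X" for y
      by (rule le_trans[OF True m(2)[OF that]]) (use insert.prems m(1) that in auto)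
    then show ?thesis using insert.prems by (intro bexI[of _ x]) auto
  next
    case False
    then have "m \<preceq> x" using top_chain[of m x] insert.prems m(1) by auto
    then show ?thesis using m by (intro bexI[of _ m]) auto
  qed
qed simp

lemma floor_exists:
  assumes "finite S" "S \<subseteq> carrier A"
  shows "\<exists>m. si_gbl_floor A u m \<and> (\<forall>x\<in>S. x \<in> top_part \<longrightarrow> m \<preceq> x)"
proof -
  \<comment> \<open>Adding \<open>u\<close> makes the set nonempty and forces
    \<open>m \<preceq> u\<close>, hence \<open>m \<noteq> \<one>\<close>.\<close>
  obtain m where m: "m \<in> insert u (S \<inter> top_part)" "\<And>x. x \<in> insert u (S \<inter> top_part) \<Longrightarrow> m \<preceq> x"
  proof -
    have "\<exists>m\<in>insert u (S \<inter> top_part). \<forall>x\<in>insert u (S \<inter> top_part). m \<preceq> x"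
      by (rule finite_top_least) (use assms(1) in auto)
    then show ?thesis using that by blast
  qed
  have mt: "m \<in> top_part" using m(1) by auto
  have "m \<noteq> \<one>" using m(2)[of u] u_neq_one by auto
  then have "si_gbl_floor A u m" using mt by unfold_locales
  then show ?thesis using m(2) by blast
qed

lemma local_emb_exists:
  assumes "finite S" "S \<subseteq> carrier A"
  shows "\<exists>N \<psi>. N \<ge> 1 \<and> local_emb A S {\<one>} top_part N \<psi>"
proof -
  obtain m where m: "si_gbl_floor A u m" "\<And>x. x \<in> S \<Longrightarrow> x \<in> top_part \<Longrightarrow> m \<preceq> x"
    using floor_exists[OF assms] by blast
  interpret si_gbl_floor A u m by (rule m(1))
  define T where "T = {\<one>, m} \<union> (S \<inter> top_part) \<union>
    {x \<leadsto> x \<otimes> y | x y. x \<in> S \<inter> top_part \<and> y \<in> S \<inter> top_part \<and> x \<otimes> y \<in> S}"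
  have "{x \<leadsto> x \<otimes> y | x y. x \<in> S \<inter> top_part \<and> y \<in> S \<inter> top_part \<and> x \<otimes> y \<in> S}
      \<subseteq> (\<lambda>(x, y). x \<leadsto> x \<otimes> y) ` (S \<times> S)" by auto
  then have "finite T" using assms(1) finite_subset unfolding T_def by fast
  have Ss: "x \<in> segment" if "x \<in> S" "x \<in> top_part" for x
    using that m(2) by (simp add: segment_def)
  have "T \<subseteq> segment" using Ss by (auto simp: T_def top_mult)
  then obtain L where L: "weight L T" using weight_exists[OF \<open>finite T\<close>] by blast
  have "0 < L m" using L m_neq_one by (auto simp: weight_def T_def)
  have "local_emb A S {\<one>} top_part (nat (L m))
      (\<lambda>x. if x \<in> top_part then 1 - real_of_int (L x) / real_of_int (L m) else 0)"
    by (rule weight_local_emb[OF assms(2) m(2) L]) (use \<open>T \<subseteq> segment\<close> in \<open>auto simp: T_def\<close>)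
  then show ?thesis using \<open>0 < L m\<close> by (intro exI[of _ "nat (L m)"] exI conjI) auto
qed

lemma local_emb_potent_exists:
  assumes "finite S" "S \<subseteq> carrier A"
    and pot: "\<And>x. x \<in> carrier A \<Longrightarrow> x [^] (k + 1) = x [^] (k::nat)"
  shows "\<exists>N \<psi>. N \<ge> 1 \<and> N \<le> k \<and> local_emb A S {\<one>} top_part N \<psi>"
proof -
  obtain m where m: "si_gbl_floor A u m" "\<And>x. x \<in> S \<Longrightarrow> x \<in> top_part \<Longrightarrow> m \<preceq> x"
    using floor_exists[OF assms(1,2)] by blast
  interpret si_gbl_floor A u m by (rule m(1))
  obtain L where L: "weight L segment" "L m \<le> int k" using potent_weight[OF pot] by blast
  have "0 < L m" using L m_neq_one by (auto simp: weight_def)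
  have Ss: "x \<in> segment" if "x \<in> S" "x \<in> top_part" for x
    using that m(2) by (simp add: segment_def)
  have "local_emb A S {\<one>} top_part (nat (L m))
      (\<lambda>x. if x \<in> top_part then 1 - real_of_int (L x) / real_of_int (L m) else 0)"
    by (rule weight_local_emb[OF assms(2) m(2) L(1)]) (use Ss in \<open>auto simp: top_mult\<close>)
  then show ?thesis using \<open>0 < L m\<close> L(2) by (intro exI[of _ "nat (L m)"] exI conjI) auto
qed

end

section \<open>Equational classes and images of subalgebras\<close>

definition ops_closed :: "'a rlat \<Rightarrow> 'a set \<Rightarrow> bool" where
  "ops_closed A D \<longleftrightarrow> \<zero>\<^bsub>A\<^esub> \<in> D \<and> \<one>\<^bsub>A\<^esub> \<in> D \<and> (\<forall>x\<in>D. \<forall>y\<in>D.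
    x \<curlywedge>\<^bsub>A\<^esub> y \<in> D \<and> x \<curlyvee>\<^bsub>A\<^esub> y \<in> D \<and> x \<otimes>\<^bsub>A\<^esub> y \<in> D \<and> x \<leadsto>\<^bsub>A\<^esub> y \<in> D)"

definition satisfies :: "'a rlat \<Rightarrow> trm \<times> trm \<Rightarrow> bool" where
  "satisfies A e \<longleftrightarrow> (\<forall>h. (\<forall>v. h v \<in> carrier A) \<longrightarrow> eval A h (fst e) = eval A h (snd e))"

definition models :: "(trm \<times> trm) set \<Rightarrow> 'a rlat set" where
  "models E = {A. ops_closed A (carrier A) \<and> (\<forall>e\<in>E. satisfies A e)}"

lemma eval_closed: "\<lbrakk>ops_closed A D; \<And>v. h v \<in> D\<rbrakk> \<Longrightarrow> eval A h t \<in> D"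
  by (induction t) (simp_all add: ops_closed_def)

text \<open>One construction for two uses: isomorphic copies in another type, with \<open>g\<close>
  injective, and quotients, with \<open>g\<close> the class map. The operations are computed on
  arbitrary representatives, which \<open>compatible\<close> makes harmless.\<close>

definition image_alg :: "('a \<Rightarrow> 'c) \<Rightarrow> 'a set \<Rightarrow> 'a rlat \<Rightarrow> 'c rlat" where
  "image_alg g D A =
    \<lparr>carrier = g ` D, mult = (\<lambda>x y. g (inv_into D g x \<otimes>\<^bsub>A\<^esub> inv_into D g y)), one = g \<one>\<^bsub>A\<^esub>,
     rmeet = (\<lambda>x y. g (inv_into D g x \<curlywedge>\<^bsub>A\<^esub> inv_into D g y)),
     rjoin = (\<lambda>x y. g (inv_into D g x \<curlyvee>\<^bsub>A\<^esub> inv_into D g y)),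
     rimp = (\<lambda>x y. g (inv_into D g x \<leadsto>\<^bsub>A\<^esub> inv_into D g y)), rzero = g \<zero>\<^bsub>A\<^esub>\<rparr>"

definition compatible :: "('a \<Rightarrow> 'c) \<Rightarrow> 'a set \<Rightarrow> 'a rlat \<Rightarrow> bool" where
  "compatible g D A \<longleftrightarrow> (\<forall>x\<in>D. \<forall>x'\<in>D. \<forall>y\<in>D. \<forall>y'\<in>D. g x = g x' \<and> g y = g y' \<longrightarrow>
    g (x \<curlywedge>\<^bsub>A\<^esub> y) = g (x' \<curlywedge>\<^bsub>A\<^esub> y') \<and> g (x \<curlyvee>\<^bsub>A\<^esub> y) = g (x' \<curlyvee>\<^bsub>A\<^esub> y') \<and>
    g (x \<otimes>\<^bsub>A\<^esub> y) = g (x' \<otimes>\<^bsub>A\<^esub> y') \<and> g (x \<leadsto>\<^bsub>A\<^esub> y) = g (x' \<leadsto>\<^bsub>A\<^esub> y'))"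

lemma compatible_inj: "inj_on g D \<Longrightarrow> compatible g D A"
  unfolding compatible_def by (metis inj_onD)

lemma image_alg_simps [simp]:
  "carrier (image_alg g D A) = g ` D" "one (image_alg g D A) = g \<one>\<^bsub>A\<^esub>" "rzero (image_alg g D A) = g \<zero>\<^bsub>A\<^esub>"
  by (simp_all add: image_alg_def)

lemma image_alg_ops:
  assumes "compatible g D A" "x \<in> D" "y \<in> D"
  shows "g x \<curlywedge>\<^bsub>image_alg g D A\<^esub> g y = g (x \<curlywedge>\<^bsub>A\<^esub> y)" "g x \<curlyvee>\<^bsub>image_alg g D A\<^esub> g y = g (x \<curlyvee>\<^bsub>A\<^esub> y)"
    "g x \<otimes>\<^bsub>image_alg g D A\<^esub> g y = g (x \<otimes>\<^bsub>A\<^esub> y)" "g x \<leadsto>\<^bsub>image_alg g D A\<^esub> g y = g (x \<leadsto>\<^bsub>A\<^esub> y)"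
proof -
  define x' where "x' = inv_into D g (g x)"
  define y' where "y' = inv_into D g (g y)"
  have "x' \<in> D" "g x' = g x" "y' \<in> D" "g y' = g y"
    using assms(2,3) by (simp_all add: x'_def y'_def f_inv_into_f inv_into_into)
  then have "g (x' \<curlywedge>\<^bsub>A\<^esub> y') = g (x \<curlywedge>\<^bsub>A\<^esub> y) \<and> g (x' \<curlyvee>\<^bsub>A\<^esub> y') = g (x \<curlyvee>\<^bsub>A\<^esub> y) \<and>
      g (x' \<otimes>\<^bsub>A\<^esub> y') = g (x \<otimes>\<^bsub>A\<^esub> y) \<and> g (x' \<leadsto>\<^bsub>A\<^esub> y') = g (x \<leadsto>\<^bsub>A\<^esub> y)"
    using assms unfolding compatible_def by blast
  then show "g x \<curlywedge>\<^bsub>image_alg g D A\<^esub> g y = g (x \<curlywedge>\<^bsub>A\<^esub> y)" "g x \<curlyvee>\<^bsub>image_alg g D A\<^esub> g y = g (x \<curlyvee>\<^bsub>A\<^esub> y)"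
    "g x \<otimes>\<^bsub>image_alg g D A\<^esub> g y = g (x \<otimes>\<^bsub>A\<^esub> y)" "g x \<leadsto>\<^bsub>image_alg g D A\<^esub> g y = g (x \<leadsto>\<^bsub>A\<^esub> y)"
    by (simp_all add: image_alg_def x'_def y'_def)
qed

lemma image_alg_ops_closed:
  assumes "compatible g D A" "ops_closed A D"
  shows "ops_closed (image_alg g D A) (carrier (image_alg g D A))"
  using assms by (auto simp: ops_closed_def image_alg_ops)

lemma eval_image_alg:
  assumes "compatible g D A" "ops_closed A D" "\<And>v. h v \<in> D"
  shows "eval (image_alg g D A) (\<lambda>v. g (h v)) t = g (eval A h t)"
  using eval_closed[OF assms(2,3)] by (induction t) (simp_all add: image_alg_ops[OF assms(1)])

lemma image_alg_models:
  assumes "A \<in> models E" "D \<subseteq> carrier A" "ops_closed A D" "compatible g D A"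
  shows "image_alg g D A \<in> models E"
  unfolding models_def satisfies_def
proof (intro CollectI conjI ballI allI impI)
  fix e and h :: "nat \<Rightarrow> _" assume e: "e \<in> E" and h: "\<forall>v. h v \<in> carrier (image_alg g D A)"
  define h' where "h' v = inv_into D g (h v)" for v
  have h': "h' v \<in> D" "g (h' v) = h v" for v
    using h by (simp_all add: h'_def inv_into_into f_inv_into_f)
  have "eval A h' (fst e) = eval A h' (snd e)"
    using assms(1) e subsetD[OF assms(2) h'(1)] by (simp add: models_def satisfies_def)
  then show "eval (image_alg g D A) h (fst e) = eval (image_alg g D A) h (snd e)"
    using eval_image_alg[OF assms(4,3) h'(1)] by (simp add: h'(2))
qed (use assms image_alg_ops_closed in blast)

section \<open>Equations defining the varieties\<close>

abbreviation (input) "tx \<equiv> Var 0"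
abbreviation (input) "ty \<equiv> Var 1"
abbreviation (input) "tz \<equiv> Var 2"

text \<open>Residuation is not an equation. It is replaced by distributivity of the product over
  joins, which yields monotonicity, and by the inequalities
  \<open>x \<otimes> (x \<leadsto> y) \<preceq> y\<close> and
  \<open>x \<preceq> y \<leadsto> (x \<otimes> y) \<curlyvee> z\<close>, written with meets. The
  join with \<open>z\<close> in the latter builds in the monotonicity of implication that
  residuation needs.\<close>

definition gbl_eqs :: "(trm \<times> trm) set" where
  "gbl_eqs = {(Meet tx ty, Meet ty tx), (Join tx ty, Join ty tx),
    (Meet (Meet tx ty) tz, Meet tx (Meet ty tz)), (Join (Join tx ty) tz, Join tx (Join ty tz)),
    (Meet tx (Join tx ty), tx), (Join tx (Meet tx ty), tx), (Meet Zero tx, Zero), (Meet tx One, tx),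
    (Mult (Mult tx ty) tz, Mult tx (Mult ty tz)), (Mult tx ty, Mult ty tx), (Mult One tx, tx),
    (Mult (Join tx ty) tz, Join (Mult tx tz) (Mult ty tz)),
    (Meet (Mult tx (Imp tx ty)) ty, Mult tx (Imp tx ty)),
    (Meet tx (Imp ty (Join (Mult tx ty) tz)), tx), (Mult tx (Imp tx ty), Meet tx ty)}"

definition prelinearity_eq :: "trm \<times> trm" where
  "prelinearity_eq = (Join (Imp tx ty) (Imp ty tx), One)"

definition involution_eq :: "trm \<times> trm" where
  "involution_eq = (tx, Imp (Imp tx Zero) Zero)"

primrec tpow :: "nat \<Rightarrow> trm" where
  "tpow 0 = One"
| "tpow (Suc n) = Mult (tpow n) tx"

definition potency_eq :: "nat \<Rightarrow> trm \<times> trm" where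
  "potency_eq k = (tpow (k + 1), tpow k)"

lemma satisfies_instance:
  assumes "satisfies A (s, t)" "a \<in> carrier A" "b \<in> carrier A" "c \<in> carrier A"
  shows "eval A (\<lambda>n. if n = 0 then a else if n = 1 then b else c) s
    = eval A (\<lambda>n. if n = 0 then a else if n = 1 then b else c) t"
  using assms by (simp add: satisfies_def)

lemma ops_closed_carrier: "residuated_lattice A \<Longrightarrow> ops_closed A (carrier A)"
  by (simp add: ops_closed_def residuated_lattice.rl_closed residuated_lattice_def comm_monoid_def monoid.m_closed monoid.one_closed)

lemma GBL_eq: "GBL = models gbl_eqs"
proof (intro equalityI subsetI)
  fix A :: "'a rlat" (structure) assume "A \<in> GBL"
  then interpret gbl_algebra A by (simp add: GBL_def)
  have "x \<preceq> y \<leadsto> ((x \<otimes> y) \<curlyvee> z)" if "x \<in> carrier A" "y \<in> carrier A" "z \<in> carrier A" for x y z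
    using that by (simp flip: residuation)
  then have "x \<curlywedge> (y \<leadsto> ((x \<otimes> y) \<curlyvee> z)) = x" if "x \<in> carrier A" "y \<in> carrier A" "z \<in> carrier A" for x y z
    using that by (simp add: rle_def)
  moreover have "x \<otimes> (x \<leadsto> y) \<curlywedge> y = x \<otimes> (x \<leadsto> y)" if "x \<in> carrier A" "y \<in> carrier A" for x y
    using mult_imp_le[OF that] by (simp add: rle_def)
  moreover have "\<zero> \<curlywedge> x = \<zero>" "x \<curlywedge> \<one> = x" if "x \<in> carrier A" for x
    using zero_least[OF that] one_greatest[OF that] by (simp_all add: rle_def)
  ultimately show "A \<in> models gbl_eqs"
    using ops_closed_carrier[OF residuated_lattice_axioms]
    by (simp add: models_def gbl_eqs_def satisfies_def meet_assoc join_assoc meet_join_absorb join_meet_absorb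
        m_assoc mult_join divisibility) (simp add: meet_comm join_comm m_comm)
next
  fix A :: "'a rlat" assume A: "A \<in> models gbl_eqs"
  then have sat: "satisfies A e" if "e \<in> gbl_eqs" for e using that by (simp add: models_def)
  have cl: "ops_closed A (carrier A)" using A by (simp add: models_def)
  note inst = satisfies_instance[OF sat]
  have closed: "\<zero>\<^bsub>A\<^esub> \<in> carrier A" "\<one>\<^bsub>A\<^esub> \<in> carrier A"
    "\<And>x y. \<lbrakk>x \<in> carrier A; y \<in> carrier A\<rbrakk> \<Longrightarrow> x \<curlywedge>\<^bsub>A\<^esub> y \<in> carrier A"
    "\<And>x y. \<lbrakk>x \<in> carrier A; y \<in> carrier A\<rbrakk> \<Longrightarrow> x \<curlyvee>\<^bsub>A\<^esub> y \<in> carrier A"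
    "\<And>x y. \<lbrakk>x \<in> carrier A; y \<in> carrier A\<rbrakk> \<Longrightarrow> x \<otimes>\<^bsub>A\<^esub> y \<in> carrier A"
    "\<And>x y. \<lbrakk>x \<in> carrier A; y \<in> carrier A\<rbrakk> \<Longrightarrow> x \<leadsto>\<^bsub>A\<^esub> y \<in> carrier A"
    using cl by (simp_all add: ops_closed_def)
  have eqs: "x \<curlywedge>\<^bsub>A\<^esub> y = y \<curlywedge>\<^bsub>A\<^esub> x" "x \<curlyvee>\<^bsub>A\<^esub> y = y \<curlyvee>\<^bsub>A\<^esub> x"
    "(x \<curlywedge>\<^bsub>A\<^esub> y) \<curlywedge>\<^bsub>A\<^esub> z = x \<curlywedge>\<^bsub>A\<^esub> (y \<curlywedge>\<^bsub>A\<^esub> z)" "(x \<curlyvee>\<^bsub>A\<^esub> y) \<curlyvee>\<^bsub>A\<^esub> z = x \<curlyvee>\<^bsub>A\<^esub> (y \<curlyvee>\<^bsub>A\<^esub> z)"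
    "x \<curlywedge>\<^bsub>A\<^esub> (x \<curlyvee>\<^bsub>A\<^esub> y) = x" "x \<curlyvee>\<^bsub>A\<^esub> (x \<curlywedge>\<^bsub>A\<^esub> y) = x" "\<zero>\<^bsub>A\<^esub> \<curlywedge>\<^bsub>A\<^esub> x = \<zero>\<^bsub>A\<^esub>" "x \<curlywedge>\<^bsub>A\<^esub> \<one>\<^bsub>A\<^esub> = x"
    "(x \<otimes>\<^bsub>A\<^esub> y) \<otimes>\<^bsub>A\<^esub> z = x \<otimes>\<^bsub>A\<^esub> (y \<otimes>\<^bsub>A\<^esub> z)" "x \<otimes>\<^bsub>A\<^esub> y = y \<otimes>\<^bsub>A\<^esub> x" "\<one>\<^bsub>A\<^esub> \<otimes>\<^bsub>A\<^esub> x = x"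
    "(x \<curlyvee>\<^bsub>A\<^esub> y) \<otimes>\<^bsub>A\<^esub> z = (x \<otimes>\<^bsub>A\<^esub> z) \<curlyvee>\<^bsub>A\<^esub> (y \<otimes>\<^bsub>A\<^esub> z)"
    "(x \<otimes>\<^bsub>A\<^esub> (x \<leadsto>\<^bsub>A\<^esub> y)) \<curlywedge>\<^bsub>A\<^esub> y = x \<otimes>\<^bsub>A\<^esub> (x \<leadsto>\<^bsub>A\<^esub> y)"
    "x \<curlywedge>\<^bsub>A\<^esub> (y \<leadsto>\<^bsub>A\<^esub> ((x \<otimes>\<^bsub>A\<^esub> y) \<curlyvee>\<^bsub>A\<^esub> z)) = x" "x \<otimes>\<^bsub>A\<^esub> (x \<leadsto>\<^bsub>A\<^esub> y) = x \<curlywedge>\<^bsub>A\<^esub> y"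
    if "x \<in> carrier A" "y \<in> carrier A" "z \<in> carrier A" for x y z
    using inst[of "Meet tx ty" "Meet ty tx" x y z]
      inst[of "Join tx ty" "Join ty tx" x y z]
      inst[of "Meet (Meet tx ty) tz" "Meet tx (Meet ty tz)" x y z]
      inst[of "Join (Join tx ty) tz" "Join tx (Join ty tz)" x y z]
      inst[of "Meet tx (Join tx ty)" tx x y z] inst[of "Join tx (Meet tx ty)" tx x y z]
      inst[of "Meet Zero tx" Zero x y z] inst[of "Meet tx One" tx x y z]
      inst[of "Mult (Mult tx ty) tz" "Mult tx (Mult ty tz)" x y z]
      inst[of "Mult tx ty" "Mult ty tx" x y z] inst[of "Mult One tx" tx x y z]
      inst[of "Mult (Join tx ty) tz" "Join (Mult tx tz) (Mult ty tz)" x y z]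
      inst[of "Meet (Mult tx (Imp tx ty)) ty" "Mult tx (Imp tx ty)" x y z]
      inst[of "Meet tx (Imp ty (Join (Mult tx ty) tz))" tx x y z]
      inst[of "Mult tx (Imp tx ty)" "Meet tx ty" x y z] that
    by (simp_all add: gbl_eqs_def)
  have cm: "comm_monoid A"
    by (rule comm_monoidI) (use closed eqs in auto)
  have join_le: "x \<preceq>\<^bsub>A\<^esub> y \<longleftrightarrow> x \<curlyvee>\<^bsub>A\<^esub> y = y" if "x \<in> carrier A" "y \<in> carrier A" for x y
    unfolding rle_def using eqs(1,2,5,6)[of x y x] eqs(1,2,5,6)[of y x x] that by metis
  have res: "x \<otimes>\<^bsub>A\<^esub> y \<preceq>\<^bsub>A\<^esub> z \<longleftrightarrow> x \<preceq>\<^bsub>A\<^esub> y \<leadsto>\<^bsub>A\<^esub> z"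
    if [simp]: "x \<in> carrier A" "y \<in> carrier A" "z \<in> carrier A" for x y z
  proof
    assume "x \<otimes>\<^bsub>A\<^esub> y \<preceq>\<^bsub>A\<^esub> z"
    then have "(x \<otimes>\<^bsub>A\<^esub> y) \<curlyvee>\<^bsub>A\<^esub> z = z" using join_le closed by simp
    then show "x \<preceq>\<^bsub>A\<^esub> y \<leadsto>\<^bsub>A\<^esub> z" using eqs(14)[of x y z] by (simp add: rle_def)
  next
    assume "x \<preceq>\<^bsub>A\<^esub> y \<leadsto>\<^bsub>A\<^esub> z"
    then have "x \<curlyvee>\<^bsub>A\<^esub> (y \<leadsto>\<^bsub>A\<^esub> z) = y \<leadsto>\<^bsub>A\<^esub> z" using join_le closed by simp
    then have "(x \<otimes>\<^bsub>A\<^esub> y) \<curlyvee>\<^bsub>A\<^esub> ((y \<leadsto>\<^bsub>A\<^esub> z) \<otimes>\<^bsub>A\<^esub> y) = (y \<leadsto>\<^bsub>A\<^esub> z) \<otimes>\<^bsub>A\<^esub> y"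
      using eqs(12)[of x "y \<leadsto>\<^bsub>A\<^esub> z" y] closed by simp
    then have "x \<otimes>\<^bsub>A\<^esub> y \<preceq>\<^bsub>A\<^esub> y \<otimes>\<^bsub>A\<^esub> (y \<leadsto>\<^bsub>A\<^esub> z)"
      using join_le eqs(10)[of "y \<leadsto>\<^bsub>A\<^esub> z" y] closed by simp
    then have 1: "(x \<otimes>\<^bsub>A\<^esub> y) \<curlywedge>\<^bsub>A\<^esub> (y \<otimes>\<^bsub>A\<^esub> (y \<leadsto>\<^bsub>A\<^esub> z)) = x \<otimes>\<^bsub>A\<^esub> y" by (simp add: rle_def)
    have 2: "(y \<otimes>\<^bsub>A\<^esub> (y \<leadsto>\<^bsub>A\<^esub> z)) \<curlywedge>\<^bsub>A\<^esub> z = y \<otimes>\<^bsub>A\<^esub> (y \<leadsto>\<^bsub>A\<^esub> z)" using eqs(13)[of y z z] by simp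
    have "(x \<otimes>\<^bsub>A\<^esub> y) \<curlywedge>\<^bsub>A\<^esub> z = ((x \<otimes>\<^bsub>A\<^esub> y) \<curlywedge>\<^bsub>A\<^esub> (y \<otimes>\<^bsub>A\<^esub> (y \<leadsto>\<^bsub>A\<^esub> z))) \<curlywedge>\<^bsub>A\<^esub> z" by (simp only: 1)
    also have "\<dots> = (x \<otimes>\<^bsub>A\<^esub> y) \<curlywedge>\<^bsub>A\<^esub> ((y \<otimes>\<^bsub>A\<^esub> (y \<leadsto>\<^bsub>A\<^esub> z)) \<curlywedge>\<^bsub>A\<^esub> z)"
      using closed by (intro eqs(3)) simp_all
    also have "\<dots> = x \<otimes>\<^bsub>A\<^esub> y" by (simp only: 1 2)
    finally show "x \<otimes>\<^bsub>A\<^esub> y \<preceq>\<^bsub>A\<^esub> z" by (simp add: rle_def)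
  qed
  interpret comm_monoid A by (rule cm)
  have "residuated_lattice A"
    by unfold_locales
      (use closed eqs(3,4,5,6) res in \<open>simp_all add: rle_def eqs(7,8)\<close>, (metis eqs(1) eqs(2))+)
  then interpret residuated_lattice A .
  have "gbl_algebra A" by unfold_locales (rule eqs(15), assumption+)
  then show "A \<in> GBL" by (simp add: GBL_def)
qed

lemma models_insert: "models (insert e E) = {A \<in> models E. satisfies A e}"
  by (auto simp: models_def)

lemma satisfies_unary:
  assumes "\<And>h. eval A h (fst e) = l (h 0)" "\<And>h. eval A h (snd e) = r (h 0)"
  shows "satisfies A e \<longleftrightarrow> (\<forall>x\<in>carrier A. l x = r x)"
proof
  assume *: "satisfies A e"
  show "\<forall>x\<in>carrier A. l x = r x"
  proof
    fix x assume "x \<in> carrier A"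
    then show "l x = r x" using * assms[of "\<lambda>_. x"] by (simp add: satisfies_def)
  qed
qed (use assms in \<open>simp add: satisfies_def\<close>)

lemma satisfies_prelinearity:
  "satisfies A prelinearity_eq \<longleftrightarrow>
    (\<forall>x\<in>carrier A. \<forall>y\<in>carrier A. (x \<leadsto>\<^bsub>A\<^esub> y) \<curlyvee>\<^bsub>A\<^esub> (y \<leadsto>\<^bsub>A\<^esub> x) = \<one>\<^bsub>A\<^esub>)"
  using satisfies_instance[of A "fst prelinearity_eq" "snd prelinearity_eq"]
  by (auto simp: prelinearity_eq_def satisfies_def)

lemma satisfies_involution:
  "satisfies A involution_eq \<longleftrightarrow> (\<forall>x\<in>carrier A. x = (x \<leadsto>\<^bsub>A\<^esub> \<zero>\<^bsub>A\<^esub>) \<leadsto>\<^bsub>A\<^esub> \<zero>\<^bsub>A\<^esub>)"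
  by (rule satisfies_unary) (simp_all add: involution_eq_def)

lemma eval_tpow: "eval A h (tpow n) = h 0 [^]\<^bsub>A\<^esub> n"
  by (induction n) (simp_all add: nat_pow_def)

lemma satisfies_potency:
  "satisfies A (potency_eq k) \<longleftrightarrow> (\<forall>x\<in>carrier A. x [^]\<^bsub>A\<^esub> (k + 1) = x [^]\<^bsub>A\<^esub> k)"
  by (rule satisfies_unary) (simp_all only: potency_eq_def fst_conv snd_conv eval_tpow)

lemma BL_eq: "BL = models (insert prelinearity_eq gbl_eqs)"
  unfolding models_insert satisfies_prelinearity GBL_eq[symmetric] BL_def GBL_def
  by (auto simp: bl_algebra_def bl_algebra_axioms_def)

lemma MV_eq: "{A. mv_algebra A} = models (insert involution_eq (insert prelinearity_eq gbl_eqs))"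
  unfolding models_insert[of involution_eq] satisfies_involution BL_eq[symmetric] BL_def
  by (auto simp: mv_algebra_def mv_algebra_axioms_def)

lemma potent_models: "potent k (models E) = models (insert (potency_eq k) E)"
  unfolding models_insert satisfies_potency potent_def by simp

section \<open>Filters and quotients\<close>

locale dfilter = gbl_algebra A for A :: "'a rlat" (structure) +
  fixes F
  assumes F_carrier: "F \<subseteq> carrier A" and one_F [simp]: "\<one> \<in> F"
    and F_up: "\<lbrakk>x \<in> F; x \<preceq> y; y \<in> carrier A\<rbrakk> \<Longrightarrow> y \<in> F"
    and F_mult: "\<lbrakk>x \<in> F; y \<in> F\<rbrakk> \<Longrightarrow> x \<otimes> y \<in> F"
begin

lemma F_closed [simp]: "x \<in> F \<Longrightarrow> x \<in> carrier A"
  using F_carrier by blast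

definition cls :: "'a \<Rightarrow> 'a set" where
  "cls x = {y \<in> carrier A. x \<leadsto> y \<in> F \<and> y \<leadsto> x \<in> F}"

definition quot :: "'a set rlat" where "quot = image_alg cls (carrier A) A"

lemma F_trans:
  assumes "x \<leadsto> y \<in> F" "y \<leadsto> z \<in> F" "x \<in> carrier A" "y \<in> carrier A" "z \<in> carrier A"
  shows "x \<leadsto> z \<in> F"
  by (rule F_up[OF F_mult[OF assms(1,2)]]) (use assms(3-) in \<open>simp_all add: imp_trans\<close>)

lemma F_mp: "\<lbrakk>x \<leadsto> y \<in> F; x \<in> F; y \<in> carrier A\<rbrakk> \<Longrightarrow> y \<in> F"
  using F_up[OF F_mult[of x "x \<leadsto> y"], of y] mult_imp_le[of x y] F_closed[of x] by blast

lemma cls_eq_iff: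
  assumes "x \<in> carrier A" "y \<in> carrier A"
  shows "cls x = cls y \<longleftrightarrow> x \<leadsto> y \<in> F \<and> y \<leadsto> x \<in> F"
proof
  assume "cls x = cls y"
  moreover have "y \<in> cls y" using assms by (simp add: cls_def)
  ultimately have "y \<in> cls x" by simp
  then show "x \<leadsto> y \<in> F \<and> y \<leadsto> x \<in> F" by (simp add: cls_def)
next
  assume "x \<leadsto> y \<in> F \<and> y \<leadsto> x \<in> F"
  then show "cls x = cls y" using assms F_trans unfolding cls_def by blast
qed

lemma F_meet_cong:
  assumes "x \<leadsto> y \<in> F" "x' \<leadsto> y' \<in> F" and [simp]: "x \<in> carrier A" "y \<in> carrier A" "x' \<in> carrier A" "y' \<in> carrier A"
  shows "(x \<curlywedge> x') \<leadsto> (y \<curlywedge> y') \<in> F"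
proof (rule F_up[OF F_mult[OF assms(1,2)]])
  let ?t = "(x \<leadsto> y) \<otimes> (x' \<leadsto> y')"
  have "?t \<preceq> (x \<curlywedge> x') \<leadsto> y"
    by (rule le_trans[of _ "x \<leadsto> y"]) (simp_all add: imp_antimono)
  moreover have "?t \<preceq> (x \<curlywedge> x') \<leadsto> y'"
    by (rule le_trans[of _ "x' \<leadsto> y'"]) (simp_all add: imp_antimono)
  ultimately show "?t \<preceq> (x \<curlywedge> x') \<leadsto> (y \<curlywedge> y')" by (simp add: imp_meet meet_greatest)
qed simp

lemma F_join_cong:
  assumes "x \<leadsto> y \<in> F" "x' \<leadsto> y' \<in> F" and [simp]: "x \<in> carrier A" "y \<in> carrier A" "x' \<in> carrier A" "y' \<in> carrier A"
  shows "(x \<curlyvee> x') \<leadsto> (y \<curlyvee> y') \<in> F"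
proof (rule F_up[OF F_mult[OF assms(1,2)]])
  let ?t = "(x \<leadsto> y) \<otimes> (x' \<leadsto> y')"
  have "?t \<preceq> x \<leadsto> (y \<curlyvee> y')"
    by (rule le_trans[of _ "x \<leadsto> y"]) (simp_all add: imp_mono)
  moreover have "?t \<preceq> x' \<leadsto> (y \<curlyvee> y')"
    by (rule le_trans[of _ "x' \<leadsto> y'"]) (simp_all add: imp_mono)
  ultimately have "x \<otimes> ?t \<preceq> y \<curlyvee> y'" "x' \<otimes> ?t \<preceq> y \<curlyvee> y'"
    by (simp_all add: residuation m_comm[of _ ?t])
  then have "(x \<curlyvee> x') \<otimes> ?t \<preceq> y \<curlyvee> y'" by (simp add: mult_join join_least)
  then show "?t \<preceq> (x \<curlyvee> x') \<leadsto> (y \<curlyvee> y')" by (simp add: residuation m_comm[of _ ?t])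
qed simp

lemma F_mult_cong:
  assumes "x \<leadsto> y \<in> F" "x' \<leadsto> y' \<in> F" and [simp]: "x \<in> carrier A" "y \<in> carrier A" "x' \<in> carrier A" "y' \<in> carrier A"
  shows "(x \<otimes> x') \<leadsto> (y \<otimes> y') \<in> F"
proof (rule F_up[OF F_mult[OF assms(1,2)]])
  let ?t = "(x \<leadsto> y) \<otimes> (x' \<leadsto> y')"
  have "?t \<otimes> (x \<otimes> x') = (x \<otimes> (x \<leadsto> y)) \<otimes> (x' \<otimes> (x' \<leadsto> y'))" by (simp add: m_ac)
  also have "\<dots> \<preceq> y \<otimes> y'" by (simp add: mult_imp_le mult_mono)
  finally show "?t \<preceq> (x \<otimes> x') \<leadsto> (y \<otimes> y')" by (simp add: residuation)
qed simp

lemma F_imp_cong: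
  assumes "y \<leadsto> x \<in> F" "x' \<leadsto> y' \<in> F" and [simp]: "x \<in> carrier A" "y \<in> carrier A" "x' \<in> carrier A" "y' \<in> carrier A"
  shows "(x \<leadsto> x') \<leadsto> (y \<leadsto> y') \<in> F"
proof (rule F_up[OF F_mult[OF assms(1,2)]])
  have "((y \<leadsto> x) \<otimes> (x' \<leadsto> y')) \<otimes> (x \<leadsto> x') = ((y \<leadsto> x) \<otimes> (x \<leadsto> x')) \<otimes> (x' \<leadsto> y')" by (simp add: m_ac)
  also have "\<dots> \<preceq> (y \<leadsto> x') \<otimes> (x' \<leadsto> y')" by (simp add: mult_mono1 imp_trans)
  also have "(y \<leadsto> x') \<otimes> (x' \<leadsto> y') \<preceq> y \<leadsto> y'" by (simp add: imp_trans)
  finally (le_trans) have "((y \<leadsto> x) \<otimes> (x' \<leadsto> y')) \<otimes> (x \<leadsto> x') \<preceq> y \<leadsto> y'" by simp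
  then show "(y \<leadsto> x) \<otimes> (x' \<leadsto> y') \<preceq> (x \<leadsto> x') \<leadsto> (y \<leadsto> y')" by (simp add: residuation)
qed simp

lemma compatible_cls: "compatible cls (carrier A) A"
  unfolding compatible_def
  by (auto simp: cls_eq_iff F_meet_cong F_join_cong F_mult_cong F_imp_cong)

lemma quot_simps [simp]: "carrier quot = cls ` carrier A" "one quot = cls \<one>" "rzero quot = cls \<zero>"
  by (simp_all add: quot_def)

lemmas quot_ops = image_alg_ops[OF compatible_cls, folded quot_def]

lemma quot_models: "A \<in> models E \<Longrightarrow> quot \<in> models E"
  unfolding quot_def
  by (rule image_alg_models) (simp_all add: compatible_cls ops_closed_carrier residuated_lattice_axioms)

lemma gbl_quot: "gbl_algebra quot"
  using quot_models[of gbl_eqs] gbl_algebra_axioms by (simp add: GBL_def flip: GBL_eq)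

lemma quot_pow: "x \<in> carrier A \<Longrightarrow> cls x [^]\<^bsub>quot\<^esub> (n::nat) = cls (x [^] n)"
  by (induction n) (simp_all add: nat_pow_def[of quot] quot_ops)

lemma quot_le: 
  assumes "x \<in> carrier A" "y \<in> carrier A"
  shows "cls x \<preceq>\<^bsub>quot\<^esub> cls y \<longleftrightarrow> x \<leadsto> y \<in> F"
proof -
  have "x \<leadsto> (x \<curlywedge> y) = x \<leadsto> y"
    using assms imp_meet[of x x y] le_one[of "x \<leadsto> y"] by (simp add: rle_def meet_comm)
  moreover have "(x \<curlywedge> y) \<leadsto> x = \<one>" using assms by (simp add: imp_eq_one)
  ultimately show ?thesis using assms by (simp add: rle_def quot_ops cls_eq_iff)
qed

lemma cls_one_iff: "x \<in> carrier A \<Longrightarrow> cls x = cls \<one> \<longleftrightarrow> x \<in> F"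
  by (simp add: cls_eq_iff)

end

text \<open>Maximality is stated in the form that the quotient needs: the filter generated by
  \<open>F\<close> and \<open>x\<close> contains \<open>a\<close>. Thus the class of
  \<open>a\<close> can be the witness \<open>u\<close> of \<open>si_gbl\<close>.\<close>

locale vfilter = dfilter +
  fixes a
  assumes a_carrier: "a \<in> carrier A" and a_notin: "a \<notin> F"
    and maximal: "\<lbrakk>x \<in> carrier A; x \<notin> F\<rbrakk> \<Longrightarrow> \<exists>n::nat. x [^] n \<leadsto> a \<in> F"
begin

lemma si_gbl_quot: "si_gbl quot (cls a)"
proof -
  interpret Q: gbl_algebra quot by (rule gbl_quot)
  show ?thesis
  proof
    show "cls a \<in> carrier quot" using a_carrier by simp
    show "cls a \<noteq> \<one>\<^bsub>quot\<^esub>" using a_carrier a_notin by (simp add: cls_one_iff)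
    fix X assume X: "X \<in> carrier quot" "X \<noteq> \<one>\<^bsub>quot\<^esub>"
    then obtain x where x: "x \<in> carrier A" "X = cls x" by auto
    then have "x \<notin> F" using X by (simp add: cls_one_iff)
    then obtain n :: nat where "x [^] n \<leadsto> a \<in> F" using maximal x by blast
    then show "\<exists>n::nat. X [^]\<^bsub>quot\<^esub> n \<preceq>\<^bsub>quot\<^esub> cls a"
      using x a_carrier by (auto simp: quot_pow quot_le)
  qed
qed

definition upper :: "'a set" where
  "upper = {x \<in> carrier A. cls x \<in> si_gbl.top_part quot (cls a)}"

lemma upper_dfilter: "dfilter A upper"
proof -
  interpret Q: si_gbl quot "cls a" by (rule si_gbl_quot)
  show ?thesis
  proof
    show "\<one> \<in> upper" using Q.one_top by (simp add: upper_def)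
    fix x y assume x: "x \<in> upper"
    {
      assume "x \<preceq> y" "y \<in> carrier A"
      then have "cls x \<preceq>\<^bsub>quot\<^esub> cls y" using x by (simp add: quot_le imp_eq_one[THEN iffD2] upper_def)
      then show "y \<in> upper" using x \<open>y \<in> carrier A\<close> Q.top_upward[of "cls x" "cls y"] by (simp add: upper_def)
    next
      assume "y \<in> upper"
      then show "x \<otimes> y \<in> upper"
        using x Q.top_mult[of "cls x" "cls y"] by (simp add: upper_def quot_ops)
    }
  qed (auto simp: upper_def)
qed

lemma F_upper: "F \<subseteq> upper"
proof
  interpret Q: si_gbl quot "cls a" by (rule si_gbl_quot)
  fix x assume "x \<in> F"
  then have "cls x = \<one>\<^bsub>quot\<^esub>" by (simp add: cls_one_iff)
  then show "x \<in> upper" using \<open>x \<in> F\<close> Q.one_top by (simp add: upper_def)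
qed

lemma a_upper: "a \<in> upper"
proof -
  interpret Q: si_gbl quot "cls a" by (rule si_gbl_quot)
  show ?thesis using Q.u_top a_carrier by (simp add: upper_def)
qed

lemma local_emb_pullback:
  assumes "local_emb quot (cls ` S) {\<one>\<^bsub>quot\<^esub>} (si_gbl.top_part quot (cls a)) N \<psi>" and S: "S \<subseteq> carrier A"
  shows "local_emb A S F upper N (\<lambda>x. \<psi> (cls x))"
proof -
  have C: "x \<in> carrier A" if "x \<in> S" for x using that S by blast
  have U: "x \<in> upper \<longleftrightarrow> cls x \<in> si_gbl.top_part quot (cls a)" if "x \<in> S" for x
    using C[OF that] by (simp add: upper_def)
  have one: "cls x = \<one>\<^bsub>quot\<^esub> \<longleftrightarrow> x \<in> F" if "x \<in> S" for x
    using C[OF that] by (simp add: cls_one_iff)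
  have img: "cls x \<in> cls ` S" if "x \<in> S" for x using that by simp
  note d = assms(1)[unfolded local_emb_def]
  show ?thesis
    unfolding local_emb_def
  proof (intro conjI ballI impI)
    fix x assume x: "x \<in> S"
    show "\<exists>i\<le>N. \<psi> (cls x) = real i / real N" using d x by simp
    show "(\<psi> (cls x) = 1) = (x \<in> F)" using d one[OF x] x by simp
    show "\<psi> (cls x) = 0" if "x \<notin> upper" using d U[OF x] x that by simp
    fix y assume y: "y \<in> S"
    note ops = quot_ops[OF C[OF x] C[OF y], symmetric]
    have xy: "cls x \<in> cls ` S" "cls y \<in> cls ` S" using x y by simp_all
    show "\<psi> (cls (x \<otimes> y)) = max 0 (\<psi> (cls x) + \<psi> (cls y) - 1)" if "x \<otimes> y \<in> S"
      using d xy img[OF that] unfolding ops by blast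
    show "\<psi> (cls (x \<curlywedge> y)) = min (\<psi> (cls x)) (\<psi> (cls y))" if "x \<curlywedge> y \<in> S"
      using d xy img[OF that] unfolding ops by blast
    show "\<psi> (cls (x \<curlyvee> y)) = max (\<psi> (cls x)) (\<psi> (cls y))" if "x \<curlyvee> y \<in> S"
      using d xy img[OF that] unfolding ops by blast
    show "\<psi> (cls (x \<leadsto> y)) = min 1 (1 - \<psi> (cls x) + \<psi> (cls y))" if "x \<leadsto> y \<in> S" "x \<leadsto> y \<in> upper"
      using d xy img[OF that(1)] that(2)[unfolded U[OF that(1)]] unfolding ops by blast
  next
    assume "\<zero> \<in> S"
    then show "\<psi> (cls \<zero>) = 0" using d by force
  qed
qed

lemma local_emb_upper:
  assumes "finite S" "S \<subseteq> carrier A"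
  shows "\<exists>N \<psi>. N \<ge> 1 \<and> local_emb A S F upper N \<psi>"
proof -
  interpret Q: si_gbl quot "cls a" by (rule si_gbl_quot)
  obtain N \<psi> where "N \<ge> 1" "local_emb quot (cls ` S) {\<one>\<^bsub>quot\<^esub>} Q.top_part N \<psi>"
    using Q.local_emb_exists[of "cls ` S"] assms by (auto simp: image_mono)
  then show ?thesis using local_emb_pullback[OF _ assms(2)] by blast
qed

lemma local_emb_upper_potent:
  assumes "finite S" "S \<subseteq> carrier A" and "\<And>x. x \<in> carrier A \<Longrightarrow> x [^] (k + 1) = x [^] (k::nat)"
  shows "\<exists>N \<psi>. N \<ge> 1 \<and> N \<le> k \<and> local_emb A S F upper N \<psi>"
proof -
  interpret Q: si_gbl quot "cls a" by (rule si_gbl_quot)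
  have "X [^]\<^bsub>quot\<^esub> (k + 1) = X [^]\<^bsub>quot\<^esub> k" if "X \<in> carrier quot" for X
    using that assms(3) by (auto simp: quot_pow simp del: nat_pow_Suc add_Suc_right)
  then obtain N \<psi> where "N \<ge> 1" "N \<le> k" "local_emb quot (cls ` S) {\<one>\<^bsub>quot\<^esub>} Q.top_part N \<psi>"
    using Q.local_emb_potent_exists[of "cls ` S" k] assms by (auto simp: image_mono)
  then show ?thesis using local_emb_pullback[OF _ assms(2)] by blast
qed

end

lemma vfilter_exists:
  assumes "dfilter A G" "a \<in> carrier A" "a \<notin> G"
  shows "\<exists>F. vfilter A F a \<and> G \<subseteq> F"
proof -
  interpret G: dfilter A G by (rule assms(1))
  define \<F> where "\<F> = {F. dfilter A F \<and> G \<subseteq> F \<and> a \<notin> F}"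
  have "\<exists>M\<in>\<F>. \<forall>X\<in>\<F>. M \<subseteq> X \<longrightarrow> X = M"
  proof (rule subset_Zorn_nonempty)
    show "\<F> \<noteq> {}" using assms by (auto simp: \<F>_def)
    fix \<C> assume \<C>: "\<C> \<noteq> {}" "subset.chain \<F> \<C>"
    then have F: "dfilter A F" "G \<subseteq> F" "a \<notin> F" if "F \<in> \<C>" for F
      using that by (auto simp: \<F>_def subset_chain_def)
    have "dfilter A (\<Union>\<C>)"
    proof
      show "\<Union>\<C> \<subseteq> carrier A" using F(1) dfilter.F_carrier by blast
      show "\<one>\<^bsub>A\<^esub> \<in> \<Union>\<C>" using F(1) dfilter.one_F \<C>(1) by blast
      fix x y assume x: "x \<in> \<Union>\<C>"
      {
        assume xy: "x \<preceq>\<^bsub>A\<^esub> y" "y \<in> carrier A"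
        obtain X where X: "X \<in> \<C>" "x \<in> X" using x by blast
        have "y \<in> X" by (rule dfilter.F_up[OF F(1)[OF X(1)] X(2) xy])
        then show "y \<in> \<Union>\<C>" using X(1) by blast
      next
        assume "y \<in> \<Union>\<C>"
        then obtain X Y where XY: "X \<in> \<C>" "Y \<in> \<C>" "x \<in> X" "y \<in> Y" using x by blast
        then have "X \<subseteq> Y \<or> Y \<subseteq> X" using \<C>(2) by (auto simp: subset_chain_def)
        then obtain Z where Z: "Z \<in> \<C>" "x \<in> Z" "y \<in> Z" using XY by blast
        have "x \<otimes>\<^bsub>A\<^esub> y \<in> Z" by (rule dfilter.F_mult[OF F(1)[OF Z(1)] Z(2,3)])
        then show "x \<otimes>\<^bsub>A\<^esub> y \<in> \<Union>\<C>" using Z(1) by blast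
      }
    qed
    moreover have "G \<subseteq> \<Union>\<C>" using F(2) \<C>(1) by blast
    moreover have "a \<notin> \<Union>\<C>" using F(3) by blast
    ultimately show "\<Union>\<C> \<in> \<F>" by (simp add: \<F>_def)
  qed
  then obtain M where M: "dfilter A M" "G \<subseteq> M" "a \<notin> M"
    and max: "\<And>X. \<lbrakk>dfilter A X; G \<subseteq> X; a \<notin> X; M \<subseteq> X\<rbrakk> \<Longrightarrow> X = M" by (auto simp: \<F>_def)
  interpret M: dfilter A M by (rule M(1))
  have "\<exists>n::nat. x [^]\<^bsub>A\<^esub> n \<leadsto>\<^bsub>A\<^esub> a \<in> M" if x: "x \<in> carrier A" "x \<notin> M" for x
  proof (rule ccontr)
    assume no: "\<not> ?thesis"
    \<comment> \<open>The filter generated by \<open>M\<close> and \<open>x\<close>. If it omitted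
      \<open>a\<close>, maximality would make it equal to \<open>M\<close>, although it contains
      \<open>x\<close>.\<close>
    define X where "X = {y \<in> carrier A. \<exists>n::nat. x [^]\<^bsub>A\<^esub> n \<leadsto>\<^bsub>A\<^esub> y \<in> M}"
    note [simp] = x(1)
    have "dfilter A X"
    proof
      show "X \<subseteq> carrier A" by (auto simp: X_def)
      show "\<one>\<^bsub>A\<^esub> \<in> X" by (simp add: X_def)
      fix y z assume y: "y \<in> X"
      {
        assume yz: "y \<preceq>\<^bsub>A\<^esub> z" "z \<in> carrier A"
        obtain n :: nat where n: "x [^]\<^bsub>A\<^esub> n \<leadsto>\<^bsub>A\<^esub> y \<in> M" "y \<in> carrier A" using y by (auto simp: X_def)
        have "x [^]\<^bsub>A\<^esub> n \<leadsto>\<^bsub>A\<^esub> z \<in> M"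
          by (rule M.F_up[OF n(1)]) (use yz n(2) in \<open>simp_all add: G.imp_mono\<close>)
        then show "z \<in> X" using yz by (auto simp: X_def)
      next
        assume z: "z \<in> X"
        obtain n :: nat where n: "x [^]\<^bsub>A\<^esub> n \<leadsto>\<^bsub>A\<^esub> y \<in> M" "y \<in> carrier A" using y by (auto simp: X_def)
        obtain k :: nat where k: "x [^]\<^bsub>A\<^esub> k \<leadsto>\<^bsub>A\<^esub> z \<in> M" "z \<in> carrier A" using z by (auto simp: X_def)
        have "(x [^]\<^bsub>A\<^esub> n \<otimes>\<^bsub>A\<^esub> x [^]\<^bsub>A\<^esub> k) \<leadsto>\<^bsub>A\<^esub> (y \<otimes>\<^bsub>A\<^esub> z) \<in> M"
          using n k by (intro M.F_mult_cong) simp_all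
        then have "x [^]\<^bsub>A\<^esub> (n + k) \<leadsto>\<^bsub>A\<^esub> (y \<otimes>\<^bsub>A\<^esub> z) \<in> M" by (simp add: G.nat_pow_mult)
        then show "y \<otimes>\<^bsub>A\<^esub> z \<in> X" using n k by (auto simp: X_def)
      }
    qed
    moreover have "M \<subseteq> X"
    proof
      fix y assume y: "y \<in> M"
      then have "x [^]\<^bsub>A\<^esub> (0::nat) \<leadsto>\<^bsub>A\<^esub> y \<in> M" by simp
      then show "y \<in> X" using M.F_closed[OF y] unfolding X_def by blast
    qed
    moreover have "a \<notin> X" using no by (simp add: X_def)
    ultimately have "X = M" using max M(2) by blast
    moreover have "x [^]\<^bsub>A\<^esub> (1::nat) \<leadsto>\<^bsub>A\<^esub> x \<in> M" by simp
    then have "x \<in> X" using x(1) unfolding X_def by blast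
    ultimately show False using x(2) by simp
  qed
  then have "vfilter A M a" using assms(2) M(3) by unfold_locales
  then show ?thesis using M(2) by blast
qed

section \<open>Poset products\<close>

locale gbl_frame =
  fixes F :: "('x, 'b) frame" (structure)
  assumes po: "partial_order_on (worlds F) (ord F)"
    and gbl: "x \<in> worlds F \<Longrightarrow> gbl_algebra (alg F x)"
begin

definition strict_up :: "'x \<Rightarrow> 'x set" where
  "strict_up x = {y \<in> worlds F. (x, y) \<in> ord F \<and> x \<noteq> y}"

lemma strict_up_world [simp]: "y \<in> strict_up x \<Longrightarrow> y \<in> worlds F"
  by (simp add: strict_up_def)

lemma strict_up_trans: "\<lbrakk>y \<in> strict_up x; z \<in> strict_up y\<rbrakk> \<Longrightarrow> z \<in> strict_up x"
  using po unfolding strict_up_def partial_order_on_def preorder_on_def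
  by (auto dest: antisymD transD)

lemma rl: "x \<in> worlds F \<Longrightarrow> residuated_lattice (alg F x)"
  using gbl by (simp add: gbl_algebra_def)

lemma cm: "x \<in> worlds F \<Longrightarrow> comm_monoid (alg F x)"
  using rl by (simp add: residuated_lattice_def)

definition Box :: "('x \<Rightarrow> 'b) \<Rightarrow> bool" where
  "Box f \<longleftrightarrow> (\<forall>x\<in>worlds F. \<forall>y\<in>strict_up x. f x = \<zero>\<^bsub>alg F x\<^esub> \<or> f y = \<one>\<^bsub>alg F y\<^esub>)"

lemma box_apply:
  "x \<in> worlds F \<Longrightarrow> box F f x = (if \<forall>y\<in>strict_up x. f y = \<one>\<^bsub>alg F y\<^esub> then f x else \<zero>\<^bsub>alg F x\<^esub>)"
proof -
  assume "x \<in> worlds F"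
  moreover have "(\<forall>y\<in>worlds F. (x, y) \<in> ord F \<and> x \<noteq> y \<longrightarrow> f y = \<one>\<^bsub>alg F y\<^esub>) \<longleftrightarrow>
      (\<forall>y\<in>strict_up x. f y = \<one>\<^bsub>alg F y\<^esub>)" unfolding strict_up_def by blast
  ultimately show ?thesis unfolding box_def by simp
qed

lemma box_fixed_iff: "f \<in> extensional (worlds F) \<Longrightarrow> box F f = f \<longleftrightarrow> Box f"
proof
  assume "f \<in> extensional (worlds F)" "Box f"
  then have "box F f x = f x" for x
    by (cases "x \<in> worlds F") (auto simp: box_apply Box_def, auto simp: box_def extensional_def)
  then show "box F f = f" by blast
next
  assume "box F f = f"
  then show "Box f" unfolding Box_def using box_apply by metis
qed

lemma pp_carrier:
  "f \<in> carrier (poset_product F) \<longleftrightarrow>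
    f \<in> extensional (worlds F) \<and> (\<forall>x\<in>worlds F. f x \<in> carrier (alg F x)) \<and> Box f"
  by (auto simp: poset_product_def PiE_iff box_fixed_iff)

lemma box_in_carrier:
  assumes "\<And>x. x \<in> worlds F \<Longrightarrow> f x \<in> carrier (alg F x)"
  shows "box F f \<in> carrier (poset_product F)"
  unfolding pp_carrier
proof (intro conjI ballI)
  show "box F f \<in> extensional (worlds F)" by (simp add: box_def)
  show "box F f x \<in> carrier (alg F x)" if "x \<in> worlds F" for x
    using that assms residuated_lattice.zero_closed[OF rl] by (simp add: box_apply)
  show "Box (box F f)"
    unfolding Box_def
  proof (intro ballI)
    fix x y assume xy: "x \<in> worlds F" "y \<in> strict_up x"
    show "box F f x = \<zero>\<^bsub>alg F x\<^esub> \<or> box F f y = \<one>\<^bsub>alg F y\<^esub>"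
      using xy strict_up_trans[OF xy(2)] by (auto simp: box_apply)
  qed
qed

lemma pp_simps:
  assumes "x \<in> worlds F"
  shows "(f \<otimes>\<^bsub>poset_product F\<^esub> g) x = f x \<otimes>\<^bsub>alg F x\<^esub> g x" "(f \<curlyvee>\<^bsub>poset_product F\<^esub> g) x = f x \<curlyvee>\<^bsub>alg F x\<^esub> g x"
    "\<one>\<^bsub>poset_product F\<^esub> x = \<one>\<^bsub>alg F x\<^esub>" "\<zero>\<^bsub>poset_product F\<^esub> x = \<zero>\<^bsub>alg F x\<^esub>"
    "(f \<leadsto>\<^bsub>poset_product F\<^esub> g) x = (if \<forall>y\<in>strict_up x. f y \<leadsto>\<^bsub>alg F y\<^esub> g y = \<one>\<^bsub>alg F y\<^esub>
      then f x \<leadsto>\<^bsub>alg F x\<^esub> g x else \<zero>\<^bsub>alg F x\<^esub>)"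
  using assms by (simp_all add: poset_product_def box_apply)

lemma pp_value: "\<lbrakk>f \<in> carrier (poset_product F); x \<in> worlds F\<rbrakk> \<Longrightarrow> f x \<in> carrier (alg F x)"
  by (simp add: pp_carrier)

lemma pp_box:
  "\<lbrakk>f \<in> carrier (poset_product F); x \<in> worlds F; y \<in> strict_up x\<rbrakk> \<Longrightarrow> f x = \<zero>\<^bsub>alg F x\<^esub> \<or> f y = \<one>\<^bsub>alg F y\<^esub>"
  unfolding pp_carrier Box_def by blast

lemma pp_eqI:
  "\<lbrakk>f \<in> carrier (poset_product F); g \<in> carrier (poset_product F); \<And>x. x \<in> worlds F \<Longrightarrow> f x = g x\<rbrakk> \<Longrightarrow> f = g"
  by (auto simp: pp_carrier intro: extensionalityI)

lemma pp_one: "\<one>\<^bsub>poset_product F\<^esub> \<in> carrier (poset_product F)"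
  unfolding pp_carrier Box_def using monoid.one_closed[OF comm_monoid.axioms(1)[OF cm]]
  by (auto simp: pp_simps) (simp add: poset_product_def)

lemma pp_zero: "\<zero>\<^bsub>poset_product F\<^esub> \<in> carrier (poset_product F)"
  unfolding pp_carrier Box_def using residuated_lattice.zero_closed[OF rl]
  by (auto simp: pp_simps) (simp add: poset_product_def)

text \<open>The box in the definition of the meet does nothing on box-stable functions: where the
  pointwise meet differs from 1 at a higher point, one of the two functions already vanishes at
  \<open>x\<close>.\<close>

lemma pp_meet:
  assumes "x \<in> worlds F" "f \<in> carrier (poset_product F)" "g \<in> carrier (poset_product F)"
  shows "(f \<curlywedge>\<^bsub>poset_product F\<^esub> g) x = f x \<curlywedge>\<^bsub>alg F x\<^esub> g x"
proof -
  interpret gbl_algebra "alg F x" using gbl assms(1) .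
  note [simp] = pp_value[OF assms(2,1)] pp_value[OF assms(3,1)]
  show ?thesis
  proof (cases "\<forall>y\<in>strict_up x. f y \<curlywedge>\<^bsub>alg F y\<^esub> g y = \<one>\<^bsub>alg F y\<^esub>")
    case True
    then show ?thesis using assms(1) by (simp add: poset_product_def box_apply)
  next
    case False
    then obtain y where y: "y \<in> strict_up x" "f y \<curlywedge>\<^bsub>alg F y\<^esub> g y \<noteq> \<one>\<^bsub>alg F y\<^esub>" by blast
    interpret Y: gbl_algebra "alg F y" using gbl y(1) by simp
    have "f x = \<zero>\<^bsub>alg F x\<^esub> \<or> g x = \<zero>\<^bsub>alg F x\<^esub>"
      using y pp_box[OF assms(2,1) y(1)] pp_box[OF assms(3,1) y(1)] by auto
    then have "f x \<curlywedge>\<^bsub>alg F x\<^esub> g x = \<zero>\<^bsub>alg F x\<^esub>" by auto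
    then show ?thesis using False assms(1) by (simp add: poset_product_def box_apply)
  qed
qed

lemma pp_closed:
  assumes f: "f \<in> carrier (poset_product F)" and g: "g \<in> carrier (poset_product F)"
  shows "f \<otimes>\<^bsub>poset_product F\<^esub> g \<in> carrier (poset_product F)" "f \<curlyvee>\<^bsub>poset_product F\<^esub> g \<in> carrier (poset_product F)"
    "f \<curlywedge>\<^bsub>poset_product F\<^esub> g \<in> carrier (poset_product F)" "f \<leadsto>\<^bsub>poset_product F\<^esub> g \<in> carrier (poset_product F)"
proof -
  note vals = pp_value[OF f] pp_value[OF g]
  note boxes = pp_box[OF f] pp_box[OF g]
  have zero_mult: "a \<otimes>\<^bsub>alg F x\<^esub> b = \<zero>\<^bsub>alg F x\<^esub>"
    if "x \<in> worlds F" "a \<in> carrier (alg F x)" "b \<in> carrier (alg F x)" "a = \<zero>\<^bsub>alg F x\<^esub> \<or> b = \<zero>\<^bsub>alg F x\<^esub>" for x a b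
  proof -
    interpret gbl_algebra "alg F x" using gbl that(1) .
    show ?thesis using that by auto
  qed
  show "f \<otimes>\<^bsub>poset_product F\<^esub> g \<in> carrier (poset_product F)"
    unfolding pp_carrier Box_def
  proof (intro conjI ballI)
    show "f \<otimes>\<^bsub>poset_product F\<^esub> g \<in> extensional (worlds F)" by (simp add: poset_product_def)
    show "(f \<otimes>\<^bsub>poset_product F\<^esub> g) x \<in> carrier (alg F x)" if "x \<in> worlds F" for x
      using that vals monoid.m_closed[OF comm_monoid.axioms(1)[OF cm]] by (simp add: pp_simps)
    fix x y assume xy: "x \<in> worlds F" "y \<in> strict_up x"
    interpret Y: gbl_algebra "alg F y" using gbl xy(2) by simp
    show "(f \<otimes>\<^bsub>poset_product F\<^esub> g) x = \<zero>\<^bsub>alg F x\<^esub> \<or> (f \<otimes>\<^bsub>poset_product F\<^esub> g) y = \<one>\<^bsub>alg F y\<^esub>"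
      using xy boxes[OF xy] zero_mult[OF xy(1) vals[OF xy(1)]] by (auto simp: pp_simps)
  qed
  show "f \<curlyvee>\<^bsub>poset_product F\<^esub> g \<in> carrier (poset_product F)"
    unfolding pp_carrier Box_def
  proof (intro conjI ballI)
    show "f \<curlyvee>\<^bsub>poset_product F\<^esub> g \<in> extensional (worlds F)" by (simp add: poset_product_def)
    show "(f \<curlyvee>\<^bsub>poset_product F\<^esub> g) x \<in> carrier (alg F x)" if "x \<in> worlds F" for x
      using that vals residuated_lattice.join_closed[OF rl] by (simp add: pp_simps)
    fix x y assume xy: "x \<in> worlds F" "y \<in> strict_up x"
    interpret X: gbl_algebra "alg F x" using gbl xy(1) .
    interpret Y: gbl_algebra "alg F y" using gbl xy(2) by simp
    have yw: "y \<in> worlds F" using xy(2) by simp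
    show "(f \<curlyvee>\<^bsub>poset_product F\<^esub> g) x = \<zero>\<^bsub>alg F x\<^esub> \<or> (f \<curlyvee>\<^bsub>poset_product F\<^esub> g) y = \<one>\<^bsub>alg F y\<^esub>"
      using xy(1) yw boxes[OF xy] vals[OF yw] by (auto simp: pp_simps)
  qed
  have "box F (\<lambda>x\<in>worlds F. f x \<curlywedge>\<^bsub>alg F x\<^esub> g x) \<in> carrier (poset_product F)"
    by (rule box_in_carrier) (simp add: vals residuated_lattice.meet_closed[OF rl])
  then show "f \<curlywedge>\<^bsub>poset_product F\<^esub> g \<in> carrier (poset_product F)" by (simp add: poset_product_def)
  have "box F (\<lambda>x\<in>worlds F. f x \<leadsto>\<^bsub>alg F x\<^esub> g x) \<in> carrier (poset_product F)"
    by (rule box_in_carrier) (simp add: vals residuated_lattice.imp_closed[OF rl])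
  then show "f \<leadsto>\<^bsub>poset_product F\<^esub> g \<in> carrier (poset_product F)" by (simp add: poset_product_def)
qed

lemma pp_le:
  assumes f: "f \<in> carrier (poset_product F)" and g: "g \<in> carrier (poset_product F)"
  shows "f \<preceq>\<^bsub>poset_product F\<^esub> g \<longleftrightarrow> (\<forall>x\<in>worlds F. f x \<preceq>\<^bsub>alg F x\<^esub> g x)"
proof
  assume "f \<preceq>\<^bsub>poset_product F\<^esub> g"
  then have "f \<curlywedge>\<^bsub>poset_product F\<^esub> g = f" by (simp add: rle_def)
  then show "\<forall>x\<in>worlds F. f x \<preceq>\<^bsub>alg F x\<^esub> g x" unfolding rle_def using pp_meet[OF _ f g] by metis
next
  assume "\<forall>x\<in>worlds F. f x \<preceq>\<^bsub>alg F x\<^esub> g x"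
  then show "f \<preceq>\<^bsub>poset_product F\<^esub> g"
    unfolding rle_def by (intro pp_eqI pp_closed f g) (simp add: pp_meet[OF _ f g])
qed

text \<open>Only a point at which the box resets the implication to 0 needs an argument. There
  \<open>f\<close> is not below \<open>g\<close> at some higher \<open>y\<close>, so
  \<open>h y\<close> cannot be 1, and box-stability makes \<open>h\<close> vanish at the
  point.\<close>

lemma pp_residuation:
  assumes f: "f \<in> carrier (poset_product F)" and g: "g \<in> carrier (poset_product F)" and h: "h \<in> carrier (poset_product F)"
  shows "h \<otimes>\<^bsub>poset_product F\<^esub> f \<preceq>\<^bsub>poset_product F\<^esub> g \<longleftrightarrow> h \<preceq>\<^bsub>poset_product F\<^esub> f \<leadsto>\<^bsub>poset_product F\<^esub> g"
  unfolding pp_le[OF pp_closed(1)[OF h f] g] pp_le[OF h pp_closed(4)[OF f g]]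
proof (intro iffI ballI)
  fix x assume x: "x \<in> worlds F"
  interpret gbl_algebra "alg F x" using gbl x .
  note [simp] = pp_value[OF f x] pp_value[OF g x] pp_value[OF h x]
  {
    assume le: "\<forall>x\<in>worlds F. (h \<otimes>\<^bsub>poset_product F\<^esub> f) x \<preceq>\<^bsub>alg F x\<^esub> g x"
    show "h x \<preceq>\<^bsub>alg F x\<^esub> (f \<leadsto>\<^bsub>poset_product F\<^esub> g) x"
    proof (cases "\<forall>y\<in>strict_up x. f y \<leadsto>\<^bsub>alg F y\<^esub> g y = \<one>\<^bsub>alg F y\<^esub>")
      case True
      then show ?thesis using bspec[OF le x] x by (simp add: pp_simps residuation)
    next
      case False
      then obtain y where y: "y \<in> strict_up x" "f y \<leadsto>\<^bsub>alg F y\<^esub> g y \<noteq> \<one>\<^bsub>alg F y\<^esub>" by blast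
      have yw: "y \<in> worlds F" using y by simp
      interpret Y: gbl_algebra "alg F y" using gbl yw .
      note [simp] = pp_value[OF f yw] pp_value[OF g yw] pp_value[OF h yw]
      have "h y \<noteq> \<one>\<^bsub>alg F y\<^esub>"
      proof
        assume "h y = \<one>\<^bsub>alg F y\<^esub>"
        then have "f y \<preceq>\<^bsub>alg F y\<^esub> g y" using bspec[OF le yw] yw by (simp add: pp_simps)
        then show False using y(2) by (simp add: Y.imp_eq_one)
      qed
      then have "h x = \<zero>\<^bsub>alg F x\<^esub>" using pp_box[OF h x y(1)] by blast
      then show ?thesis using False x by (simp add: pp_simps zero_least)
    qed
  next
    assume "\<forall>x\<in>worlds F. h x \<preceq>\<^bsub>alg F x\<^esub> (f \<leadsto>\<^bsub>poset_product F\<^esub> g) x"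
    then have "h x \<preceq>\<^bsub>alg F x\<^esub> (f \<leadsto>\<^bsub>poset_product F\<^esub> g) x" using x by blast
    moreover have "(f \<leadsto>\<^bsub>poset_product F\<^esub> g) x \<preceq>\<^bsub>alg F x\<^esub> f x \<leadsto>\<^bsub>alg F x\<^esub> g x"
      using x by (simp add: pp_simps zero_least)
    moreover have "(f \<leadsto>\<^bsub>poset_product F\<^esub> g) x \<in> carrier (alg F x)"
      using pp_value[OF pp_closed(4)[OF f g] x] .
    ultimately have "h x \<preceq>\<^bsub>alg F x\<^esub> f x \<leadsto>\<^bsub>alg F x\<^esub> g x" by (meson le_trans imp_closed pp_value[OF f x] pp_value[OF g x] pp_value[OF h x])
    then show "(h \<otimes>\<^bsub>poset_product F\<^esub> f) x \<preceq>\<^bsub>alg F x\<^esub> g x" using x by (simp add: pp_simps residuation)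
  }
qed

lemma pp_divisibility:
  assumes f: "f \<in> carrier (poset_product F)" and g: "g \<in> carrier (poset_product F)"
  shows "f \<otimes>\<^bsub>poset_product F\<^esub> (f \<leadsto>\<^bsub>poset_product F\<^esub> g) = f \<curlywedge>\<^bsub>poset_product F\<^esub> g"
proof (intro pp_eqI pp_closed f g)
  fix x assume x: "x \<in> worlds F"
  interpret gbl_algebra "alg F x" using gbl x .
  note [simp] = pp_value[OF f x] pp_value[OF g x]
  show "(f \<otimes>\<^bsub>poset_product F\<^esub> (f \<leadsto>\<^bsub>poset_product F\<^esub> g)) x = (f \<curlywedge>\<^bsub>poset_product F\<^esub> g) x"
  proof (cases "\<forall>y\<in>strict_up x. f y \<leadsto>\<^bsub>alg F y\<^esub> g y = \<one>\<^bsub>alg F y\<^esub>")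
    case True
    then show ?thesis using x by (simp add: pp_simps pp_meet[OF x f g] divisibility)
  next
    case False
    then obtain y where y: "y \<in> strict_up x" "f y \<leadsto>\<^bsub>alg F y\<^esub> g y \<noteq> \<one>\<^bsub>alg F y\<^esub>" by blast
    have yw: "y \<in> worlds F" using y by simp
    interpret Y: gbl_algebra "alg F y" using gbl yw .
    \<comment> \<open>An implication into 1 is 1. So a failure above \<open>x\<close> makes
      \<open>g\<close> vanish at \<open>x\<close>, and both sides are 0.\<close>
    have "g y \<noteq> \<one>\<^bsub>alg F y\<^esub>" using y(2) pp_value[OF f yw] by auto
    then have "g x = \<zero>\<^bsub>alg F x\<^esub>" using pp_box[OF g x y(1)] by blast
    then show ?thesis using False x by (simp add: pp_simps pp_meet[OF x f g] divisibility)
  qed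
qed

lemma pp_gbl: "gbl_algebra (poset_product F)"
proof -
  let ?P = "poset_product F"
  have cmP: "comm_monoid ?P"
  proof (rule comm_monoidI)
    fix f g h assume f: "f \<in> carrier ?P" and g: "g \<in> carrier ?P" and h: "h \<in> carrier ?P"
    show "f \<otimes>\<^bsub>?P\<^esub> g \<otimes>\<^bsub>?P\<^esub> h = f \<otimes>\<^bsub>?P\<^esub> (g \<otimes>\<^bsub>?P\<^esub> h)"
      by (intro pp_eqI pp_closed f g h)
        (use pp_value[OF f] pp_value[OF g] pp_value[OF h] in
          \<open>simp add: pp_simps monoid.m_assoc[OF comm_monoid.axioms(1)[OF cm]]\<close>)
  next
    fix f g assume f: "f \<in> carrier ?P" and g: "g \<in> carrier ?P"
    show "f \<otimes>\<^bsub>?P\<^esub> g \<in> carrier ?P" by (rule pp_closed[OF f g])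
    show "f \<otimes>\<^bsub>?P\<^esub> g = g \<otimes>\<^bsub>?P\<^esub> f"
      by (intro pp_eqI pp_closed f g)
        (use pp_value[OF f] pp_value[OF g] in \<open>simp add: pp_simps comm_monoid.m_comm[OF cm]\<close>)
  next
    show "\<one>\<^bsub>?P\<^esub> \<in> carrier ?P" by (rule pp_one)
    fix f assume f: "f \<in> carrier ?P"
    show "\<one>\<^bsub>?P\<^esub> \<otimes>\<^bsub>?P\<^esub> f = f"
      by (intro pp_eqI pp_closed pp_one f)
        (use pp_value[OF f] in \<open>simp add: pp_simps monoid.l_one[OF comm_monoid.axioms(1)[OF cm]]\<close>)
  qed
  interpret comm_monoid ?P by (rule cmP)
  have "residuated_lattice ?P"
  proof
    fix f g assume f: "f \<in> carrier ?P" and g: "g \<in> carrier ?P"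
    note v = pp_value[OF f] pp_value[OF g]
    show "f \<curlywedge>\<^bsub>?P\<^esub> g \<in> carrier ?P" "f \<curlyvee>\<^bsub>?P\<^esub> g \<in> carrier ?P" "f \<leadsto>\<^bsub>?P\<^esub> g \<in> carrier ?P"
      using pp_closed[OF f g] by simp_all
    show "f \<curlywedge>\<^bsub>?P\<^esub> g = g \<curlywedge>\<^bsub>?P\<^esub> f"
      by (intro pp_eqI pp_closed f g) (use v in \<open>simp add: pp_meet f g residuated_lattice.meet_comm[OF rl]\<close>)
    show "f \<curlyvee>\<^bsub>?P\<^esub> g = g \<curlyvee>\<^bsub>?P\<^esub> f"
      by (intro pp_eqI pp_closed f g) (use v in \<open>simp add: pp_simps residuated_lattice.join_comm[OF rl]\<close>)
    show "f \<curlywedge>\<^bsub>?P\<^esub> (f \<curlyvee>\<^bsub>?P\<^esub> g) = f"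
      by (intro pp_eqI pp_closed f g)
        (use v in \<open>simp add: pp_meet pp_simps pp_closed f g residuated_lattice.meet_join_absorb[OF rl]\<close>)
    show "f \<curlyvee>\<^bsub>?P\<^esub> (f \<curlywedge>\<^bsub>?P\<^esub> g) = f"
      by (intro pp_eqI pp_closed f g)
        (use v in \<open>simp add: pp_meet pp_simps pp_closed f g residuated_lattice.join_meet_absorb[OF rl]\<close>)
    fix h assume h: "h \<in> carrier ?P"
    note v = v pp_value[OF h]
    show "f \<curlywedge>\<^bsub>?P\<^esub> g \<curlywedge>\<^bsub>?P\<^esub> h = f \<curlywedge>\<^bsub>?P\<^esub> (g \<curlywedge>\<^bsub>?P\<^esub> h)"
      by (intro pp_eqI pp_closed f g h)
        (use v in \<open>simp add: pp_meet pp_closed f g h residuated_lattice.meet_assoc[OF rl]\<close>)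
    show "f \<curlyvee>\<^bsub>?P\<^esub> g \<curlyvee>\<^bsub>?P\<^esub> h = f \<curlyvee>\<^bsub>?P\<^esub> (g \<curlyvee>\<^bsub>?P\<^esub> h)"
      by (intro pp_eqI pp_closed f g h)
        (use v in \<open>simp add: pp_simps residuated_lattice.join_assoc[OF rl]\<close>)
    show "f \<otimes>\<^bsub>?P\<^esub> g \<preceq>\<^bsub>?P\<^esub> h \<longleftrightarrow> f \<preceq>\<^bsub>?P\<^esub> g \<leadsto>\<^bsub>?P\<^esub> h"
      by (rule pp_residuation[OF g h f])
  next
    show "\<zero>\<^bsub>?P\<^esub> \<in> carrier ?P" by (rule pp_zero)
    fix f assume f: "f \<in> carrier ?P"
    show "\<zero>\<^bsub>?P\<^esub> \<preceq>\<^bsub>?P\<^esub> f"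
      using pp_value[OF f] by (simp add: pp_le[OF pp_zero f] pp_simps residuated_lattice.zero_least[OF rl])
    show "f \<preceq>\<^bsub>?P\<^esub> \<one>\<^bsub>?P\<^esub>"
      using pp_value[OF f] by (simp add: pp_le[OF f one_closed] pp_simps residuated_lattice.one_greatest[OF rl])
  qed
  then interpret residuated_lattice ?P .
  show ?thesis by unfold_locales (rule pp_divisibility)
qed

text \<open>Were both implications reset at \<open>x\<close>, there would be higher points
  \<open>y\<close> and \<open>z\<close> with \<open>f\<close> not below \<open>g\<close> at
  \<open>y\<close> and \<open>g\<close> not below \<open>f\<close> at \<open>z\<close>. These are
  comparable, and the function that is nonzero at the lower one is 1 at the higher one, where it was
  supposed to fail to dominate. If only one implication is reset, its conclusion vanishes at
  \<open>x\<close>, and the other one is 1.\<close>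

lemma pp_prelinear:
  assumes root: "\<And>x. x \<in> worlds F \<Longrightarrow> total_on {y \<in> worlds F. (x, y) \<in> ord F} (ord F)"
    and chain: "\<And>x. x \<in> worlds F \<Longrightarrow> is_chain (alg F x)"
  shows "bl_algebra (poset_product F)"
proof -
  let ?P = "poset_product F"
  interpret P: gbl_algebra ?P by (rule pp_gbl)
  have "(f \<leadsto>\<^bsub>?P\<^esub> g) \<curlyvee>\<^bsub>?P\<^esub> (g \<leadsto>\<^bsub>?P\<^esub> f) = \<one>\<^bsub>?P\<^esub>" if f: "f \<in> carrier ?P" and g: "g \<in> carrier ?P" for f g
  proof (intro pp_eqI pp_closed pp_one f g)
    fix x assume x: "x \<in> worlds F"
    have val: "f y \<in> carrier (alg F y)" "g y \<in> carrier (alg F y)" if "y \<in> worlds F" for y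
      using pp_value[OF f that] pp_value[OF g that] .
    interpret X: gbl_algebra "alg F x" using gbl x .
    note [simp] = val[OF x]
    have imp1: "a \<leadsto>\<^bsub>alg F y\<^esub> b = \<one>\<^bsub>alg F y\<^esub> \<longleftrightarrow> a \<preceq>\<^bsub>alg F y\<^esub> b"
      if "y \<in> worlds F" "a \<in> carrier (alg F y)" "b \<in> carrier (alg F y)" for y a b
      using that by (rule residuated_lattice.imp_eq_one[OF rl])
    have tot: "f y \<preceq>\<^bsub>alg F y\<^esub> g y \<or> g y \<preceq>\<^bsub>alg F y\<^esub> f y" if "y \<in> worlds F" for y
      using chain[OF that] val[OF that] by (auto simp: is_chain_def)
    define up where "up = (\<lambda>p q. \<forall>y\<in>strict_up x. p y \<leadsto>\<^bsub>alg F y\<^esub> q y = \<one>\<^bsub>alg F y\<^esub>)"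
    have one: "(p \<leadsto>\<^bsub>?P\<^esub> q) x = \<one>\<^bsub>alg F x\<^esub>" if "up p q" "p x \<preceq>\<^bsub>alg F x\<^esub> q x" "p x \<in> carrier (alg F x)" "q x \<in> carrier (alg F x)" for p q
      using that x imp1 by (simp add: pp_simps up_def)
    have zero: "p x = \<zero>\<^bsub>alg F x\<^esub>" if "\<not> up q p" "p \<in> carrier ?P" "q \<in> carrier ?P" for p q
    proof -
      obtain y where y: "y \<in> strict_up x" "q y \<leadsto>\<^bsub>alg F y\<^esub> p y \<noteq> \<one>\<^bsub>alg F y\<^esub>" using \<open>\<not> up q p\<close> by (auto simp: up_def)
      have yw: "y \<in> worlds F" using y by simp
      have "p y \<noteq> \<one>\<^bsub>alg F y\<^esub>" using y(2) residuated_lattice.imp_one[OF rl[OF yw] pp_value[OF that(3) yw]] by auto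
      then show ?thesis using pp_box[OF that(2) x y(1)] by blast
    qed
    have "(f \<leadsto>\<^bsub>?P\<^esub> g) x = \<one>\<^bsub>alg F x\<^esub> \<or> (g \<leadsto>\<^bsub>?P\<^esub> f) x = \<one>\<^bsub>alg F x\<^esub>"
    proof (cases "up f g"; cases "up g f")
      assume "up f g" "up g f"
      then show ?thesis using tot[OF x] one by auto
    next
      assume 1: "up f g" "\<not> up g f"
      have "f x = \<zero>\<^bsub>alg F x\<^esub>" by (rule zero[OF 1(2) f g])
      then have "f x \<preceq>\<^bsub>alg F x\<^esub> g x" by (simp add: X.zero_least)
      then show ?thesis using one[OF 1(1)] by simp
    next
      assume 1: "\<not> up f g" "up g f"
      have "g x = \<zero>\<^bsub>alg F x\<^esub>" by (rule zero[OF 1(1) g f])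
      then have "g x \<preceq>\<^bsub>alg F x\<^esub> f x" by (simp add: X.zero_least)
      then show ?thesis using one[OF 1(2)] by simp
    next
      assume "\<not> up f g" "\<not> up g f"
      then obtain y z where yz: "y \<in> strict_up x" "f y \<leadsto>\<^bsub>alg F y\<^esub> g y \<noteq> \<one>\<^bsub>alg F y\<^esub>"
        "z \<in> strict_up x" "g z \<leadsto>\<^bsub>alg F z\<^esub> f z \<noteq> \<one>\<^bsub>alg F z\<^esub>" by (auto simp: up_def)
      have w: "y \<in> worlds F" "z \<in> worlds F" using yz by simp_all
      interpret Y: gbl_algebra "alg F y" using gbl w(1) .
      interpret Z: gbl_algebra "alg F z" using gbl w(2) .
      have fg: "\<not> f y \<preceq>\<^bsub>alg F y\<^esub> g y" using yz(2) imp1 val w by simp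
      have gf: "\<not> g z \<preceq>\<^bsub>alg F z\<^esub> f z" using yz(4) imp1 val w by simp
      have "y \<noteq> z" using fg gf tot[OF w(1)] by auto
      then have "z \<in> strict_up y \<or> y \<in> strict_up z"
        using root[OF x] yz(1,3) unfolding total_on_def strict_up_def by blast
      then have False
      proof
        assume z: "z \<in> strict_up y"
        have "f y \<noteq> \<zero>\<^bsub>alg F y\<^esub>" using fg Y.zero_least[OF val(2)[OF w(1)]] by auto
        then have "f z = \<one>\<^bsub>alg F z\<^esub>" using pp_box[OF f w(1) z] by blast
        then show False using gf Z.one_greatest[OF val(2)[OF w(2)]] by auto
      next
        assume y: "y \<in> strict_up z"
        have "g z \<noteq> \<zero>\<^bsub>alg F z\<^esub>" using gf Z.zero_least[OF val(1)[OF w(2)]] by auto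
        then have "g y = \<one>\<^bsub>alg F y\<^esub>" using pp_box[OF g w(2) y] by blast
        then show False using fg Y.one_greatest[OF val(1)[OF w(1)]] by auto
      qed
      then show ?thesis ..
    qed
    moreover have "(f \<leadsto>\<^bsub>?P\<^esub> g) x \<in> carrier (alg F x)" "(g \<leadsto>\<^bsub>?P\<^esub> f) x \<in> carrier (alg F x)"
      using pp_value[OF pp_closed(4)[OF f g] x] pp_value[OF pp_closed(4)[OF g f] x] .
    ultimately show "((f \<leadsto>\<^bsub>?P\<^esub> g) \<curlyvee>\<^bsub>?P\<^esub> (g \<leadsto>\<^bsub>?P\<^esub> f)) x = \<one>\<^bsub>?P\<^esub> x"
      using x by (auto simp: pp_simps(2,3))
  qed
  then show ?thesis by unfold_locales
qed

lemma pp_pow: "x \<in> worlds F \<Longrightarrow> (f [^]\<^bsub>poset_product F\<^esub> (n::nat)) x = f x [^]\<^bsub>alg F x\<^esub> n"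
  by (induction n) (simp_all add: nat_pow_def pp_simps)

lemma pp_potent:
  assumes "\<And>x a. \<lbrakk>x \<in> worlds F; a \<in> carrier (alg F x)\<rbrakk> \<Longrightarrow> a [^]\<^bsub>alg F x\<^esub> (k + 1) = a [^]\<^bsub>alg F x\<^esub> (k::nat)"
    and f: "f \<in> carrier (poset_product F)"
  shows "f [^]\<^bsub>poset_product F\<^esub> (k + 1) = f [^]\<^bsub>poset_product F\<^esub> k"
proof -
  interpret P: gbl_algebra "poset_product F" by (rule pp_gbl)
  show ?thesis
  proof (intro pp_eqI P.nat_pow_closed f)
    fix x assume x: "x \<in> worlds F"
    show "(f [^]\<^bsub>poset_product F\<^esub> (k + 1)) x = (f [^]\<^bsub>poset_product F\<^esub> k) x"
      unfolding pp_pow[OF x] by (rule assms(1)[OF x pp_value[OF f x]])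
  qed
qed

end

section \<open>Soundness and transfer between frames\<close>

instance trm :: countable
  by countable_datatype

text \<open>Validity in \<open>models E\<close> speaks only of algebras over \<open>'a\<close>. The
  values of all terms under one valuation form a countable subalgebra of the poset product, which
  has a copy over \<open>'a\<close> because terms are countable and \<open>'a\<close> is
  infinite.\<close>

lemma soundI:
  fixes K :: "('x, 'b) frame set"
  assumes "\<And>F. F \<in> K \<Longrightarrow> poset_product F \<in> models E"
  shows "sound K (models E :: 'a::infinite rlat set)"
  unfolding sound_def forces_def
proof (intro allI impI ballI)
  fix t F x and h :: "nat \<Rightarrow> 'x \<Rightarrow> 'b"
  assume t: "valid_one (models E :: 'a rlat set) t" and F: "F \<in> K"
    and h: "\<forall>v. h v \<in> carrier (poset_product F)" and x: "x \<in> worlds F"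
  let ?P = "poset_product F"
  define D where "D = range (eval ?P h)"
  have P: "?P \<in> models E" using assms F .
  have D: "D \<subseteq> carrier ?P"
    using P h eval_closed[of ?P "carrier ?P" h] by (auto simp: D_def models_def)
  have "ops_closed ?P D"
    unfolding ops_closed_def D_def
    using rangeI[of "eval ?P h" Zero] rangeI[of "eval ?P h" One] by (auto simp flip: eval.simps(4-))
  have "countable D" by (simp add: D_def)
  obtain e :: "nat \<Rightarrow> 'a" where "inj e"
    using infinite_countable_subset[OF infinite_UNIV] by blast
  define g where "g = e \<circ> to_nat_on D"
  have inj: "inj_on g D"
    unfolding g_def using \<open>countable D\<close> \<open>inj e\<close> by (meson comp_inj_on inj_on_subset inj_on_to_nat_on subset_UNIV)
  then have c: "compatible g D ?P" by (rule compatible_inj)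
  have hD: "h v \<in> D" for v unfolding D_def by (metis eval.simps(1) rangeI)
  have "image_alg g D ?P \<in> models E" by (rule image_alg_models[OF P D \<open>ops_closed ?P D\<close> c])
  moreover have "\<forall>v. g (h v) \<in> carrier (image_alg g D ?P)" using hD by simp
  ultimately have "eval (image_alg g D ?P) (\<lambda>v. g (h v)) t = \<one>\<^bsub>image_alg g D ?P\<^esub>"
    using t[unfolded valid_one_def, rule_format, of "image_alg g D ?P" "\<lambda>v. g (h v)"] by simp
  then have "g (eval ?P h t) = g \<one>\<^bsub>?P\<^esub>"
    by (simp add: eval_image_alg[OF c \<open>ops_closed ?P D\<close> hD])
  moreover have "eval ?P h t \<in> D" "\<one>\<^bsub>?P\<^esub> \<in> D"
    using \<open>ops_closed ?P D\<close> by (simp_all add: D_def ops_closed_def)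
  ultimately have "eval ?P h t = \<one>\<^bsub>?P\<^esub>" using inj by (simp add: inj_on_eq_iff)
  then show "eval ?P h t x = \<one>\<^bsub>alg F x\<^esub>" using x by (simp add: poset_product_def)
qed

section \<open>Transfer of refutations along embeddings of the value algebras\<close>

definition embeds :: "('b \<Rightarrow> 'c) \<Rightarrow> 'b rlat \<Rightarrow> 'c rlat \<Rightarrow> bool" where
  "embeds \<iota> A B \<longleftrightarrow> \<iota> ` carrier A \<subseteq> carrier B \<and> inj_on \<iota> (carrier A) \<and>
    \<iota> \<one>\<^bsub>A\<^esub> = \<one>\<^bsub>B\<^esub> \<and> \<iota> \<zero>\<^bsub>A\<^esub> = \<zero>\<^bsub>B\<^esub> \<and>
    (\<forall>x\<in>carrier A. \<forall>y\<in>carrier A. \<iota> (x \<curlywedge>\<^bsub>A\<^esub> y) = \<iota> x \<curlywedge>\<^bsub>B\<^esub> \<iota> y \<and> \<iota> (x \<curlyvee>\<^bsub>A\<^esub> y) = \<iota> x \<curlyvee>\<^bsub>B\<^esub> \<iota> y \<and>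
      \<iota> (x \<otimes>\<^bsub>A\<^esub> y) = \<iota> x \<otimes>\<^bsub>B\<^esub> \<iota> y \<and> \<iota> (x \<leadsto>\<^bsub>A\<^esub> y) = \<iota> x \<leadsto>\<^bsub>B\<^esub> \<iota> y)"

lemma embeds_image_alg:
  assumes "inj_on \<iota> (carrier A)"
  shows "embeds \<iota> A (image_alg \<iota> (carrier A) A)"
proof -
  note ops = image_alg_ops[OF compatible_inj[OF assms, of A]]
  show ?thesis
    unfolding embeds_def
    by (intro conjI ballI ops[symmetric]) (simp_all add: assms)
qed

text \<open>Composition with \<open>\<iota>\<close> commutes with the operations of the poset
  products: the box only asks whether a value is 1, and an injective map preserving 1 neither
  creates nor destroys this.\<close>

lemma forces_embedding:
  assumes F1: "gbl_frame F1" and F2: "gbl_frame F2"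
    and eq: "worlds F2 = worlds F1" "ord F2 = ord F1"
    and emb: "\<And>x. x \<in> worlds F1 \<Longrightarrow> embeds \<iota> (alg F1 x) (alg F2 x)"
    and forces: "F2 \<tturnstile> t"
  shows "F1 \<tturnstile> t"
  unfolding forces_def
proof (intro allI impI ballI)
  fix h :: "nat \<Rightarrow> _" and x assume h: "\<forall>v. h v \<in> carrier (poset_product F1)" and x: "x \<in> worlds F1"
  interpret F1: gbl_frame F1 by (rule F1)
  interpret F2: gbl_frame F2 by (rule F2)
  interpret P1: gbl_algebra "poset_product F1" by (rule F1.pp_gbl)
  interpret P2: gbl_algebra "poset_product F2" by (rule F2.pp_gbl)
  have up: "F2.strict_up = F1.strict_up"
    unfolding fun_eq_iff F1.strict_up_def F2.strict_up_def eq by blast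
  have \<iota>: "\<iota> a \<in> carrier (alg F2 x)" if "a \<in> carrier (alg F1 x)" "x \<in> worlds F1" for a x
    using emb[OF that(2)] that(1) by (auto simp: embeds_def)
  have \<iota>1: "\<iota> a = \<one>\<^bsub>alg F2 x\<^esub> \<longleftrightarrow> a = \<one>\<^bsub>alg F1 x\<^esub>" if "a \<in> carrier (alg F1 x)" "x \<in> worlds F1" for a x
  proof -
    have "\<one>\<^bsub>alg F1 x\<^esub> \<in> carrier (alg F1 x)"
      using F1.cm[OF that(2)] by (simp add: comm_monoid_def monoid.one_closed)
    then show ?thesis using emb[OF that(2)] that(1) unfolding embeds_def by (metis inj_on_eq_iff)
  qed
  define lift where "lift f = (\<lambda>x\<in>worlds F1. \<iota> (f x))" for f
  have lift_apply: "lift f y = \<iota> (f y)" if "y \<in> worlds F1" for f y using that by (simp add: lift_def)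
  have lift_carrier: "lift f \<in> carrier (poset_product F2)" if f: "f \<in> carrier (poset_product F1)" for f
    unfolding F2.pp_carrier F2.Box_def eq up
  proof (intro conjI ballI)
    show "lift f \<in> extensional (worlds F1)" by (simp add: lift_def)
    show "lift f y \<in> carrier (alg F2 y)" if "y \<in> worlds F1" for y
      using that \<iota> F1.pp_value[OF f] by (simp add: lift_apply)
    fix y z assume yz: "y \<in> worlds F1" "z \<in> F1.strict_up y"
    have zw: "z \<in> worlds F1" using yz(2) by simp
    show "lift f y = \<zero>\<^bsub>alg F2 y\<^esub> \<or> lift f z = \<one>\<^bsub>alg F2 z\<^esub>"
      using F1.pp_box[OF f yz] emb[OF yz(1)] emb[OF zw] yz(1) zw by (auto simp: lift_apply embeds_def)
  qed
  have closed1: "ops_closed (poset_product F1) (carrier (poset_product F1))"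
    by (rule ops_closed_carrier) (rule P1.residuated_lattice_axioms)
  have ev1: "eval (poset_product F1) h s \<in> carrier (poset_product F1)" for s
    by (rule eval_closed[OF closed1]) (use h in blast)
  have imp_lift: "lift (f \<leadsto>\<^bsub>poset_product F1\<^esub> g) y = (lift f \<leadsto>\<^bsub>poset_product F2\<^esub> lift g) y"
    if f: "f \<in> carrier (poset_product F1)" and g: "g \<in> carrier (poset_product F1)" and y: "y \<in> worlds F1" for f g y
  proof -
    have hom: "\<iota> (f z) \<leadsto>\<^bsub>alg F2 z\<^esub> \<iota> (g z) = \<iota> (f z \<leadsto>\<^bsub>alg F1 z\<^esub> g z)" if "z \<in> worlds F1" for z
      using emb[OF that] F1.pp_value[OF f that] F1.pp_value[OF g that] by (simp add: embeds_def)
    have "f z \<leadsto>\<^bsub>alg F1 z\<^esub> g z \<in> carrier (alg F1 z)" if "z \<in> worlds F1" for z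
      using residuated_lattice.imp_closed[OF F1.rl[OF that] F1.pp_value[OF f that] F1.pp_value[OF g that]] .
    then have "(\<forall>z\<in>F1.strict_up y. lift f z \<leadsto>\<^bsub>alg F2 z\<^esub> lift g z = \<one>\<^bsub>alg F2 z\<^esub>) \<longleftrightarrow>
        (\<forall>z\<in>F1.strict_up y. f z \<leadsto>\<^bsub>alg F1 z\<^esub> g z = \<one>\<^bsub>alg F1 z\<^esub>)"
      using hom \<iota>1 by (simp add: lift_apply)
    then show ?thesis
      using y eq hom[OF y] emb[OF y] by (auto simp: F1.pp_simps F2.pp_simps up lift_apply embeds_def)
  qed
  have ev: "eval (poset_product F2) (\<lambda>v. lift (h v)) s = lift (eval (poset_product F1) h s)" for s
  proof (induction s)
    case Zero
    show ?case
    proof (simp, rule F2.pp_eqI[OF P2.zero_closed lift_carrier[OF P1.zero_closed]])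
      fix y assume "y \<in> worlds F2"
      then show "\<zero>\<^bsub>poset_product F2\<^esub> y = lift \<zero>\<^bsub>poset_product F1\<^esub> y"
        using emb eq by (simp add: lift_apply F1.pp_simps F2.pp_simps embeds_def)
    qed
  next
    case One
    show ?case
    proof (simp, rule F2.pp_eqI[OF P2.one_closed lift_carrier[OF P1.one_closed]])
      fix y assume "y \<in> worlds F2"
      then show "\<one>\<^bsub>poset_product F2\<^esub> y = lift \<one>\<^bsub>poset_product F1\<^esub> y"
        using emb eq by (simp add: lift_apply F1.pp_simps F2.pp_simps embeds_def)
    qed
  next
    case (Meet s r)
    let ?s = "eval (poset_product F1) h s" and ?r = "eval (poset_product F1) h r"
    have "lift ?s \<curlywedge>\<^bsub>poset_product F2\<^esub> lift ?r = lift (?s \<curlywedge>\<^bsub>poset_product F1\<^esub> ?r)"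
    proof (intro F2.pp_eqI P2.meet_closed lift_carrier P1.meet_closed ev1)
      fix y assume y: "y \<in> worlds F2"
      then show "(lift ?s \<curlywedge>\<^bsub>poset_product F2\<^esub> lift ?r) y = lift (?s \<curlywedge>\<^bsub>poset_product F1\<^esub> ?r) y"
        using emb[of y] eq F1.pp_value[OF ev1, of y]
        by (simp add: F2.pp_meet[OF y lift_carrier[OF ev1] lift_carrier[OF ev1]] F1.pp_meet[OF _ ev1 ev1] lift_apply embeds_def)
    qed
    then show ?case using Meet by simp
  next
    case (Join s r)
    let ?s = "eval (poset_product F1) h s" and ?r = "eval (poset_product F1) h r"
    have "lift ?s \<curlyvee>\<^bsub>poset_product F2\<^esub> lift ?r = lift (?s \<curlyvee>\<^bsub>poset_product F1\<^esub> ?r)"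
    proof (intro F2.pp_eqI P2.join_closed lift_carrier P1.join_closed ev1)
      fix y assume y: "y \<in> worlds F2"
      then show "(lift ?s \<curlyvee>\<^bsub>poset_product F2\<^esub> lift ?r) y = lift (?s \<curlyvee>\<^bsub>poset_product F1\<^esub> ?r) y"
        using emb[of y] eq F1.pp_value[OF ev1, of y]
        by (simp add: F1.pp_simps F2.pp_simps lift_apply embeds_def)
    qed
    then show ?case using Join by simp
  next
    case (Mult s r)
    let ?s = "eval (poset_product F1) h s" and ?r = "eval (poset_product F1) h r"
    have "lift ?s \<otimes>\<^bsub>poset_product F2\<^esub> lift ?r = lift (?s \<otimes>\<^bsub>poset_product F1\<^esub> ?r)"
    proof (intro F2.pp_eqI P2.m_closed lift_carrier P1.m_closed ev1)
      fix y assume y: "y \<in> worlds F2"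
      then show "(lift ?s \<otimes>\<^bsub>poset_product F2\<^esub> lift ?r) y = lift (?s \<otimes>\<^bsub>poset_product F1\<^esub> ?r) y"
        using emb[of y] eq F1.pp_value[OF ev1, of y]
        by (simp add: F1.pp_simps F2.pp_simps lift_apply embeds_def)
    qed
    then show ?case using Mult by simp
  next
    case (Imp s r)
    let ?s = "eval (poset_product F1) h s" and ?r = "eval (poset_product F1) h r"
    have "lift ?s \<leadsto>\<^bsub>poset_product F2\<^esub> lift ?r = lift (?s \<leadsto>\<^bsub>poset_product F1\<^esub> ?r)"
    proof (intro F2.pp_eqI P2.imp_closed lift_carrier P1.imp_closed ev1)
      fix y assume y: "y \<in> worlds F2"
      then show "(lift ?s \<leadsto>\<^bsub>poset_product F2\<^esub> lift ?r) y = lift (?s \<leadsto>\<^bsub>poset_product F1\<^esub> ?r) y"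
        using eq imp_lift[OF ev1 ev1, of y] by simp
    qed
    then show ?case using Imp by simp
  qed simp
  have "eval (poset_product F2) (\<lambda>v. lift (h v)) t x = \<one>\<^bsub>alg F2 x\<^esub>"
    using forces x eq lift_carrier h unfolding forces_def by simp
  then have "\<iota> (eval (poset_product F1) h t x) = \<one>\<^bsub>alg F2 x\<^esub>" using ev x by (simp add: lift_apply)
  then show "eval (poset_product F1) h t x = \<one>\<^bsub>alg F1 x\<^esub>"
    using \<iota>1[OF F1.pp_value[OF ev1 x] x] by simp
qed

section \<open>Subalgebras of the standard MV-algebra\<close>

text \<open>For simplicity of the algebra, a congruence identifying \<open>x < y\<close> identifies
  \<open>z = 1 - y + x\<close>, the value of the implication from \<open>y\<close> to
  \<open>x\<close>, with 1. Each power of \<open>z\<close> loses a further \<open>1 - z\<close>, so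
  by the Archimedean property some power is 0. Then 0 and 1 are identified, and with them
  everything.\<close>

lemma unit_subalgebra:
  assumes C: "C \<subseteq> {0..1}" "0 \<in> C" "1 \<in> C"
    and cl: "\<And>x y. \<lbrakk>x \<in> C; y \<in> C\<rbrakk> \<Longrightarrow> max 0 (x + y - 1) \<in> C" "\<And>x y. \<lbrakk>x \<in> C; y \<in> C\<rbrakk> \<Longrightarrow> min 1 (1 - x + y) \<in> C"
  shows "mv_algebra (MV_unit\<lparr>carrier := C\<rparr>)" (is "mv_algebra ?A")
    and "is_chain (MV_unit\<lparr>carrier := C\<rparr>)" and "simple_algebra (MV_unit\<lparr>carrier := C\<rparr>)"
proof -
  have ops: "x \<curlywedge>\<^bsub>?A\<^esub> y = min x y" "x \<curlyvee>\<^bsub>?A\<^esub> y = max x y" "x \<otimes>\<^bsub>?A\<^esub> y = max 0 (x + y - 1)"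
    "x \<leadsto>\<^bsub>?A\<^esub> y = min 1 (1 - x + y)" "\<one>\<^bsub>?A\<^esub> = 1" "\<zero>\<^bsub>?A\<^esub> = 0" "carrier ?A = C" for x y
    by (simp_all add: MV_unit_def)
  have b: "0 \<le> x" "x \<le> 1" if "x \<in> C" for x using that C(1) by auto
  have "satisfies ?A e" if e: "e \<in> insert involution_eq (insert prelinearity_eq gbl_eqs)" for e
    unfolding satisfies_def
  proof (intro allI impI)
    fix h :: "nat \<Rightarrow> real" assume h: "\<forall>v. h v \<in> carrier ?A"
    define x where "x = h 0"
    define y where "y = h (Suc 0)"
    define z where "z = h 2"
    have "x \<in> C" "y \<in> C" "z \<in> C" using h by (simp_all add: ops x_def y_def z_def)
    then have "0 \<le> x" "x \<le> 1" "0 \<le> y" "y \<le> 1" "0 \<le> z" "z \<le> 1" using b by simp_all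
    then show "eval ?A h (fst e) = eval ?A h (snd e)"
      using e unfolding gbl_eqs_def prelinearity_eq_def involution_eq_def
      by (elim insertE emptyE) (auto simp: MV_unit_def min_def max_def x_def y_def z_def)
  qed
  moreover have "ops_closed ?A (carrier ?A)"
    unfolding ops_closed_def ops using C(2,3) cl by (auto simp: min_def max_def)
  ultimately have "?A \<in> models (insert involution_eq (insert prelinearity_eq gbl_eqs))"
    by (simp add: models_def)
  then show "mv_algebra ?A" unfolding MV_eq[symmetric] by simp
  show "is_chain ?A" unfolding is_chain_def rle_def ops by auto
  show "simple_algebra ?A"
    unfolding simple_algebra_def ops
  proof (intro conjI allI impI)
    have "(0, 1) \<in> C \<times> C - Id_on C" using C(2,3) by auto
    then show "Id_on C \<noteq> C \<times> C" by blast
    fix \<theta> assume \<theta>: "congruence ?A \<theta>"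
    have eqv: "equiv C \<theta>" using \<theta> by (simp add: congruence_def ops)
    have mult: "(max 0 (x + y - 1), max 0 (x' + y' - 1)) \<in> \<theta>"
      and imp: "(min 1 (1 - x + y), min 1 (1 - x' + y')) \<in> \<theta>" if "(x, x') \<in> \<theta>" "(y, y') \<in> \<theta>" for x x' y y'
      using \<theta> that unfolding congruence_def ops by blast+
    have refl: "(x, x) \<in> \<theta>" if "x \<in> C" for x using eqv that by (meson equiv_class_self equivE refl_onD)
    have sub: "\<theta> \<subseteq> C \<times> C" using eqv by (rule equiv_type)
    have sym: "(y, x) \<in> \<theta>" if "(x, y) \<in> \<theta>" for x y using eqv that by (meson equivE symD)
    have trans: "(x, z) \<in> \<theta>" if "(x, y) \<in> \<theta>" "(y, z) \<in> \<theta>" for x y z using eqv that by (meson equivE transD)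
    show "\<theta> = Id_on C \<or> \<theta> = C \<times> C"
    proof (cases "\<theta> \<subseteq> Id_on C")
      case True
      then show ?thesis using refl by (auto simp: Id_on_def)
    next
      case False
      then obtain x y where xy: "(x, y) \<in> \<theta>" "x < y"
        using sub sym by (metis Id_onI linorder_neqE_linordered_idom mem_Sigma_iff subrelI subsetD)
      then have xyC: "x \<in> C" "y \<in> C" using sub by auto
      define z where "z = 1 - y + x"
      have "(min 1 (1 - y + x), min 1 (1 - y + y)) \<in> \<theta>" by (rule imp[OF refl[OF xyC(2)] xy(1)])
      then have z: "(z, 1) \<in> \<theta>" "z < 1" using xy(2) by (simp_all add: z_def)
      have pow: "(max 0 (1 - real j * (1 - z)), 1) \<in> \<theta>" for j
      proof (induction j)
        case 0
        then show ?case using refl[OF C(3)] by simp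
      next
        case (Suc j)
        have "max 0 (max 0 (1 - real j * (1 - z)) + z - 1) = max 0 (1 - real (Suc j) * (1 - z))"
          using z(2) by (simp add: algebra_simps max_def)
        then show ?case using mult[OF Suc z(1)] by simp
      qed
      obtain j :: nat where "1 / (1 - z) \<le> real j" using real_arch_simple by blast
      then have "1 \<le> real j * (1 - z)" using z(2) by (simp add: field_simps)
      then have zero: "(0, 1) \<in> \<theta>" using pow[of j] by simp
      have "(0, w) \<in> \<theta>" if "w \<in> C" for w
        using mult[OF refl[OF that] zero] b[OF that] by simp
      then have "C \<times> C \<subseteq> \<theta>" using sym trans by blast
      then show ?thesis using sub by blast
    qed
  qed
qed

lemma MV_unit_props: "mv_algebra MV_unit" "is_chain MV_unit"
proof -
  have "MV_unit\<lparr>carrier := {0..1}\<rparr> = MV_unit" by (simp add: MV_unit_def)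
  moreover have "mv_algebra (MV_unit\<lparr>carrier := {0..1}\<rparr>)" "is_chain (MV_unit\<lparr>carrier := {0..1}\<rparr>)"
    by (intro unit_subalgebra; simp add: max_def min_def)+
  ultimately show "mv_algebra MV_unit" "is_chain MV_unit" by simp_all
qed

lemma Luk_carrier: "carrier (Luk (Suc n)) = {real i / real n | i. i \<le> n}"
  by (simp add: Luk_def)

lemma Luk_ops [simp]:
  "x \<curlywedge>\<^bsub>Luk k\<^esub> y = min x y" "x \<curlyvee>\<^bsub>Luk k\<^esub> y = max x y" "x \<otimes>\<^bsub>Luk k\<^esub> y = max 0 (x + y - 1)"
  "x \<leadsto>\<^bsub>Luk k\<^esub> y = min 1 (1 - x + y)" "\<one>\<^bsub>Luk k\<^esub> = 1" "\<zero>\<^bsub>Luk k\<^esub> = 0"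
  by (simp_all add: Luk_def MV_unit_def)

text \<open>The parameter \<open>n\<close> is the common denominator, so the chain has
  \<open>n + 1\<close> elements. Rationality allows all these chains to be moved into another type
  by one injection of a countable set.\<close>

lemma Luk_props:
  assumes "1 \<le> n"
  shows "mv_algebra (Luk (Suc n))" "is_chain (Luk (Suc n))" "simple_algebra (Luk (Suc n))"
    "finite (carrier (Luk (Suc n)))" "carrier (Luk (Suc n)) \<subseteq> {0..1}" "carrier (Luk (Suc n)) \<subseteq> \<rat>"
proof -
  let ?C = "{real i / real n | i. i \<le> n}"
  have n: "0 < real n" using assms by simp
  have C: "?C \<subseteq> {0..1}" using n by auto
  have "0 = real 0 / real n" "1 = real n / real n" using n by simp_all
  then have in01: "0 \<in> ?C" "1 \<in> ?C" by blast+
  have mult: "max 0 (x + y - 1) \<in> ?C" if xy: "x \<in> ?C" "y \<in> ?C" for x y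
  proof -
    obtain i j where ij: "x = real i / real n" "y = real j / real n" "i \<le> n" "j \<le> n" using xy by blast
    have "max 0 (x + y - 1) = real (i + j - n) / real n"
    proof (cases "n \<le> i + j")
      case True
      then have "real n \<le> real i + real j" by linarith
      then show ?thesis using n True by (simp add: ij of_nat_diff field_simps)
    next
      case False
      then have "real i + real j < real n" by linarith
      then show ?thesis using n False by (simp add: ij field_simps)
    qed
    moreover have "i + j - n \<le> n" using ij by simp
    ultimately show ?thesis by blast
  qed
  have imp: "min 1 (1 - x + y) \<in> ?C" if xy: "x \<in> ?C" "y \<in> ?C" for x y
  proof -
    obtain i j where ij: "x = real i / real n" "y = real j / real n" "i \<le> n" "j \<le> n" using xy by blast
    have "min 1 (1 - x + y) = real (min n (n - i + j)) / real n"
    proof -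
      have "1 - x + y = real (n - i + j) / real n" using n ij(3) by (simp add: ij(1,2) of_nat_diff field_simps)
      moreover have "min 1 (real k / real n) = real (min n k) / real n" for k
        using n by (simp add: min_def divide_simps)
      ultimately show ?thesis by (simp only:)
    qed
    moreover have "min n (n - i + j) \<le> n" by simp
    ultimately show ?thesis by blast
  qed
  have eq: "Luk (Suc n) = MV_unit\<lparr>carrier := ?C\<rparr>" by (simp add: Luk_def)
  show "mv_algebra (Luk (Suc n))" "is_chain (Luk (Suc n))" "simple_algebra (Luk (Suc n))"
    unfolding eq using unit_subalgebra[OF C in01 mult imp] by simp_all
  have "?C = (\<lambda>i. real i / real n) ` {..n}" by auto
  then show "finite (carrier (Luk (Suc n)))" by (simp add: Luk_carrier)
  show "carrier (Luk (Suc n)) \<subseteq> {0..1}" using C by (simp add: Luk_carrier)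
  show "carrier (Luk (Suc n)) \<subseteq> \<rat>" by (auto simp: Luk_carrier)
qed

text \<open>An element other than 1 loses at least \<open>1 / n\<close>, so its powers from
  \<open>n\<close> on are 0.\<close>

lemma Luk_potent:
  assumes "1 \<le> n" "n \<le> k" "x \<in> carrier (Luk (Suc n))"
  shows "x [^]\<^bsub>Luk (Suc n)\<^esub> (k + 1) = x [^]\<^bsub>Luk (Suc n)\<^esub> k"
proof -
  obtain i where i: "x = real i / real n" "i \<le> n" using assms(3) by (auto simp: Luk_carrier)
  have n: "0 < real n" using assms(1) by simp
  have x1: "x \<le> 1" using i n by simp
  have pow: "x [^]\<^bsub>Luk (Suc n)\<^esub> j = max 0 (1 - real j * (1 - x))" for j
  proof (induction j)
    case 0
    then show ?case by (simp add: nat_pow_def)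
  next
    case (Suc j)
    have "x [^]\<^bsub>Luk (Suc n)\<^esub> Suc j = max 0 (x [^]\<^bsub>Luk (Suc n)\<^esub> j + x - 1)" by (simp add: nat_pow_def)
    also have "\<dots> = max 0 (1 - real (Suc j) * (1 - x))"
      unfolding Suc using x1 by (simp add: algebra_simps max_def)
    finally show ?case .
  qed
  show ?thesis
  proof (cases "i = n")
    case True
    then have "x = 1" using i n by simp
    then show ?thesis unfolding pow by simp
  next
    case False
    then have "real i + 1 \<le> real n" using i(2) by linarith
    moreover have "real n * x = real i" using n by (simp add: i(1))
    ultimately have "1 \<le> real n * (1 - x)" by (simp add: right_diff_distrib)
    also have "\<dots> \<le> real k * (1 - x)" using assms(2) x1 by (intro mult_right_mono) simp_all
    finally have "1 \<le> real k * (1 - x)" .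
    moreover have "real k * (1 - x) \<le> real (k + 1) * (1 - x)" using x1 by (intro mult_right_mono) simp_all
    ultimately show ?thesis unfolding pow by simp
  qed
qed

section \<open>Copies of the finite chains in an arbitrary type\<close>

lemma simple_image_alg:
  assumes A: "simple_algebra A" "ops_closed A (carrier A)" and inj: "inj_on g (carrier A)"
  shows "simple_algebra (image_alg g (carrier A) A)"
proof -
  let ?C = "carrier A" and ?B = "image_alg g (carrier A) A"
  note ops = image_alg_ops[OF compatible_inj[OF inj]]
  have cl: "x \<curlywedge>\<^bsub>A\<^esub> y \<in> ?C \<and> x \<curlyvee>\<^bsub>A\<^esub> y \<in> ?C \<and> x \<otimes>\<^bsub>A\<^esub> y \<in> ?C \<and> x \<leadsto>\<^bsub>A\<^esub> y \<in> ?C" if "x \<in> ?C" "y \<in> ?C" for x y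
    using A(2) that by (simp add: ops_closed_def)
  show ?thesis
    unfolding simple_algebra_def image_alg_simps
  proof (intro conjI allI impI)
    have "Id_on ?C \<noteq> ?C \<times> ?C" using A(1) by (simp add: simple_algebra_def)
    then obtain x y where "x \<in> ?C" "y \<in> ?C" "x \<noteq> y" by (auto simp: Id_on_iff)
    then have "(g x, g y) \<in> g ` ?C \<times> g ` ?C - Id_on (g ` ?C)" using inj by (auto simp: inj_on_eq_iff)
    then show "Id_on (g ` ?C) \<noteq> g ` ?C \<times> g ` ?C" by blast
    fix \<theta> assume \<theta>: "congruence ?B \<theta>"
    define \<theta>' where "\<theta>' = {(x, y) \<in> ?C \<times> ?C. (g x, g y) \<in> \<theta>}"
    have eqv: "equiv (g ` ?C) \<theta>" using \<theta> by (simp add: congruence_def)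
    have "equiv ?C \<theta>'"
    proof (rule equivI)
      show "\<theta>' \<subseteq> ?C \<times> ?C" by (auto simp: \<theta>'_def)
      show "refl_on ?C \<theta>'" using eqv by (auto simp: \<theta>'_def refl_on_def equiv_def)
      show "sym \<theta>'" using eqv by (auto simp: \<theta>'_def sym_def equiv_def)
      show "trans \<theta>'" using eqv unfolding \<theta>'_def trans_def equiv_def by blast
    qed
    moreover have "(x \<curlywedge>\<^bsub>A\<^esub> y, x' \<curlywedge>\<^bsub>A\<^esub> y') \<in> \<theta>' \<and> (x \<curlyvee>\<^bsub>A\<^esub> y, x' \<curlyvee>\<^bsub>A\<^esub> y') \<in> \<theta>' \<and>
      (x \<otimes>\<^bsub>A\<^esub> y, x' \<otimes>\<^bsub>A\<^esub> y') \<in> \<theta>' \<and> (x \<leadsto>\<^bsub>A\<^esub> y, x' \<leadsto>\<^bsub>A\<^esub> y') \<in> \<theta>'"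
      if "(x, x') \<in> \<theta>'" "(y, y') \<in> \<theta>'" for x x' y y'
    proof -
      have C: "x \<in> ?C" "x' \<in> ?C" "y \<in> ?C" "y' \<in> ?C" and g: "(g x, g x') \<in> \<theta>" "(g y, g y') \<in> \<theta>"
        using that by (auto simp: \<theta>'_def)
      have "(g x \<curlywedge>\<^bsub>?B\<^esub> g y, g x' \<curlywedge>\<^bsub>?B\<^esub> g y') \<in> \<theta> \<and> (g x \<curlyvee>\<^bsub>?B\<^esub> g y, g x' \<curlyvee>\<^bsub>?B\<^esub> g y') \<in> \<theta> \<and>
        (g x \<otimes>\<^bsub>?B\<^esub> g y, g x' \<otimes>\<^bsub>?B\<^esub> g y') \<in> \<theta> \<and> (g x \<leadsto>\<^bsub>?B\<^esub> g y, g x' \<leadsto>\<^bsub>?B\<^esub> g y') \<in> \<theta>"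
        using \<theta> g unfolding congruence_def by blast
      then show ?thesis using C cl by (simp add: ops \<theta>'_def)
    qed
    ultimately have "congruence A \<theta>'" unfolding congruence_def by auto
    then have "\<theta>' = Id_on ?C \<or> \<theta>' = ?C \<times> ?C" using A(1) by (simp add: simple_algebra_def)
    moreover have "\<theta> = map_prod g g ` \<theta>'"
    proof
      show "\<theta> \<subseteq> map_prod g g ` \<theta>'"
      proof (rule subrelI)
        fix a b assume ab: "(a, b) \<in> \<theta>"
        then have "a \<in> g ` ?C" "b \<in> g ` ?C" using equiv_type[OF eqv] by auto
        then obtain x y where "x \<in> ?C" "y \<in> ?C" "a = g x" "b = g y" by blast
        then show "(a, b) \<in> map_prod g g ` \<theta>'" using ab by (auto simp: \<theta>'_def intro!: image_eqI[of _ _ "(x, y)"])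
      qed
    qed (auto simp: \<theta>'_def)
    ultimately show "\<theta> = Id_on (g ` ?C) \<or> \<theta> = g ` ?C \<times> g ` ?C"
      by (auto simp: Id_on_def image_iff map_prod_def)
  qed
qed

lemma Luk_copy:
  assumes "1 \<le> n" and inj: "inj_on g (carrier (Luk (Suc n)))"
  defines "B \<equiv> image_alg g (carrier (Luk (Suc n))) (Luk (Suc n))"
  shows "B \<in> finite_simple_MV_chains" and "n \<le> k \<Longrightarrow> B \<in> potent k finite_simple_MV_chains"
proof -
  let ?L = "Luk (Suc n)"
  interpret mv_algebra ?L by (rule Luk_props(1)[OF assms(1)])
  have cl: "ops_closed ?L (carrier ?L)" by (rule ops_closed_carrier) (rule residuated_lattice_axioms)
  have mod: "B \<in> models E" if "?L \<in> models E" for E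
    unfolding B_def using that cl inj by (intro image_alg_models compatible_inj) auto
  have "mv_algebra B"
    using mod[of "insert involution_eq (insert prelinearity_eq gbl_eqs)"] mv_algebra_axioms
    unfolding MV_eq[symmetric] by simp
  moreover have "is_chain B"
    unfolding is_chain_def rle_def B_def image_alg_simps
    using image_alg_ops(1)[OF compatible_inj[OF inj]] by (auto simp: min_def)
  moreover have "finite (carrier B)" using Luk_props(4)[OF assms(1)] by (simp add: B_def)
  moreover have "simple_algebra B"
    unfolding B_def by (rule simple_image_alg[OF Luk_props(3)[OF assms(1)] cl inj])
  ultimately show B: "B \<in> finite_simple_MV_chains" by (simp add: finite_simple_MV_chains_def)
  assume "n \<le> k"
  then have "satisfies ?L (potency_eq k)" using Luk_potent[OF assms(1)] by (simp only: satisfies_potency) blast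
  then have "?L \<in> models {potency_eq k}" using cl by (simp add: models_def)
  then have "satisfies B (potency_eq k)" using mod by (auto simp: models_def)
  then show "B \<in> potent k finite_simple_MV_chains" using B by (simp only: satisfies_potency potent_def) blast
qed

section \<open>Countermodels\<close>

primrec subterms :: "trm \<Rightarrow> trm set" where
  "subterms (Var v) = {Var v}"
| "subterms Zero = {Zero}"
| "subterms One = {One}"
| "subterms (Meet s t) = insert (Meet s t) (subterms s \<union> subterms t)"
| "subterms (Join s t) = insert (Join s t) (subterms s \<union> subterms t)"
| "subterms (Mult s t) = insert (Mult s t) (subterms s \<union> subterms t)"
| "subterms (Imp s t) = insert (Imp s t) (subterms s \<union> subterms t)"

lemma finite_subterms [simp]: "finite (subterms t)"
  by (induction t) simp_all

lemma subterms_self [simp]: "t \<in> subterms t"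
  by (cases t) simp_all

text \<open>The points of a refuting system are filters \<open>Fl i\<close>, each maximal with respect to omitting some element,
  and \<open>Up i\<close> is the preimage of the top component of the quotient by \<open>Fl i\<close>; the order is
  \<open>i = j \<or> Up i \<subseteq> Fl j\<close>, so that an element of \<open>Up i\<close> takes value \<open>1\<close> at all points strictly above \<open>i\<close>.\<close>

definition refuting :: "'a rlat \<Rightarrow> 'a set \<Rightarrow> 'a \<Rightarrow> 'i set \<Rightarrow> ('i \<Rightarrow> 'a set) \<Rightarrow> ('i \<Rightarrow> 'a set) \<Rightarrow> bool" where
  "refuting A S a X Fl Up \<longleftrightarrow>
    (\<forall>i\<in>X. \<exists>c. vfilter A (Fl i) c \<and> Up i = vfilter.upper A (Fl i) c) \<and>
    (\<forall>i\<in>X. \<forall>b\<in>S. b \<notin> Up i \<longrightarrow> (\<exists>j\<in>X. Up i \<subseteq> Fl j \<and> b \<in> Up j \<and> b \<notin> Fl j)) \<and>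
    (\<exists>i\<in>X. a \<notin> Fl i)"

lemma gbl_frame_Luk:
  fixes G :: "('x, real) frame"
  assumes "partial_order_on (worlds G) (ord G)" "\<And>w. w \<in> worlds G \<Longrightarrow> \<exists>N\<ge>1. alg G w = Luk (Suc N)"
  shows "gbl_frame G"
proof (rule gbl_frame.intro)
  show "partial_order_on (worlds G) (ord G)" by (rule assms(1))
  show "gbl_algebra (alg G x)" if "x \<in> worlds G" for x
    using assms(2)[OF that] Luk_props(1) by (auto simp: mv_algebra_def bl_algebra_def)
qed

text \<open>A truth lemma: by induction over the subterms, the value at the point
  \<open>\<gamma> i\<close> is \<open>\<psi> i\<close> applied to the value in \<open>A\<close>. The
  map \<open>\<gamma>\<close> only renames the points into the required type, and the predicate
  \<open>P\<close> passes on a bound for the lengths of the chains.\<close>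

lemma refuting_frame:
  fixes \<gamma> :: "'i \<Rightarrow> 'x"
  assumes A: "gbl_algebra A" and h: "\<And>v. h v \<in> carrier A" and S: "S = eval A h ` subterms t"
    and ref: "refuting A S (eval A h t) X Fl Up" and \<gamma>: "inj_on \<gamma> X"
    and emb: "\<And>F c. vfilter A F c \<Longrightarrow> \<exists>N \<psi>. N \<ge> 1 \<and> P N \<and> local_emb A S F (vfilter.upper A F c) N \<psi>"
  shows "\<exists>G :: ('x, real) frame. worlds G = \<gamma> ` X \<and>
    ord G = {(\<gamma> i, \<gamma> j) | i j. i \<in> X \<and> j \<in> X \<and> (i = j \<or> Up i \<subseteq> Fl j)} \<and>
    partial_order_on (worlds G) (ord G) \<and>
    (\<forall>w\<in>worlds G. \<exists>N\<ge>1. P N \<and> alg G w = Luk (Suc N)) \<and> \<not> G \<tturnstile> t"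
proof -
  define R where "R = {(\<gamma> i, \<gamma> j) | i j. i \<in> X \<and> j \<in> X \<and> (i = j \<or> Up i \<subseteq> Fl j)}"
  have vf: "\<exists>c. vfilter A (Fl i) c \<and> Up i = vfilter.upper A (Fl i) c" if "i \<in> X" for i
    using ref that by (simp add: refuting_def)
  have sub: "Fl i \<subset> Up i" if "i \<in> X" for i
  proof -
    obtain c where c: "vfilter A (Fl i) c" "Up i = vfilter.upper A (Fl i) c" using vf[OF \<open>i \<in> X\<close>] by blast
    interpret vfilter A "Fl i" c by (rule c(1))
    show ?thesis using F_upper a_upper a_notin c(2) by blast
  qed
  have "\<exists>N \<psi>. N \<ge> 1 \<and> P N \<and> local_emb A S (Fl i) (Up i) N \<psi>" if "i \<in> X" for i
    using vf[OF that] emb by metis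
  then obtain N \<psi> where N: "\<And>i. i \<in> X \<Longrightarrow> N i \<ge> 1 \<and> P (N i)"
    and \<psi>: "\<And>i. i \<in> X \<Longrightarrow> local_emb A S (Fl i) (Up i) (N i) (\<psi> i)" by metis
  define \<rho> where "\<rho> = inv_into X \<gamma>"
  have \<rho>: "\<rho> (\<gamma> i) = i" if "i \<in> X" for i using that \<gamma> by (simp add: \<rho>_def)
  define G :: "('x, real) frame" where "G = \<lparr>worlds = \<gamma> ` X, ord = R, alg = \<lambda>w. Luk (Suc (N (\<rho> w)))\<rparr>"
  have po: "partial_order_on (\<gamma> ` X) R"
    unfolding partial_order_on_def preorder_on_def
  proof (intro conjI)
    show "R \<subseteq> \<gamma> ` X \<times> \<gamma> ` X" by (auto simp: R_def)
    show "refl_on (\<gamma> ` X) R" by (auto simp: R_def refl_on_def)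
    have Rcases: "\<exists>i j. i \<in> X \<and> j \<in> X \<and> p = \<gamma> i \<and> q = \<gamma> j \<and> (i = j \<or> Up i \<subseteq> Fl j)" if "(p, q) \<in> R" for p q
      using that by (auto simp: R_def)
    show "trans R"
    proof (rule transI)
      fix p q r assume "(p, q) \<in> R" "(q, r) \<in> R"
      then obtain i j j' k where *: "i \<in> X" "j \<in> X" "p = \<gamma> i" "q = \<gamma> j" "i = j \<or> Up i \<subseteq> Fl j"
        "j' \<in> X" "k \<in> X" "q = \<gamma> j'" "r = \<gamma> k" "j' = k \<or> Up j' \<subseteq> Fl k"
        using Rcases by metis
      then have "j' = j" using \<gamma> by (simp add: inj_on_eq_iff)
      then have "i = k \<or> Up i \<subseteq> Fl k" using * sub[of j] by blast
      then show "(p, r) \<in> R" using * by (auto simp: R_def)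
    qed
    show "antisym R"
    proof (rule antisymI)
      fix p q assume "(p, q) \<in> R" "(q, p) \<in> R"
      then obtain i j i' j' where *: "i \<in> X" "j \<in> X" "p = \<gamma> i" "q = \<gamma> j" "i = j \<or> Up i \<subseteq> Fl j"
        "j' \<in> X" "i' \<in> X" "q = \<gamma> j'" "p = \<gamma> i'" "j' = i' \<or> Up j' \<subseteq> Fl i'"
        using Rcases by metis
      then have "j' = j" "i' = i" using \<gamma> by (simp_all add: inj_on_eq_iff)
      then have "i = j" using * sub[of i] sub[of j] by blast
      then show "p = q" using * by simp
    qed
  qed
  have G: "gbl_frame G"
  proof (rule gbl_frame_Luk)
    show "partial_order_on (worlds G) (ord G)" using po by (simp add: G_def)
    fix w assume "w \<in> worlds G"
    then obtain i where "i \<in> X" "w = \<gamma> i" by (auto simp: G_def)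
    then show "\<exists>N\<ge>1. alg G w = Luk (Suc N)" using N \<rho> by (intro exI[of _ "N i"]) (simp add: G_def)
  qed
  interpret G: gbl_frame G by (rule G)
  interpret PG: gbl_algebra "poset_product G" by (rule G.pp_gbl)
  have wG: "worlds G = \<gamma> ` X" by (simp add: G_def)
  have aG: "alg G (\<gamma> i) = Luk (Suc (N i))" if "i \<in> X" for i using that \<rho> by (simp add: G_def)
  have up_iff: "\<gamma> j \<in> G.strict_up (\<gamma> i) \<longleftrightarrow> Up i \<subseteq> Fl j" if "i \<in> X" "j \<in> X" for i j
  proof -
    have "(\<gamma> i, \<gamma> j) \<in> R \<and> \<gamma> i \<noteq> \<gamma> j \<longleftrightarrow> (i = j \<or> Up i \<subseteq> Fl j) \<and> i \<noteq> j"
      using that \<gamma> by (auto simp: R_def inj_on_eq_iff)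
    \<comment> \<open>The inclusion excludes \<open>i = j\<close> because \<open>Fl i\<close> is a
      proper subset of \<open>Up i\<close>.\<close>
    also have "\<dots> \<longleftrightarrow> Up i \<subseteq> Fl j" using sub[OF that(1)] by blast
    finally show ?thesis using that by (simp add: G.strict_up_def wG) (simp add: G_def)
  qed
  have up_ball: "(\<forall>w\<in>G.strict_up (\<gamma> i). Q w) \<longleftrightarrow> (\<forall>j\<in>X. Up i \<subseteq> Fl j \<longrightarrow> Q (\<gamma> j))" if "i \<in> X" for i Q
  proof -
    have "w \<in> G.strict_up (\<gamma> i) \<longleftrightarrow> (\<exists>j\<in>X. w = \<gamma> j \<and> Up i \<subseteq> Fl j)" for w
      using up_iff[OF that] G.strict_up_world[of w "\<gamma> i"] unfolding wG by blast
    then have "G.strict_up (\<gamma> i) = \<gamma> ` {j \<in> X. Up i \<subseteq> Fl j}" by auto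
    then show ?thesis by simp blast
  qed
  have le: "local_emb A S (Fl i) (Up i) (N i) (\<psi> i)" if "i \<in> X" for i using \<psi>[OF that] .
  have \<psi>1: "\<psi> i b = 1 \<longleftrightarrow> b \<in> Fl i" if "i \<in> X" "b \<in> S" for i b
    using le[OF that(1)] that(2) by (simp add: local_emb_def)
  have \<psi>0: "\<psi> i b = 0" if "i \<in> X" "b \<in> S" "b \<notin> Up i" for i b
    using le[OF that(1)] that(2,3) by (simp add: local_emb_def)
  have \<psi>c: "\<psi> i b \<in> carrier (Luk (Suc (N i)))" if "i \<in> X" "b \<in> S" for i b
    using le[OF that(1)] that(2) by (auto simp: local_emb_def Luk_carrier)
  \<comment> \<open>A variable that does not occur in \<open>t\<close> may have a value outside
    \<open>S\<close>, where \<open>\<psi>\<close> is unconstrained; it receives the constant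
    1.\<close>
  define h' where "h' v = (if Var v \<in> subterms t then (\<lambda>w\<in>\<gamma> ` X. \<psi> (\<rho> w) (h v)) else \<one>\<^bsub>poset_product G\<^esub>)" for v
  have h': "h' v \<in> carrier (poset_product G)" for v
  proof (cases "Var v \<in> subterms t")
    case True
    then have hv: "h v \<in> S" using S by (metis eval.simps(1) imageI)
    have "h' v \<in> extensional (worlds G)" using True by (simp add: h'_def wG)
    moreover have "h' v (\<gamma> i) = \<psi> i (h v)" if "i \<in> X" for i using True that \<rho> by (simp add: h'_def)
    moreover have "\<forall>i\<in>X. \<psi> i (h v) = 0 \<or> (\<forall>j\<in>X. Up i \<subseteq> Fl j \<longrightarrow> \<psi> j (h v) = 1)"
      using \<psi>0[OF _ hv] \<psi>1[OF _ hv] by blast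
    ultimately show ?thesis
      unfolding G.pp_carrier G.Box_def using \<psi>c hv by (simp add: wG aG up_ball)
  next
    case False
    then show ?thesis by (simp add: h'_def)
  qed
  have closed: "ops_closed (poset_product G) (carrier (poset_product G))"
    by (rule ops_closed_carrier) (rule PG.residuated_lattice_axioms)
  have ev_c: "eval (poset_product G) h' s \<in> carrier (poset_product G)" for s
    by (rule eval_closed[OF closed h'])
  have gw: "\<gamma> i \<in> worlds G" if "i \<in> X" for i using that by (simp add: wG)
  have ev: "\<forall>i\<in>X. eval (poset_product G) h' s (\<gamma> i) = \<psi> i (eval A h s)" if "subterms s \<subseteq> subterms t" for s
    using that
  proof (induction s)
    case (Var v)
    then show ?case using \<rho> by (simp add: h'_def)
  next
    case Zero
    then have "\<zero>\<^bsub>A\<^esub> \<in> S" using S by (metis eval.simps(2) imageI insert_subset subterms.simps(2))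
    then show ?case using le gw by (simp add: G.pp_simps aG local_emb_def)
  next
    case One
    then have "\<one>\<^bsub>A\<^esub> \<in> S" using S by (metis eval.simps(3) imageI insert_subset subterms.simps(3))
    moreover have "\<one>\<^bsub>A\<^esub> \<in> Fl i" if "i \<in> X" for i
      using vf[OF that] dfilter.one_F by (auto simp: vfilter_def)
    ultimately show ?case using \<psi>1 gw by (simp add: G.pp_simps aG)
  next
    case (Meet s r)
    have "eval A h s \<in> S" "eval A h r \<in> S" "eval A h s \<curlywedge>\<^bsub>A\<^esub> eval A h r \<in> S"
      using Meet.prems subterms_self[of s] subterms_self[of r] unfolding S
      by (auto intro!: imageI simp flip: eval.simps)
    then show ?case using Meet le gw
      by (simp add: G.pp_meet[OF _ ev_c ev_c] aG local_emb_def)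
  next
    case (Join s r)
    have "eval A h s \<in> S" "eval A h r \<in> S" "eval A h s \<curlyvee>\<^bsub>A\<^esub> eval A h r \<in> S"
      using Join.prems subterms_self[of s] subterms_self[of r] unfolding S
      by (auto intro!: imageI simp flip: eval.simps)
    then show ?case using Join le gw by (simp add: G.pp_simps aG local_emb_def)
  next
    case (Mult s r)
    have "eval A h s \<in> S" "eval A h r \<in> S" "eval A h s \<otimes>\<^bsub>A\<^esub> eval A h r \<in> S"
      using Mult.prems subterms_self[of s] subterms_self[of r] unfolding S
      by (auto intro!: imageI simp flip: eval.simps)
    then show ?case using Mult le gw by (simp add: G.pp_simps aG local_emb_def)
  next
    case (Imp s r)
    let ?b = "eval A h s" and ?c = "eval A h r"
    have mem: "?b \<in> S" "?c \<in> S" "?b \<leadsto>\<^bsub>A\<^esub> ?c \<in> S"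
      using Imp.prems subterms_self[of s] subterms_self[of r] unfolding S
      by (auto intro!: imageI simp flip: eval.simps)
    have IH: "eval (poset_product G) h' s (\<gamma> i) = \<psi> i ?b" "eval (poset_product G) h' r (\<gamma> i) = \<psi> i ?c" if "i \<in> X" for i
      using Imp that by simp_all
    have imp: "\<psi> i (?b \<leadsto>\<^bsub>A\<^esub> ?c) = min 1 (1 - \<psi> i ?b + \<psi> i ?c)" if "i \<in> X" "?b \<leadsto>\<^bsub>A\<^esub> ?c \<in> Up i" for i
      using le[OF that(1)] that(2) mem unfolding local_emb_def by blast
    show ?case
    proof
      fix i assume i: "i \<in> X"
      have val: "eval (poset_product G) h' (Imp s r) (\<gamma> i) =
        (if \<forall>j\<in>X. Up i \<subseteq> Fl j \<longrightarrow> min 1 (1 - \<psi> j ?b + \<psi> j ?c) = 1 then min 1 (1 - \<psi> i ?b + \<psi> i ?c) else 0)"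
        using i gw by (simp add: G.pp_simps(5) up_ball aG IH) blast
      show "eval (poset_product G) h' (Imp s r) (\<gamma> i) = \<psi> i (eval A h (Imp s r))"
      \<comment> \<open>Inside \<open>Up i\<close> the implication belongs to \<open>Fl j\<close>
        for every higher \<open>j\<close>, so the box does nothing. Outside \<open>Up i\<close> its
        value has to be 0, and the refuting condition supplies a higher point where it is not 1, so
        the box resets it.\<close>
      proof (cases "?b \<leadsto>\<^bsub>A\<^esub> ?c \<in> Up i")
        case True
        have "min 1 (1 - \<psi> j ?b + \<psi> j ?c) = 1" if j: "j \<in> X" "Up i \<subseteq> Fl j" for j
        proof -
          have "?b \<leadsto>\<^bsub>A\<^esub> ?c \<in> Fl j" using True j by blast
          then show ?thesis using imp[OF j(1)] \<psi>1[OF j(1) mem(3)] sub[OF j(1)] by auto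
        qed
        then show ?thesis using val imp[OF i True] by simp
      next
        case False
        then obtain j where j: "j \<in> X" "Up i \<subseteq> Fl j" "?b \<leadsto>\<^bsub>A\<^esub> ?c \<in> Up j" "?b \<leadsto>\<^bsub>A\<^esub> ?c \<notin> Fl j"
          using ref i mem(3) unfolding refuting_def by blast
        then have "min 1 (1 - \<psi> j ?b + \<psi> j ?c) \<noteq> 1" using imp[OF j(1,3)] \<psi>1[OF j(1) mem(3)] by auto
        then show ?thesis using val j(1,2) \<psi>0[OF i mem(3) False] by auto
      qed
    qed
  qed
  obtain i where i: "i \<in> X" "eval A h t \<notin> Fl i" using ref by (auto simp: refuting_def)
  have "eval (poset_product G) h' t (\<gamma> i) \<noteq> 1" using ev[of t] \<psi>1[OF i(1), of "eval A h t"] i S by auto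
  then have "eval (poset_product G) h' t (\<gamma> i) \<noteq> \<one>\<^bsub>alg G (\<gamma> i)\<^esub>" using aG[OF i(1)] by simp
  then have "\<not> G \<tturnstile> t" unfolding forces_def using h' gw[OF i(1)] by blast
  moreover have "\<exists>N\<ge>1. P N \<and> alg G w = Luk (Suc N)" if "w \<in> worlds G" for w
    using that N aG unfolding wG by blast
  ultimately show ?thesis
    using po by (intro exI[of _ G]) (simp add: G_def R_def)
qed

text \<open>A point is the list of the elements omitted one after another, the latest first. Such
  lists over the finite set \<open>S\<close> are countable, even where the filters of
  \<open>A\<close> are not. Distinct lists may carry the same filter; they are then incomparable
  points.\<close>

lemma refuting_countable:
  fixes A :: "'a rlat"
  assumes A: "gbl_algebra A" and S: "finite S" "S \<subseteq> carrier A" and a: "a \<in> S" "a \<noteq> \<one>\<^bsub>A\<^esub>"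
  shows "\<exists>(X :: 'a list set) Fl Up. countable X \<and> refuting A S a X Fl Up"
proof -
  interpret gbl_algebra A by (rule A)
  define next_filter where "next_filter U b = (SOME F. vfilter A F b \<and> U \<subseteq> F)" for U b
  \<comment> \<open>The empty list carries the filter \<open>{\<one>}\<close>, from which the
    extensions start. It need not be maximal with respect to omitting any element and is excluded
    from \<open>X\<close>.\<close>
  define fw :: "'a list \<Rightarrow> 'a set \<times> 'a set" where
    "fw = rec_list ({\<one>\<^bsub>A\<^esub>}, {\<one>\<^bsub>A\<^esub>}) (\<lambda>b l p. (next_filter (snd p) b, vfilter.upper A (next_filter (snd p) b) b))"
  define valid where "valid = rec_list True (\<lambda>b l p. p \<and> b \<in> S \<and> b \<notin> snd (fw l))"
  have fw: "fw [] = ({\<one>\<^bsub>A\<^esub>}, {\<one>\<^bsub>A\<^esub>})"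
    "fw (b # l) = (next_filter (snd (fw l)) b, vfilter.upper A (next_filter (snd (fw l)) b) b)" for b l
    by (simp_all add: fw_def)
  have valid: "valid []" "valid (b # l) \<longleftrightarrow> valid l \<and> b \<in> S \<and> b \<notin> snd (fw l)" for b l
    by (simp_all add: valid_def)
  have step: "vfilter A (fst (fw (b # l))) b \<and> snd (fw l) \<subseteq> fst (fw (b # l))"
    if "dfilter A (snd (fw l))" "b \<in> S" "b \<notin> snd (fw l)" for b l
    unfolding fw fst_conv next_filter_def
    by (rule someI_ex) (use vfilter_exists[OF that(1) _ that(3)] that(2) S(2) in blast)
  have triv: "dfilter A {\<one>\<^bsub>A\<^esub>}" by unfold_locales auto
  have dU: "dfilter A (snd (fw l))" if "valid l" for l
    using that
  proof (induction l)
    case Nil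
    then show ?case using triv by (simp add: fw)
  next
    case (Cons b l)
    then have "vfilter A (fst (fw (b # l))) b" using step valid by blast
    then show ?case using vfilter.upper_dfilter by (simp add: fw)
  qed
  define X where "X = {l. valid l \<and> l \<noteq> []}"
  have "set l \<subseteq> S" if "valid l" for l using that by (induction l) (auto simp: valid)
  then have "X \<subseteq> lists S" by (auto simp: X_def)
  then have "countable X" using S(1) by (meson countable_finite countable_lists countable_subset)
  have ext: "b # l \<in> X \<and> snd (fw l) \<subseteq> fst (fw (b # l)) \<and> b \<in> snd (fw (b # l)) \<and> b \<notin> fst (fw (b # l))"
    if "valid l" "b \<in> S" "b \<notin> snd (fw l)" for b l
  proof -
    have v: "vfilter A (fst (fw (b # l))) b" "snd (fw l) \<subseteq> fst (fw (b # l))" using step dU that by blast+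
    interpret vfilter A "fst (fw (b # l))" b by (rule v(1))
    show ?thesis using v(2) a_upper a_notin that valid by (simp add: X_def) (simp add: fw)
  qed
  have "refuting A S a X (\<lambda>l. fst (fw l)) (\<lambda>l. snd (fw l))"
    unfolding refuting_def
  proof (intro conjI ballI impI)
    fix l assume l: "l \<in> X"
    then obtain b l' where bl: "l = b # l'" "valid l'" "b \<in> S" "b \<notin> snd (fw l')"
      by (cases l) (auto simp: X_def valid)
    then have "vfilter A (fst (fw l)) b" using step dU by blast
    then show "\<exists>c. vfilter A (fst (fw l)) c \<and> snd (fw l) = vfilter.upper A (fst (fw l)) c"
      using bl(1) by (auto simp: fw)
    fix b assume "b \<in> S" "b \<notin> snd (fw l)"
    then show "\<exists>j\<in>X. snd (fw l) \<subseteq> fst (fw j) \<and> b \<in> snd (fw j) \<and> b \<notin> fst (fw j)"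
      using ext[of l b] l unfolding X_def by blast
  next
    have "a # [] \<in> X \<and> a \<notin> fst (fw (a # []))" using ext[of "[]" a] a valid by (simp add: fw)
    then show "\<exists>i\<in>X. a \<notin> fst (fw i)" by blast
  qed
  with \<open>countable X\<close> show ?thesis by blast
qed

text \<open>By prelinearity the quotient by \<open>F0\<close> decides between the two implications
  of any pair, so the filters above \<open>F0\<close> form a chain and \<open>Fl b\<close> is the
  largest of them omitting \<open>b\<close>. Points are named by the elements they omit. The walk
  starts at \<open>F0\<close> and moves from \<open>b\<close> to the smallest \<open>Fl c\<close>
  with \<open>c\<close> in \<open>S\<close> but not in \<open>Up b\<close>, so no element still to
  be refuted is skipped.\<close>

lemma refuting_chain:
  fixes A :: "'a rlat"
  assumes A: "bl_algebra A" and S: "finite S" "S \<subseteq> carrier A" and a: "a \<in> S" "a \<noteq> \<one>\<^bsub>A\<^esub>"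
  shows "\<exists>(X :: 'a set) Fl Up. finite X \<and> refuting A S a X Fl Up \<and>
    (\<forall>i\<in>X. \<forall>j\<in>X. i = j \<or> Up i \<subseteq> Fl j \<or> Up j \<subseteq> Fl i)"
proof -
  interpret bl_algebra A by (rule A)
  have aC: "a \<in> carrier A" using a(1) S(2) by blast
  have "dfilter A {\<one>\<^bsub>A\<^esub>}" by unfold_locales auto
  then obtain F0 where F0: "vfilter A F0 a" using vfilter_exists[of A "{\<one>\<^bsub>A\<^esub>}" a] aC a(2) by auto
  interpret F0: vfilter A F0 a by (rule F0)
  have prime: "x \<leadsto>\<^bsub>A\<^esub> y \<in> F0 \<or> y \<leadsto>\<^bsub>A\<^esub> x \<in> F0" if xy: "x \<in> carrier A" "y \<in> carrier A" for x y
  proof -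
    interpret Q: si_gbl F0.quot "F0.cls a" by (rule F0.si_gbl_quot)
    have "F0.cls (x \<leadsto>\<^bsub>A\<^esub> y) \<curlyvee>\<^bsub>F0.quot\<^esub> F0.cls (y \<leadsto>\<^bsub>A\<^esub> x) = \<one>\<^bsub>F0.quot\<^esub>"
      using xy prelinearity[OF xy] by (simp add: F0.quot_ops)
    then have "F0.cls (x \<leadsto>\<^bsub>A\<^esub> y) = \<one>\<^bsub>F0.quot\<^esub> \<or> F0.cls (y \<leadsto>\<^bsub>A\<^esub> x) = \<one>\<^bsub>F0.quot\<^esub>"
      by (rule Q.join_eq_one) (simp_all add: xy)
    then show ?thesis using xy by (simp add: F0.cls_one_iff)
  qed
  have comparable: "G \<subseteq> H \<or> H \<subseteq> G" if GH: "dfilter A G" "dfilter A H" "F0 \<subseteq> G" "F0 \<subseteq> H" for G H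
  proof (rule ccontr)
    assume "\<not> ?thesis"
    then obtain x y where xy: "x \<in> G" "x \<notin> H" "y \<in> H" "y \<notin> G" by blast
    have C: "x \<in> carrier A" "y \<in> carrier A"
      using dfilter.F_closed[OF GH(1) xy(1)] dfilter.F_closed[OF GH(2) xy(3)] .
    from prime[OF C] show False
    proof
      assume "x \<leadsto>\<^bsub>A\<^esub> y \<in> F0"
      then show False using dfilter.F_mp[OF GH(1), of x y] GH(3) xy C by blast
    next
      assume "y \<leadsto>\<^bsub>A\<^esub> x \<in> F0"
      then show False using dfilter.F_mp[OF GH(2), of y x] GH(4) xy C by blast
    qed
  qed
  have "\<exists>F. vfilter A F b \<and> F0 \<subseteq> F" if "b \<in> S" "b \<notin> F0" for b
    using vfilter_exists[OF F0.dfilter_axioms] that S(2) by blast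
  then obtain f where f: "\<And>b. \<lbrakk>b \<in> S; b \<notin> F0\<rbrakk> \<Longrightarrow> vfilter A (f b) b \<and> F0 \<subseteq> f b" by metis
  define Fl where "Fl b = (if b = a then F0 else f b)" for b
  define Up where "Up b = vfilter.upper A (Fl b) b" for b
  define Y where "Y = S - F0"
  have Fl: "vfilter A (Fl b) b" "F0 \<subseteq> Fl b" if "b \<in> Y" for b
    using that f F0 by (auto simp: Fl_def Y_def)
  have sub: "Fl b \<subseteq> Up b" "b \<in> Up b" "b \<notin> Fl b" "dfilter A (Up b)" "dfilter A (Fl b)" if "b \<in> Y" for b
  proof -
    interpret vfilter A "Fl b" b by (rule Fl(1)[OF that])
    show "Fl b \<subseteq> Up b" "b \<in> Up b" "b \<notin> Fl b" "dfilter A (Up b)" "dfilter A (Fl b)"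
      using F_upper a_upper a_notin upper_dfilter dfilter_axioms by (simp_all add: Up_def)
  qed
  have largest: "G \<subseteq> Fl b" if G: "dfilter A G" "F0 \<subseteq> G" "b \<notin> G" "b \<in> Y" for G b
  proof (rule ccontr)
    assume n: "\<not> G \<subseteq> Fl b"
    interpret vfilter A "Fl b" b by (rule Fl(1)[OF G(4)])
    have "Fl b \<subseteq> G" using comparable[OF G(1) sub(5)[OF G(4)] G(2) Fl(2)[OF G(4)]] n by blast
    obtain x where x: "x \<in> G" "x \<notin> Fl b" using n by blast
    have xC: "x \<in> carrier A" using dfilter.F_closed[OF G(1) x(1)] .
    obtain n :: nat where "x [^]\<^bsub>A\<^esub> n \<leadsto>\<^bsub>A\<^esub> b \<in> Fl b" using maximal[OF xC x(2)] by blast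
    then have "x [^]\<^bsub>A\<^esub> n \<leadsto>\<^bsub>A\<^esub> b \<in> G" using \<open>Fl b \<subseteq> G\<close> by blast
    moreover have "x [^]\<^bsub>A\<^esub> n \<in> G" for n :: nat
      using x(1) dfilter.F_mult[OF G(1)] dfilter.one_F[OF G(1)] by (induction n) simp_all
    ultimately have "b \<in> G" using dfilter.F_mp[OF G(1)] a_carrier by blast
    with G(3) show False ..
  qed
  define rest where "rest b = S - Up b" for b
  have rest_Y: "rest b \<subseteq> Y" if "b \<in> Y" for b
    using Fl(2)[OF that] sub(1)[OF that] by (auto simp: rest_def Y_def)
  have Up_Fl: "Up b \<subseteq> Fl c" if "b \<in> Y" "c \<in> rest b" for b c
    using that rest_Y[OF that(1)] sub[OF that(1)] Fl(2)[OF that(1)] by (intro largest) (auto simp: rest_def)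
  have "\<exists>c\<in>rest b. \<forall>d\<in>rest b. Fl c \<subseteq> Fl d" if b: "b \<in> Y" "rest b \<noteq> {}" for b
  proof -
    have "finite (Fl ` rest b)" using S(1) by (simp add: rest_def)
    then obtain c where c: "c \<in> rest b" "\<And>d. d \<in> rest b \<Longrightarrow> Fl d \<subseteq> Fl c \<Longrightarrow> Fl d = Fl c"
      using b(2) finite_has_minimal[of "Fl ` rest b"] by auto
    have "Fl c \<subseteq> Fl d" if "d \<in> rest b" for d
      using comparable[OF sub(5) sub(5) Fl(2) Fl(2), of c d] c that rest_Y[OF b(1)] by blast
    with c(1) show ?thesis by blast
  qed
  then obtain m where m: "\<And>b. \<lbrakk>b \<in> Y; rest b \<noteq> {}\<rbrakk> \<Longrightarrow> m b \<in> rest b \<and> (\<forall>d\<in>rest b. Fl (m b) \<subseteq> Fl d)" by metis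
  \<comment> \<open>Once \<open>Up b\<close> contains all of \<open>S\<close>, the sequence stays
    constant.\<close>
  define nx where "nx b = (if rest b = {} then b else m b)" for b
  define s where "s n = (nx ^^ n) a" for n
  have s_Suc: "s (Suc n) = nx (s n)" for n by (simp add: s_def)
  have sY: "s n \<in> Y" for n
  proof (induction n)
    case 0
    then show ?case using a F0.a_notin by (simp add: s_def Y_def)
  next
    case (Suc n)
    then show ?case using m[OF Suc] rest_Y[OF Suc] by (auto simp: s_Suc nx_def)
  qed
  have s_next: "s (Suc n) = s n \<or> Up (s n) \<subseteq> Fl (s (Suc n))" for n
    using m[OF sY[of n]] Up_Fl[OF sY[of n]] by (auto simp: s_Suc nx_def)
  have s_lin: "i \<le> j \<Longrightarrow> s i = s j \<or> Up (s i) \<subseteq> Fl (s j)" for i j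
  proof (induction j)
    case (Suc j)
    show ?case
    proof (cases "i = Suc j")
      case False
      then have "s i = s j \<or> Up (s i) \<subseteq> Fl (s j)" using Suc by simp
      then show ?thesis using s_next[of j] sub(1)[OF sY[of j]] by auto
    qed simp
  qed simp
  define X where "X = range s"
  have "X \<subseteq> S" using sY by (auto simp: X_def Y_def)
  then have fin: "finite X" using S(1) finite_subset by blast
  have XY: "X \<subseteq> Y" using sY by (auto simp: X_def)
  have lin: "i = j \<or> Up i \<subseteq> Fl j \<or> Up j \<subseteq> Fl i" if ij: "i \<in> X" "j \<in> X" for i j
  proof -
    obtain n k where "i = s n" "j = s k" using ij by (auto simp: X_def)
    then show ?thesis using s_lin[of n k] s_lin[of k n] by (cases "n \<le> k") auto
  qed
  have succ: "\<exists>j\<in>X. Up i \<subseteq> Fl j \<and> b \<notin> Fl j" if i: "i \<in> X" and b: "b \<in> S" "b \<notin> Up i" for i b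
  proof -
    obtain n where n: "i = s n" using i by (auto simp: X_def)
    have r: "b \<in> rest i" using b by (simp add: rest_def)
    have iY: "i \<in> Y" using i XY by blast
    have j: "s (Suc n) = m i" using r n by (auto simp: s_Suc nx_def)
    have mi: "m i \<in> rest i" "Fl (m i) \<subseteq> Fl b" using m[OF iY] r by auto
    have "Up i \<subseteq> Fl (m i)" using Up_Fl[OF iY mi(1)] .
    moreover have "b \<notin> Fl (m i)" using mi(2) sub(3)[of b] rest_Y[OF iY] r by blast
    moreover have "m i \<in> X" using j by (metis X_def rangeI)
    ultimately show ?thesis by blast
  qed
  have "refuting A S a X Fl Up"
    unfolding refuting_def
  proof (intro conjI ballI impI)
    fix i assume i: "i \<in> X"
    then show "\<exists>c. vfilter A (Fl i) c \<and> Up i = vfilter.upper A (Fl i) c"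
      using Fl(1) XY by (auto simp: Up_def)
    fix b assume b: "b \<in> S" "b \<notin> Up i"
    \<comment> \<open>The element \<open>b\<close> is refuted at the last point of the chain that
      omits it. Were \<open>b\<close> still outside \<open>Up j\<close> there, a point with a
      strictly larger filter would omit it too.\<close>
    define Z where "Z = {j \<in> X. Up i \<subseteq> Fl j \<and> b \<notin> Fl j}"
    have "finite (Fl ` Z)" "Fl ` Z \<noteq> {}" using fin succ[OF i b] by (auto simp: Z_def)
    then obtain j where j: "j \<in> Z" "\<And>k. k \<in> Z \<Longrightarrow> Fl j \<subseteq> Fl k \<Longrightarrow> Fl k = Fl j"
      using finite_has_maximal[of "Fl ` Z"] by auto
    have jX: "j \<in> X" "Up i \<subseteq> Fl j" "b \<notin> Fl j" using j(1) by (auto simp: Z_def)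
    have jY: "j \<in> Y" using jX(1) XY by blast
    have "b \<in> Up j"
    proof (rule ccontr)
      assume "b \<notin> Up j"
      then obtain k where k: "k \<in> X" "Up j \<subseteq> Fl k" "b \<notin> Fl k" using succ[OF jX(1) b(1)] by blast
      then have "k \<in> Z" using jX(2) sub(1)[OF jY] by (auto simp: Z_def)
      then have "Fl k = Fl j" using j(2) k(2) sub(1)[OF jY] by blast
      then show False using k(2) sub(2,3)[OF jY] by blast
    qed
    then show "\<exists>j\<in>X. Up i \<subseteq> Fl j \<and> b \<in> Up j \<and> b \<notin> Fl j" using jX by blast
  next
    have "a \<in> X" unfolding X_def by (metis funpow_0 rangeI s_def)
    then show "\<exists>i\<in>X. a \<notin> Fl i" using F0.a_notin by (intro bexI[of _ a]) (simp_all add: Fl_def)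
  qed
  with fin lin show ?thesis by blast
qed

section \<open>Soundness and completeness\<close>

lemma frames_gbl_frame:
  assumes "F \<in> frames Q C" "Q \<subseteq> posets" "\<And>A. A \<in> C \<Longrightarrow> gbl_algebra A"
  shows "gbl_frame F"
  using assms by (intro gbl_frame.intro) (auto simp: frames_def is_frame_def)

lemma product_GBL:
  assumes "F \<in> frames Q C" "Q \<subseteq> posets" "\<And>A. A \<in> C \<Longrightarrow> gbl_algebra A"
  shows "poset_product F \<in> GBL"
  using gbl_frame.pp_gbl[OF frames_gbl_frame[OF assms]] by (simp add: GBL_def)

lemma root_systems_posets: "root_systems \<subseteq> posets"
  by (auto simp: root_systems_def posets_def)

lemma finite_chains_root_systems: "finite_chains \<subseteq> root_systems"
  by (auto simp: finite_chains_def root_systems_def linear_order_on_def total_on_def)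

lemma product_BL:
  assumes F: "F \<in> frames Q C" and Q: "Q \<subseteq> root_systems"
    and C: "\<And>A. A \<in> C \<Longrightarrow> gbl_algebra A" "\<And>A. A \<in> C \<Longrightarrow> is_chain A"
  shows "poset_product F \<in> BL"
proof -
  have QP: "Q \<subseteq> posets" using Q root_systems_posets by blast
  interpret gbl_frame F by (rule frames_gbl_frame[OF F QP C(1)])
  have "bl_algebra (poset_product F)"
  proof (rule pp_prelinear)
    fix x assume x: "x \<in> worlds F"
    have "(worlds F, ord F) \<in> root_systems" using F Q by (auto simp: frames_def)
    then show "total_on {y \<in> worlds F. (x, y) \<in> ord F} (ord F)" using x by (simp add: root_systems_def)
    show "is_chain (alg F x)" using F x C(2) by (simp add: frames_def)
  qed
  then show ?thesis by (simp add: BL_def)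
qed

lemma product_potent:
  assumes F: "F \<in> frames Q C" and Q: "Q \<subseteq> posets"
    and C: "\<And>A. A \<in> C \<Longrightarrow> gbl_algebra A" "\<And>A x. A \<in> C \<Longrightarrow> x \<in> carrier A \<Longrightarrow> x [^]\<^bsub>A\<^esub> (k + 1) = x [^]\<^bsub>A\<^esub> k"
    and V: "poset_product F \<in> V"
  shows "poset_product F \<in> potent k V"
proof -
  interpret gbl_frame F by (rule frames_gbl_frame[OF F Q C(1)])
  have "f [^]\<^bsub>poset_product F\<^esub> (k + 1) = f [^]\<^bsub>poset_product F\<^esub> k" if "f \<in> carrier (poset_product F)" for f
    by (rule pp_potent[OF C(2) that]) (use F in \<open>simp_all add: frames_def\<close>)
  then show ?thesis using V unfolding potent_def by blast
qed

lemma potent_one_iff: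
  assumes "gbl_algebra A" "x \<in> carrier A"
  shows "x [^]\<^bsub>A\<^esub> (1 + 1 :: nat) = x [^]\<^bsub>A\<^esub> (1 :: nat) \<longleftrightarrow> x \<otimes>\<^bsub>A\<^esub> x = x"
proof -
  interpret gbl_algebra A by (rule assms(1))
  show ?thesis using assms(2) by simp
qed

lemma HA_potent: "HA = potent 1 GBL"
  unfolding HA_def GBL_def potent_def heyting_algebra_def heyting_algebra_axioms_def mem_Collect_eq
  by (rule Collect_cong) (metis potent_one_iff)

lemma GA_potent: "GA = potent 1 BL"
  unfolding GA_def BL_def potent_def goedel_algebra_def goedel_algebra_axioms_def heyting_algebra_def
    heyting_algebra_axioms_def bl_algebra_def bl_algebra_axioms_def mem_Collect_eq
  by (rule Collect_cong) (metis potent_one_iff)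

lemma sound_GBL:
  assumes "Q \<subseteq> posets" "\<And>A. A \<in> C \<Longrightarrow> gbl_algebra A"
  shows "sound (frames Q C) (GBL :: 'a::infinite rlat set)"
  unfolding GBL_eq
  by (rule soundI) (use product_GBL[OF _ assms] in \<open>simp add: GBL_eq\<close>)

lemma sound_BL:
  assumes "Q \<subseteq> root_systems" "\<And>A. A \<in> C \<Longrightarrow> gbl_algebra A" "\<And>A. A \<in> C \<Longrightarrow> is_chain A"
  shows "sound (frames Q C) (BL :: 'a::infinite rlat set)"
  unfolding BL_eq
  by (rule soundI) (use product_BL[OF _ assms] in \<open>simp add: BL_eq\<close>)

lemma sound_potent_GBL:
  assumes "Q \<subseteq> posets" "\<And>A. A \<in> C \<Longrightarrow> gbl_algebra A"
    "\<And>A x. A \<in> C \<Longrightarrow> x \<in> carrier A \<Longrightarrow> x [^]\<^bsub>A\<^esub> (k + 1) = x [^]\<^bsub>A\<^esub> k"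
  shows "sound (frames Q C) (potent k GBL :: 'a::infinite rlat set)"
  unfolding GBL_eq potent_models
proof (rule soundI)
  fix F assume F: "F \<in> frames Q C"
  show "poset_product F \<in> models (insert (potency_eq k) gbl_eqs)"
    using product_potent[OF F assms product_GBL[OF F assms(1,2)]] by (simp only: GBL_eq potent_models)
qed

lemma sound_potent_BL:
  assumes "Q \<subseteq> root_systems" "\<And>A. A \<in> C \<Longrightarrow> gbl_algebra A" "\<And>A. A \<in> C \<Longrightarrow> is_chain A"
    "\<And>A x. A \<in> C \<Longrightarrow> x \<in> carrier A \<Longrightarrow> x [^]\<^bsub>A\<^esub> (k + 1) = x [^]\<^bsub>A\<^esub> k"
  shows "sound (frames Q C) (potent k BL :: 'a::infinite rlat set)"
  unfolding BL_eq potent_models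
proof (rule soundI)
  fix F assume F: "F \<in> frames Q C"
  have Q: "Q \<subseteq> posets" using assms(1) root_systems_posets by blast
  show "poset_product F \<in> models (insert (potency_eq k) (insert prelinearity_eq gbl_eqs))"
    using product_potent[OF F Q assms(2,4) product_BL[OF F assms(1-3)]] by (simp only: BL_eq potent_models)
qed

section \<open>Completeness: countermodels in the prescribed classes of frames\<close>

lemma completeI:
  assumes "\<And>A h t. \<lbrakk>A \<in> V; \<And>v. h v \<in> carrier A; eval A h t \<noteq> \<one>\<^bsub>A\<^esub>\<rbrakk> \<Longrightarrow> \<exists>F\<in>K. \<not> F \<tturnstile> t"
  shows "complete_for K V"
  using assms unfolding complete_for_def valid_one_def by blast

text \<open>The predicate \<open>P\<close> restricts the lengths of the chains: it is constantly
  true for GBL and BL, and \<open>N \<le> k\<close> for the \<open>k\<close>-potent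
  varieties.\<close>

definition Luk_frame :: "('x set \<times> 'x rel) set \<Rightarrow> (nat \<Rightarrow> bool) \<Rightarrow> ('x, real) frame \<Rightarrow> bool" where
  "Luk_frame Q P G \<longleftrightarrow> (worlds G, ord G) \<in> Q \<and> (\<forall>w\<in>worlds G. \<exists>N\<ge>1. P N \<and> alg G w = Luk (Suc N))"

lemma eval_subterms:
  assumes "gbl_algebra A" "\<And>v. h v \<in> carrier A"
  shows "eval A h ` subterms t \<subseteq> carrier A"
proof -
  interpret gbl_algebra A by (rule assms(1))
  have "ops_closed A (carrier A)" by (rule ops_closed_carrier) (rule residuated_lattice_axioms)
  then show ?thesis using eval_closed[of A "carrier A" h] assms(2) by auto
qed

lemma countermodel_GBL:
  fixes A :: "'a rlat"
  assumes A: "gbl_algebra A" and h: "\<And>v. h v \<in> carrier A" and t: "eval A h t \<noteq> \<one>\<^bsub>A\<^esub>"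
    and emb: "\<And>S F c. \<lbrakk>finite S; S \<subseteq> carrier A; vfilter A F c\<rbrakk> \<Longrightarrow>
      \<exists>N \<psi>. N \<ge> 1 \<and> P N \<and> local_emb A S F (vfilter.upper A F c) N \<psi>"
  shows "\<exists>G :: ('x::infinite, real) frame. Luk_frame posets P G \<and> \<not> G \<tturnstile> t"
proof -
  define S where "S = eval A h ` subterms t"
  have S: "finite S" "S \<subseteq> carrier A" "eval A h t \<in> S"
    using eval_subterms[OF A h] by (simp_all add: S_def)
  obtain X :: "'a list set" and Fl Up where X: "countable X" "refuting A S (eval A h t) X Fl Up"
    using refuting_countable[OF A S t] by blast
  obtain e :: "nat \<Rightarrow> 'x" where "inj e"
    using infinite_countable_subset[OF infinite_UNIV] by blast
  then have \<gamma>: "inj_on (e \<circ> to_nat_on X) X"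
    using X(1) by (meson comp_inj_on inj_on_subset inj_on_to_nat_on subset_UNIV)
  obtain G :: "('x, real) frame" where "partial_order_on (worlds G) (ord G)"
    "\<forall>w\<in>worlds G. \<exists>N\<ge>1. P N \<and> alg G w = Luk (Suc N)" "\<not> G \<tturnstile> t"
    using refuting_frame[OF A h S_def X(2) \<gamma> emb[OF S(1,2)]] by blast
  then show ?thesis by (auto simp: Luk_frame_def posets_def)
qed

text \<open>A finite chain is a root system, so this one countermodel serves every class of frames
  considered for BL and for its potent subvarieties.\<close>

lemma countermodel_BL:
  fixes A :: "'a rlat"
  assumes A: "bl_algebra A" and h: "\<And>v. h v \<in> carrier A" and t: "eval A h t \<noteq> \<one>\<^bsub>A\<^esub>"
    and emb: "\<And>S F c. \<lbrakk>finite S; S \<subseteq> carrier A; vfilter A F c\<rbrakk> \<Longrightarrow>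
      \<exists>N \<psi>. N \<ge> 1 \<and> P N \<and> local_emb A S F (vfilter.upper A F c) N \<psi>"
  shows "\<exists>G :: ('x::infinite, real) frame. Luk_frame finite_chains P G \<and> \<not> G \<tturnstile> t"
proof -
  have gA: "gbl_algebra A" using A by (simp add: bl_algebra_def)
  define S where "S = eval A h ` subterms t"
  have S: "finite S" "S \<subseteq> carrier A" "eval A h t \<in> S"
    using eval_subterms[OF gA h] by (simp_all add: S_def)
  obtain X :: "'a set" and Fl Up where X: "finite X" "refuting A S (eval A h t) X Fl Up"
    and lin: "\<And>i j. \<lbrakk>i \<in> X; j \<in> X\<rbrakk> \<Longrightarrow> i = j \<or> Up i \<subseteq> Fl j \<or> Up j \<subseteq> Fl i"
    using refuting_chain[OF A S t] by blast
  obtain e :: "nat \<Rightarrow> 'x" where "inj e"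
    using infinite_countable_subset[OF infinite_UNIV] by blast
  then have \<gamma>: "inj_on (e \<circ> to_nat_on X) X"
    using X(1) by (meson comp_inj_on countable_finite inj_on_subset inj_on_to_nat_on subset_UNIV)
  obtain G :: "('x, real) frame" where G: "worlds G = (e \<circ> to_nat_on X) ` X"
    "ord G = {((e \<circ> to_nat_on X) i, (e \<circ> to_nat_on X) j) | i j. i \<in> X \<and> j \<in> X \<and> (i = j \<or> Up i \<subseteq> Fl j)}"
    "partial_order_on (worlds G) (ord G)"
    "\<forall>w\<in>worlds G. \<exists>N\<ge>1. P N \<and> alg G w = Luk (Suc N)" "\<not> G \<tturnstile> t"
    using refuting_frame[OF gA h S_def X(2) \<gamma> emb[OF S(1,2)]] by blast
  have "finite (worlds G)" using G(1) X(1) by simp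
  moreover have "total_on (worlds G) (ord G)"
    unfolding total_on_def G(1,2) using lin by blast
  ultimately have "(worlds G, ord G) \<in> finite_chains"
    using G(3) by (simp add: finite_chains_def linear_order_on_def)
  then show ?thesis using G(4,5) by (auto simp: Luk_frame_def)
qed

lemma Luk_frame_gbl_frame: "\<lbrakk>Luk_frame Q P G; Q \<subseteq> posets\<rbrakk> \<Longrightarrow> gbl_frame G"
  by (rule gbl_frame_Luk) (auto simp: Luk_frame_def posets_def)

lemma Luk_frame_frames:
  assumes "Luk_frame Q P G" "Q \<subseteq> posets" "\<And>N. \<lbrakk>N \<ge> 1; P N\<rbrakk> \<Longrightarrow> Luk (Suc N) \<in> C"
  shows "G \<in> frames Q C"
proof -
  interpret gbl_frame G by (rule Luk_frame_gbl_frame[OF assms(1,2)])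
  have L: "\<exists>N\<ge>1. P N \<and> alg G w = Luk (Suc N)" if "w \<in> worlds G" for w
    using assms(1) that by (simp add: Luk_frame_def)
  have "rzero (alg G w) = 0 \<and> one (alg G w) = 1" if "w \<in> worlds G" for w
    using L[OF that] by auto
  moreover have "alg G w \<in> C" if "w \<in> worlds G" for w
    using L[OF that] assms(3) by auto
  ultimately show ?thesis
    using assms(1) po rl by (simp add: frames_def is_frame_def Luk_frame_def)
qed

lemma unit_countermodel:
  assumes G: "Luk_frame Q P G" "\<not> G \<tturnstile> t" and Q: "Q \<subseteq> posets"
  shows "\<exists>F\<in>frames Q {MV_unit}. \<not> F \<tturnstile> t"
proof -
  define F where "F = G\<lparr>alg := \<lambda>_. MV_unit\<rparr>"
  interpret G: gbl_frame G by (rule Luk_frame_gbl_frame[OF G(1) Q])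
  have gM: "gbl_algebra MV_unit" using MV_unit_props(1) by (simp add: mv_algebra_def bl_algebra_def)
  have gF: "gbl_frame F" using G.po gM by (intro gbl_frame.intro) (simp_all add: F_def)
  have "F \<in> frames Q {MV_unit}"
    using G(1) G.po gM by (simp add: frames_def is_frame_def F_def Luk_frame_def gbl_algebra_def)
  moreover have "embeds id (alg G w) (alg F w)" if "w \<in> worlds G" for w
  proof -
    obtain N where "N \<ge> 1" "alg G w = Luk (Suc N)" using G(1) \<open>w \<in> worlds G\<close> by (auto simp: Luk_frame_def)
    then show ?thesis using Luk_props(5) by (auto simp: embeds_def F_def MV_unit_def)
  qed
  then have "F \<tturnstile> t \<Longrightarrow> G \<tturnstile> t"
    by (intro forces_embedding[OF G.gbl_frame_axioms gF]) (simp_all add: F_def)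
  ultimately show ?thesis using G(2) by blast
qed

text \<open>All value algebras of \<open>G\<close> consist of rationals, so one injection of the
  rationals into \<open>'b\<close> copies them. Using the same injection at every point keeps the
  bounds common, as a frame requires.\<close>

lemma copy_countermodel:
  fixes G :: "('x, real) frame" and C :: "'b::infinite rlat set"
  assumes G: "Luk_frame Q P G" "\<not> G \<tturnstile> t" and Q: "Q \<subseteq> posets"
    and C: "\<And>N (g :: real \<Rightarrow> 'b). \<lbrakk>N \<ge> 1; P N; inj_on g (carrier (Luk (Suc N)))\<rbrakk> \<Longrightarrow>
      image_alg g (carrier (Luk (Suc N))) (Luk (Suc N)) \<in> C"
    and gC: "\<And>A. A \<in> C \<Longrightarrow> gbl_algebra A"
  shows "\<exists>F\<in>frames Q C. \<not> F \<tturnstile> t"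
proof -
  obtain e :: "nat \<Rightarrow> 'b" where "inj e"
    using infinite_countable_subset[OF infinite_UNIV] by blast
  define g where "g = e \<circ> to_nat_on (\<rat> :: real set)"
  have g: "inj_on g \<rat>"
    unfolding g_def using \<open>inj e\<close> countable_rat by (meson comp_inj_on inj_on_subset inj_on_to_nat_on subset_UNIV)
  define F :: "('x, 'b) frame" where
    "F = \<lparr>worlds = worlds G, ord = ord G, alg = \<lambda>w. image_alg g (carrier (alg G w)) (alg G w)\<rparr>"
  interpret G: gbl_frame G by (rule Luk_frame_gbl_frame[OF G(1) Q])
  have inj: "inj_on g (carrier (alg G w))" and mem: "alg F w \<in> C" and bounds: "rzero (alg F w) = g 0" "one (alg F w) = g 1"
    if "w \<in> worlds G" for w
  proof -
    obtain N where N: "N \<ge> 1" "P N" "alg G w = Luk (Suc N)" using G(1) \<open>w \<in> worlds G\<close> by (auto simp: Luk_frame_def)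
    show i: "inj_on g (carrier (alg G w))" using inj_on_subset[OF g Luk_props(6)[OF N(1)]] N(3) by simp
    show "alg F w \<in> C" using C[OF N(1,2)] i N(3) by (simp add: F_def)
    show "rzero (alg F w) = g 0" "one (alg F w) = g 1" using N(3) by (simp_all add: F_def)
  qed
  have wF: "worlds F = worlds G" "ord F = ord G" by (simp_all add: F_def)
  have gF: "gbl_frame F" using G.po mem gC by (intro gbl_frame.intro) (simp_all add: wF)
  have "residuated_lattice (alg F w)" if "w \<in> worlds G" for w
    using gC[OF mem[OF that]] by (simp add: gbl_algebra_def)
  then have "F \<in> frames Q C"
    using G(1) G.po mem bounds by (simp add: frames_def is_frame_def wF Luk_frame_def)
  moreover have "embeds g (alg G w) (alg F w)" if "w \<in> worlds G" for w
    using embeds_image_alg[OF inj[OF that]] by (simp add: F_def)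
  then have "F \<tturnstile> t \<Longrightarrow> G \<tturnstile> t"
    by (intro forces_embedding[OF G.gbl_frame_axioms gF wF])
  ultimately show ?thesis using G(2) by blast
qed

lemma Luk_gbl: "N \<ge> 1 \<Longrightarrow> gbl_algebra (Luk (Suc N))"
  using Luk_props(1) by (simp add: mv_algebra_def bl_algebra_def)

lemma Luk_class: "A \<in> {Luk k | k. k \<ge> 2} \<Longrightarrow> gbl_algebra A \<and> is_chain A"
proof -
  assume "A \<in> {Luk k | k. k \<ge> 2}"
  then obtain k where k: "k \<ge> 2" "A = Luk k" by blast
  then have "A = Luk (Suc (k - 1))" "k - 1 \<ge> 1" by simp_all
  then show ?thesis using Luk_gbl[of "k - 1"] Luk_props(2)[of "k - 1"] by metis
qed

theorem theorem5p3:
  shows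
    "sound_and_complete (frames posets {MV_unit} :: ('x::infinite, real) frame set)
       (GBL :: 'a::infinite rlat set)
     \<and> sound_and_complete (frames posets finite_simple_MV_chains :: ('x, 'b::infinite) frame set)
       (GBL :: 'a rlat set)
     \<and> sound_and_complete (frames root_systems {MV_unit} :: ('x, real) frame set)
       (BL :: 'a rlat set)
     \<and> sound_and_complete (frames root_systems {Luk k | k. k \<ge> 2} :: ('x, real) frame set)
       (BL :: 'a rlat set)
     \<and> sound_and_complete (frames finite_chains {Luk k | k. k \<ge> 2} :: ('x, real) frame set)
       (BL :: 'a rlat set)
     \<and> (\<forall>k\<ge>2. sound_and_complete
           (frames posets (potent k finite_simple_MV_chains) :: ('x, 'b) frame set)
           (potent k GBL :: 'a rlat set))
     \<and> (\<forall>k\<ge>2. sound_and_complete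
           (frames root_systems (potent k finite_simple_MV_chains) :: ('x, 'b) frame set)
           (potent k BL :: 'a rlat set))
     \<and> sound_and_complete (frames posets {Luk 2} :: ('x, real) frame set) (HA :: 'a rlat set)
     \<and> sound_and_complete (frames root_systems {Luk 2} :: ('x, real) frame set) (GA :: 'a rlat set)"
proof -
  let ?MV = "finite_simple_MV_chains :: 'b rlat set"
  have unit: "gbl_algebra A" "is_chain A" if "A \<in> {MV_unit}" for A
    using that MV_unit_props by (simp_all add: mv_algebra_def bl_algebra_def)
  have MV: "gbl_algebra A" "is_chain A" if "A \<in> ?MV" for A
    using that by (simp_all add: finite_simple_MV_chains_def mv_algebra_def bl_algebra_def)
  have potMV: "gbl_algebra A" "is_chain A" "x \<in> carrier A \<Longrightarrow> x [^]\<^bsub>A\<^esub> (k + 1) = x [^]\<^bsub>A\<^esub> k"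
    if "A \<in> potent k ?MV" for A k x
    using that MV unfolding potent_def by blast+
  have two: "Luk 2 = Luk (Suc 1)" by (simp add: numeral_2_eq_2)
  have Luk2: "gbl_algebra A" "is_chain A" "x \<in> carrier A \<Longrightarrow> x [^]\<^bsub>A\<^esub> (1 + 1 :: nat) = x [^]\<^bsub>A\<^esub> (1 :: nat)"
    if "A \<in> {Luk 2}" for A x
    using that Luk_gbl[of 1] Luk_props(2)[of 1] Luk_potent[of 1 1 x] unfolding two by blast+
  have chains_posets: "(finite_chains :: ('x set \<times> 'x rel) set) \<subseteq> posets"
    using finite_chains_root_systems root_systems_posets by blast
  have root_frame: "Luk_frame root_systems P G" if "Luk_frame finite_chains P G" for P and G :: "('x, real) frame"
    using that finite_chains_root_systems by (auto simp: Luk_frame_def)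

  have GBL_cm: "\<exists>G :: ('x, real) frame. Luk_frame posets (\<lambda>_. True) G \<and> \<not> G \<tturnstile> t"
    if "A \<in> GBL" "\<And>v. h v \<in> carrier A" "eval A h t \<noteq> \<one>\<^bsub>A\<^esub>" for A :: "'a rlat" and h t
    by (rule countermodel_GBL[OF _ that(2,3)])
      (use that(1) vfilter.local_emb_upper in \<open>auto simp: GBL_def\<close>)
  have BL_cm: "\<exists>G :: ('x, real) frame. Luk_frame finite_chains (\<lambda>_. True) G \<and> \<not> G \<tturnstile> t"
    if "A \<in> BL" "\<And>v. h v \<in> carrier A" "eval A h t \<noteq> \<one>\<^bsub>A\<^esub>" for A :: "'a rlat" and h t
    by (rule countermodel_BL[OF _ that(2,3)])
      (use that(1) vfilter.local_emb_upper in \<open>auto simp: BL_def\<close>)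
  have pot: "x [^]\<^bsub>A\<^esub> (k + 1) = x [^]\<^bsub>A\<^esub> k" if "A \<in> potent k V" "x \<in> carrier A" for A :: "'a rlat" and k V x
    using that by (simp only: potent_def) blast
  have GBLk_cm: "\<exists>G :: ('x, real) frame. Luk_frame posets (\<lambda>N. N \<le> k) G \<and> \<not> G \<tturnstile> t"
    if A: "A \<in> potent k GBL" and h: "\<And>v. h v \<in> carrier A" "eval A h t \<noteq> \<one>\<^bsub>A\<^esub>" for A :: "'a rlat" and h t k
  proof (rule countermodel_GBL[OF _ h])
    show "gbl_algebra A" using A by (simp add: potent_def GBL_def)
    show "\<exists>N \<psi>. 1 \<le> N \<and> N \<le> k \<and> local_emb A S F (vfilter.upper A F c) N \<psi>"
      if "finite S" "S \<subseteq> carrier A" "vfilter A F c" for S F c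
      by (rule vfilter.local_emb_upper_potent[OF that(3,1,2) pot[OF A]])
  qed
  have BLk_cm: "\<exists>G :: ('x, real) frame. Luk_frame finite_chains (\<lambda>N. N \<le> k) G \<and> \<not> G \<tturnstile> t"
    if A: "A \<in> potent k BL" and h: "\<And>v. h v \<in> carrier A" "eval A h t \<noteq> \<one>\<^bsub>A\<^esub>" for A :: "'a rlat" and h t k
  proof (rule countermodel_BL[OF _ h])
    show "bl_algebra A" using A by (simp add: potent_def BL_def)
    show "\<exists>N \<psi>. 1 \<le> N \<and> N \<le> k \<and> local_emb A S F (vfilter.upper A F c) N \<psi>"
      if "finite S" "S \<subseteq> carrier A" "vfilter A F c" for S F c
      by (rule vfilter.local_emb_upper_potent[OF that(3,1,2) pot[OF A]])
  qed

  have "complete_for (frames posets {MV_unit} :: ('x, real) frame set) (GBL :: 'a rlat set)"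
    by (rule completeI) (use GBL_cm unit_countermodel in blast)
  moreover have "complete_for (frames posets ?MV :: ('x, 'b) frame set) (GBL :: 'a rlat set)"
  proof (rule completeI)
    fix A :: "'a rlat" and h t assume "A \<in> GBL" "\<And>v. h v \<in> carrier A" "eval A h t \<noteq> \<one>\<^bsub>A\<^esub>"
    then obtain G :: "('x, real) frame" where "Luk_frame posets (\<lambda>_. True) G" "\<not> G \<tturnstile> t" using GBL_cm by blast
    then show "\<exists>F\<in>(frames posets ?MV :: ('x, 'b) frame set). \<not> F \<tturnstile> t"
      by (rule copy_countermodel) (simp_all add: Luk_copy(1) MV(1))
  qed
  moreover have "complete_for (frames root_systems {MV_unit} :: ('x, real) frame set) (BL :: 'a rlat set)"
    by (rule completeI) (use BL_cm root_frame unit_countermodel root_systems_posets in blast)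
  moreover have "complete_for (frames root_systems {Luk k | k. k \<ge> 2} :: ('x, real) frame set) (BL :: 'a rlat set)"
  proof (rule completeI)
    fix A :: "'a rlat" and h t assume "A \<in> BL" "\<And>v. h v \<in> carrier A" "eval A h t \<noteq> \<one>\<^bsub>A\<^esub>"
    then obtain G :: "('x, real) frame" where G: "Luk_frame root_systems (\<lambda>_. True) G" "\<not> G \<tturnstile> t"
      using BL_cm root_frame by blast
    have "G \<in> frames root_systems {Luk k | k. k \<ge> 2}"
      by (rule Luk_frame_frames[OF G(1) root_systems_posets]) auto
    then show "\<exists>F\<in>(frames root_systems {Luk k | k. k \<ge> 2} :: ('x, real) frame set). \<not> F \<tturnstile> t" using G(2) by blast
  qed
  moreover have "complete_for (frames finite_chains {Luk k | k. k \<ge> 2} :: ('x, real) frame set) (BL :: 'a rlat set)"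
  proof (rule completeI)
    fix A :: "'a rlat" and h t assume "A \<in> BL" "\<And>v. h v \<in> carrier A" "eval A h t \<noteq> \<one>\<^bsub>A\<^esub>"
    then obtain G :: "('x, real) frame" where G: "Luk_frame finite_chains (\<lambda>_. True) G" "\<not> G \<tturnstile> t"
      using BL_cm by blast
    have "G \<in> frames finite_chains {Luk k | k. k \<ge> 2}"
      by (rule Luk_frame_frames[OF G(1) chains_posets]) auto
    then show "\<exists>F\<in>(frames finite_chains {Luk k | k. k \<ge> 2} :: ('x, real) frame set). \<not> F \<tturnstile> t" using G(2) by blast
  qed
  moreover have "complete_for (frames posets (potent k ?MV) :: ('x, 'b) frame set) (potent k GBL :: 'a rlat set)" for k
  proof (rule completeI)
    fix A :: "'a rlat" and h t assume "A \<in> potent k GBL" "\<And>v. h v \<in> carrier A" "eval A h t \<noteq> \<one>\<^bsub>A\<^esub>"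
    then obtain G :: "('x, real) frame" where "Luk_frame posets (\<lambda>N. N \<le> k) G" "\<not> G \<tturnstile> t" using GBLk_cm by blast
    then show "\<exists>F\<in>(frames posets (potent k ?MV) :: ('x, 'b) frame set). \<not> F \<tturnstile> t"
      by (rule copy_countermodel) (simp_all add: Luk_copy(2) potMV(1))
  qed
  moreover have "complete_for (frames root_systems (potent k ?MV) :: ('x, 'b) frame set) (potent k BL :: 'a rlat set)" for k
  proof (rule completeI)
    fix A :: "'a rlat" and h t assume "A \<in> potent k BL" "\<And>v. h v \<in> carrier A" "eval A h t \<noteq> \<one>\<^bsub>A\<^esub>"
    then obtain G :: "('x, real) frame" where "Luk_frame root_systems (\<lambda>N. N \<le> k) G" "\<not> G \<tturnstile> t"
      using BLk_cm root_frame by blast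
    then show "\<exists>F\<in>(frames root_systems (potent k ?MV) :: ('x, 'b) frame set). \<not> F \<tturnstile> t"
      by (rule copy_countermodel) (simp_all add: Luk_copy(2) potMV(1) root_systems_posets)
  qed
  moreover have "complete_for (frames posets {Luk 2} :: ('x, real) frame set) (HA :: 'a rlat set)"
    unfolding HA_potent
  proof (rule completeI)
    fix A :: "'a rlat" and h t assume "A \<in> potent 1 GBL" "\<And>v. h v \<in> carrier A" "eval A h t \<noteq> \<one>\<^bsub>A\<^esub>"
    then obtain G :: "('x, real) frame" where G: "Luk_frame posets (\<lambda>N. N \<le> 1) G" "\<not> G \<tturnstile> t" using GBLk_cm by blast
    \<comment> \<open>The bounds \<open>1 \<le> N\<close> and \<open>N \<le> 1\<close> leave only
      the two-element chain.\<close>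
    have "G \<in> frames posets {Luk 2}"
      by (rule Luk_frame_frames[OF G(1)]) (auto simp: two le_antisym)
    then show "\<exists>F\<in>(frames posets {Luk 2} :: ('x, real) frame set). \<not> F \<tturnstile> t" using G(2) by blast
  qed
  moreover have "complete_for (frames root_systems {Luk 2} :: ('x, real) frame set) (GA :: 'a rlat set)"
    unfolding GA_potent
  proof (rule completeI)
    fix A :: "'a rlat" and h t assume "A \<in> potent 1 BL" "\<And>v. h v \<in> carrier A" "eval A h t \<noteq> \<one>\<^bsub>A\<^esub>"
    then obtain G :: "('x, real) frame" where G: "Luk_frame root_systems (\<lambda>N. N \<le> 1) G" "\<not> G \<tturnstile> t"
      using BLk_cm root_frame by blast
    have "G \<in> frames root_systems {Luk 2}"
      by (rule Luk_frame_frames[OF G(1) root_systems_posets]) (auto simp: two le_antisym)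
    then show "\<exists>F\<in>(frames root_systems {Luk 2} :: ('x, real) frame set). \<not> F \<tturnstile> t" using G(2) by blast
  qed
  moreover have "sound (frames posets {MV_unit} :: ('x, real) frame set) (GBL :: 'a rlat set)"
    by (rule sound_GBL[OF subset_refl unit(1)])
  moreover have "sound (frames posets ?MV :: ('x, 'b) frame set) (GBL :: 'a rlat set)"
    by (rule sound_GBL[OF subset_refl MV(1)])
  moreover have "sound (frames root_systems {MV_unit} :: ('x, real) frame set) (BL :: 'a rlat set)"
    by (rule sound_BL[OF subset_refl unit])
  moreover have "sound (frames root_systems {Luk k | k. k \<ge> 2} :: ('x, real) frame set) (BL :: 'a rlat set)"
    by (rule sound_BL[OF subset_refl]) (use Luk_class in blast)+
  moreover have "sound (frames finite_chains {Luk k | k. k \<ge> 2} :: ('x, real) frame set) (BL :: 'a rlat set)"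
    by (rule sound_BL[OF finite_chains_root_systems]) (use Luk_class in blast)+
  moreover have "sound (frames posets (potent k ?MV) :: ('x, 'b) frame set) (potent k GBL :: 'a rlat set)" for k
    by (rule sound_potent_GBL[OF subset_refl potMV(1,3)])
  moreover have "sound (frames root_systems (potent k ?MV) :: ('x, 'b) frame set) (potent k BL :: 'a rlat set)" for k
    by (rule sound_potent_BL[OF subset_refl potMV])
  moreover have "sound (frames posets {Luk 2} :: ('x, real) frame set) (HA :: 'a rlat set)"
    unfolding HA_potent by (rule sound_potent_GBL[OF subset_refl Luk2(1,3)])
  moreover have "sound (frames root_systems {Luk 2} :: ('x, real) frame set) (GA :: 'a rlat set)"
    unfolding GA_potent by (rule sound_potent_BL[OF subset_refl Luk2])
  ultimately show ?thesis unfolding sound_and_complete_def by simp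
qed

end
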